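(* Let $m\in I$ and suppose that $\emptyset\nVdash WPHP^{2m}_m(\Delta^b_1(R))$, i.e. there is a $\Delta^b_1(R)$-formula $\phi(x,y)$ with parameters from $I$ such that the empty condition does not force $WPHP^{2m}_m(\phi)$. Then there exist $\sigma\in\mathbb{P}$, a standard $c$ and $k\in\mathbb{M}$ with $k\leq|n|^c$ such that an $(m,k,\sigma)$-WPHP-array exists.
   Context: Language $L$: constants $0,1$; unary $\lfloor x/2\rfloor$, $|x|$ (bit-length); binary $+,\cdot$, $x\#y=2^{|x|\cdot|y|}$; relation $<$; $L(R)$ adds a binary relation symbol $R$. Sharply bounded quantifiers: $\forall x<|t|$, $\exists x<|t|$. $\Sigma^b_1(R)$-formulas: built from atomic $L(R)$-formulas by connectives and sharply bounded quantifiers, with bounded existential quantifiers $\exists x<t$ in front; $\Pi^b_1(R)$ dually. $S^1_2(R)$ is BASIC plus polynomial induction for $\Sigma^b_1(R)$-formulas; a $\Delta^b_1(R)$-formula is a $\Sigma^b_1(R)$-formula that $S^1_2(R)$ proves equivalent to a $\Pi^b_1(R)$-formula. $WPHP^{2m}_m(\phi)$ is the disjunction of: $\exists a<2m\,\forall b<m\,\neg\phi(a,b)$; $\exists a\neq a'<2m\,\exists b<m\,(\phi(a,b)\wedge\phi(a',b))$; $\exists a<2m\,\exists b\neq b'<m\,(\phi(a,b)\wedge\phi(a,b'))$. Setting: $\mathbb{M}$ is a countable nonstandard model of $Th(\mathbb{N})$ in $L$, $n\in\mathbb{M}$ nonstandard, $[x]=\{y\in\mathbb{M}:y<x\}$,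 $I=\{y\in\mathbb{M}:y<2^{|n|^c}$ for some standard $c\}$, $\mathbb{I}$ the corresponding substructure. $\mathbb{P}$: partial injective functions $\sigma\in\mathbb{M}$ from $[n+1]$ to $[n]$ with $|\sigma|\leq|n|^c$ for some standard $c$; $\tau\leq\sigma$ iff $\tau\supseteq\sigma$; $\sigma\|\tau$ iff $\sigma\cup\tau\in\mathbb{P}$, else $\sigma\perp\tau$. $D\subseteq\mathbb{P}$ is $\mathbb{P}$-definable if definable in $(\mathbb{M},\mathbb{P})$, dense if every condition has an extension in $D$. A filter is a pairwise compatible upward closed (under taking subsets in $\mathbb{P}$) $G\subseteq\mathbb{P}$; generic if it meets every dense $\mathbb{P}$-definable set. For generic $G$, $(\mathbb{I},R_G)$ is the $L(R)$-structure with universe $I$ and $R$ interpreted by $R_G=\bigcup G$. For an $L(R)$-sentence $\phi$ (parameters from $I$), $\sigma\Vdash\phi$ iff $(\mathbb{I},R_G)\models\phi$ for all generic $G\ni\sigma$. An $(m,k,\sigma)$-WPHP-array is an array $A\in\mathbb{M}$ indexed by $[2m]\times[m]$ whose entries are sets of conditions of size at most $k$, each compatible with $\sigma$ and disjoint from $\sigma$, such that: (1) for $a\neq a'$, $b\neq b'$: $A(a,b)\cap A(a',b)=A(a,b)\cap A(a,b')=\emptyset$; (2) distinct $\tau\in A(a,b)$, $\tau'\in A(a',b)$ are incompatible; (3) distinct $\tau\in A(a,b)$, $\tau'\in A(a,b')$ are incompatible; (4) for every $\rho\leq\sigma$ in $\mathbb{P}$ and every $a\in[2m]$ there are $b\in[m]$,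 $\tau\in A(a,b)$ with $\tau\|\rho$. *)

theory Defs
  imports "HOL-Library.Countable_Set" "HOL-Library.Log_Nat"
begin

section \<open>Syntax of the languages L and L(R)\<close>

text \<open>Variables are de Bruijn indices. \<open>Half t\<close>, \<open>Len t\<close> and \<open>s \<^bold># t\<close> stand for
  the floor of t/2, for |t| and for s#t. Free variables also serve as parameters: a sentence
  with parameters is a formula together with an assignment \<open>e :: nat \<Rightarrow> 'a\<close> for its free variables.\<close>

datatype trm =
    Var nat
  | Zero
  | One
  | Half trm
  | Len trm
  | Plus trm trm (infixl \<open>\<^bold>+\<close> 65)
  | Times trm trm (infixl \<open>\<^bold>*\<close> 70)
  | Smash trm trm (infixl \<open>\<^bold>#\<close> 75)

datatype fm =
    Fls
  | Eq trm trm (infix \<open>\<^bold>=\<close> 50)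
  | Less trm trm (infix \<open>\<^bold><\<close> 50)
  | Rel trm trm
  | Imp fm fm (infixr \<open>\<^bold>\<longrightarrow>\<close> 25)
  | Forall fm

definition Neg :: "fm \<Rightarrow> fm" (\<open>\<^bold>\<not> _\<close> [90] 90)
  where "(\<^bold>\<not> \<phi>) = (\<phi> \<^bold>\<longrightarrow> Fls)"

definition Disj :: "fm \<Rightarrow> fm \<Rightarrow> fm" (infixr \<open>\<^bold>\<or>\<close> 30)
  where "(\<phi> \<^bold>\<or> \<psi>) = (\<^bold>\<not> \<phi> \<^bold>\<longrightarrow> \<psi>)"

definition Conj :: "fm \<Rightarrow> fm \<Rightarrow> fm" (infixr \<open>\<^bold>\<and>\<close> 35)
  where "(\<phi> \<^bold>\<and> \<psi>) = \<^bold>\<not> (\<phi> \<^bold>\<longrightarrow> \<^bold>\<not> \<psi>)"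

definition Iff :: "fm \<Rightarrow> fm \<Rightarrow> fm" (infixr \<open>\<^bold>\<longleftrightarrow>\<close> 25)
  where "(\<phi> \<^bold>\<longleftrightarrow> \<psi>) = ((\<phi> \<^bold>\<longrightarrow> \<psi>) \<^bold>\<and> (\<psi> \<^bold>\<longrightarrow> \<phi>))"

definition Exists :: "fm \<Rightarrow> fm"
  where "Exists \<phi> = \<^bold>\<not> Forall (\<^bold>\<not> \<phi>)"

definition Leq :: "trm \<Rightarrow> trm \<Rightarrow> fm" (infix \<open>\<^bold>\<le>\<close> 50)
  where "(s \<^bold>\<le> t) = (s \<^bold>< t \<^bold>\<or> s \<^bold>= t)"

primrec tsubst :: "(nat \<Rightarrow> trm) \<Rightarrow> trm \<Rightarrow> trm" where
  "tsubst f (Var i) = f i"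
| "tsubst f Zero = Zero"
| "tsubst f One = One"
| "tsubst f (Half t) = Half (tsubst f t)"
| "tsubst f (Len t) = Len (tsubst f t)"
| "tsubst f (s \<^bold>+ t) = tsubst f s \<^bold>+ tsubst f t"
| "tsubst f (s \<^bold>* t) = tsubst f s \<^bold>* tsubst f t"
| "tsubst f (s \<^bold># t) = tsubst f s \<^bold># tsubst f t"

abbreviation tlift :: "trm \<Rightarrow> trm"
  where "tlift \<equiv> tsubst (\<lambda>i. Var (Suc i))"

primrec fsubst :: "(nat \<Rightarrow> trm) \<Rightarrow> fm \<Rightarrow> fm" where
  "fsubst f Fls = Fls"
| "fsubst f (s \<^bold>= t) = (tsubst f s \<^bold>= tsubst f t)"
| "fsubst f (s \<^bold>< t) = (tsubst f s \<^bold>< tsubst f t)"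
| "fsubst f (Rel s t) = Rel (tsubst f s) (tsubst f t)"
| "fsubst f (\<phi> \<^bold>\<longrightarrow> \<psi>) = (fsubst f \<phi> \<^bold>\<longrightarrow> fsubst f \<psi>)"
| "fsubst f (Forall \<phi>) = Forall (fsubst (case_nat (Var 0) (\<lambda>i. tlift (f i))) \<phi>)"

abbreviation flift :: "fm \<Rightarrow> fm"
  where "flift \<equiv> fsubst (\<lambda>i. Var (Suc i))"

text \<open>Instantiation of the outermost variable: index 0 is replaced by t and removed.\<close>

abbreviation finst :: "trm \<Rightarrow> fm \<Rightarrow> fm"
  where "finst t \<equiv> fsubst (case_nat t Var)"

primrec tvars :: "trm \<Rightarrow> nat set" where
  "tvars (Var i) = {i}"
| "tvars Zero = {}"
| "tvars One = {}"
| "tvars (Half t) = tvars t"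
| "tvars (Len t) = tvars t"
| "tvars (s \<^bold>+ t) = tvars s \<union> tvars t"
| "tvars (s \<^bold>* t) = tvars s \<union> tvars t"
| "tvars (s \<^bold># t) = tvars s \<union> tvars t"

primrec fvars :: "fm \<Rightarrow> nat set" where
  "fvars Fls = {}"
| "fvars (s \<^bold>= t) = tvars s \<union> tvars t"
| "fvars (s \<^bold>< t) = tvars s \<union> tvars t"
| "fvars (Rel s t) = tvars s \<union> tvars t"
| "fvars (\<phi> \<^bold>\<longrightarrow> \<psi>) = fvars \<phi> \<union> fvars \<psi>"
| "fvars (Forall \<phi>) = {i. Suc i \<in> fvars \<phi>}"

text \<open>The formulas of L, i.e. those without R.\<close>

primrec R_free :: "fm \<Rightarrow> bool" where
  "R_free Fls \<longleftrightarrow> True"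
| "R_free (s \<^bold>= t) \<longleftrightarrow> True"
| "R_free (s \<^bold>< t) \<longleftrightarrow> True"
| "R_free (Rel s t) \<longleftrightarrow> False"
| "R_free (\<phi> \<^bold>\<longrightarrow> \<psi>) \<longleftrightarrow> R_free \<phi> \<and> R_free \<psi>"
| "R_free (Forall \<phi>) \<longleftrightarrow> R_free \<phi>"


section \<open>Formula classes\<close>

definition BAll :: "trm \<Rightarrow> fm \<Rightarrow> fm"
  where "BAll t \<phi> = Forall (Var 0 \<^bold>< tlift t \<^bold>\<longrightarrow> \<phi>)"

definition BEx :: "trm \<Rightarrow> fm \<Rightarrow> fm"
  where "BEx t \<phi> = Exists (Var 0 \<^bold>< tlift t \<^bold>\<and> \<phi>)"

inductive_set sharply_bounded :: "fm set" where
  "Fls \<in> sharply_bounded"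
| "(s \<^bold>= t) \<in> sharply_bounded"
| "(s \<^bold>< t) \<in> sharply_bounded"
| "Rel s t \<in> sharply_bounded"
| "\<phi> \<in> sharply_bounded \<Longrightarrow> \<psi> \<in> sharply_bounded \<Longrightarrow> (\<phi> \<^bold>\<longrightarrow> \<psi>) \<in> sharply_bounded"
| "\<phi> \<in> sharply_bounded \<Longrightarrow> BAll (Len t) \<phi> \<in> sharply_bounded"
| "\<phi> \<in> sharply_bounded \<Longrightarrow> BEx (Len t) \<phi> \<in> sharply_bounded"

inductive_set Sigma1b :: "fm set" where
  "\<phi> \<in> sharply_bounded \<Longrightarrow> \<phi> \<in> Sigma1b"
| "\<phi> \<in> Sigma1b \<Longrightarrow> BEx t \<phi> \<in> Sigma1b"

inductive_set Pi1b :: "fm set" where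
  "\<phi> \<in> sharply_bounded \<Longrightarrow> \<phi> \<in> Pi1b"
| "\<phi> \<in> Pi1b \<Longrightarrow> BAll t \<phi> \<in> Pi1b"


section \<open>Provability\<close>

text \<open>A Hilbert calculus for classical first-order logic with equality. Axioms with free
  variables are read universally, which is what the generalisation rule expresses.\<close>

inductive proves :: "fm set \<Rightarrow> fm \<Rightarrow> bool" (infix \<open>\<turnstile>\<close> 20) for T :: "fm set" where
  axiom: "\<phi> \<in> T \<Longrightarrow> T \<turnstile> \<phi>"
| weaken: "T \<turnstile> (\<phi> \<^bold>\<longrightarrow> \<psi> \<^bold>\<longrightarrow> \<phi>)"
| distrib: "T \<turnstile> ((\<phi> \<^bold>\<longrightarrow> \<psi> \<^bold>\<longrightarrow> \<chi>) \<^bold>\<longrightarrow> (\<phi> \<^bold>\<longrightarrow> \<psi>) \<^bold>\<longrightarrow> \<phi> \<^bold>\<longrightarrow> \<chi>)"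
| dbl_neg: "T \<turnstile> (((\<phi> \<^bold>\<longrightarrow> Fls) \<^bold>\<longrightarrow> Fls) \<^bold>\<longrightarrow> \<phi>)"
| inst: "T \<turnstile> (Forall \<phi> \<^bold>\<longrightarrow> finst t \<phi>)"
| all_distrib: "T \<turnstile> (Forall (\<phi> \<^bold>\<longrightarrow> \<psi>) \<^bold>\<longrightarrow> Forall \<phi> \<^bold>\<longrightarrow> Forall \<psi>)"
| vacuous: "T \<turnstile> (\<phi> \<^bold>\<longrightarrow> Forall (flift \<phi>))"
| eq_refl: "T \<turnstile> (t \<^bold>= t)"
| eq_subst: "T \<turnstile> (s \<^bold>= t \<^bold>\<longrightarrow> finst s \<phi> \<^bold>\<longrightarrow> finst t \<phi>)"
| modus_ponens: "T \<turnstile> (\<phi> \<^bold>\<longrightarrow> \<psi>) \<Longrightarrow> T \<turnstile> \<phi> \<Longrightarrow> T \<turnstile> \<psi>"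
| generalise: "T \<turnstile> \<phi> \<Longrightarrow> T \<turnstile> Forall \<phi>"

text \<open>Buss's axioms BASIC, with the successor of t written \<open>t \<^bold>+ One\<close>. Since \<open>\<^bold>\<le>\<close> is here
  defined from \<open>\<^bold><\<close>, irreflexivity of \<open>\<^bold><\<close> is added.\<close>

definition BASIC :: "fm set" where
  "BASIC = (let x = Var 0; y = Var 1; z = Var 2; u = Var 3; v = Var 4; two = One \<^bold>+ One in {
     \<^bold>\<not> (x \<^bold>< x),
     y \<^bold>\<le> x \<^bold>\<longrightarrow> y \<^bold>\<le> x \<^bold>+ One,
     \<^bold>\<not> (x \<^bold>= x \<^bold>+ One),
     Zero \<^bold>\<le> x,
     (x \<^bold>\<le> y \<^bold>\<and> \<^bold>\<not> (x \<^bold>= y)) \<^bold>\<longleftrightarrow> x \<^bold>+ One \<^bold>\<le> y,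
     \<^bold>\<not> (x \<^bold>= Zero) \<^bold>\<longrightarrow> \<^bold>\<not> (two \<^bold>* x \<^bold>= Zero),
     y \<^bold>\<le> x \<^bold>\<or> x \<^bold>\<le> y,
     x \<^bold>\<le> y \<^bold>\<and> y \<^bold>\<le> x \<^bold>\<longrightarrow> x \<^bold>= y,
     x \<^bold>\<le> y \<^bold>\<and> y \<^bold>\<le> z \<^bold>\<longrightarrow> x \<^bold>\<le> z,
     Len Zero \<^bold>= Zero,
     \<^bold>\<not> (x \<^bold>= Zero) \<^bold>\<longrightarrow> Len (two \<^bold>* x) \<^bold>= Len x \<^bold>+ One \<^bold>\<and> Len (two \<^bold>* x \<^bold>+ One) \<^bold>= Len x \<^bold>+ One,
     Len One \<^bold>= One,
     x \<^bold>\<le> y \<^bold>\<longrightarrow> Len x \<^bold>\<le> Len y,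
     Len (x \<^bold># y) \<^bold>= Len x \<^bold>* Len y \<^bold>+ One,
     Zero \<^bold># y \<^bold>= One,
     \<^bold>\<not> (x \<^bold>= Zero) \<^bold>\<longrightarrow>
       One \<^bold># (two \<^bold>* x) \<^bold>= two \<^bold>* (One \<^bold># x) \<^bold>\<and> One \<^bold># (two \<^bold>* x \<^bold>+ One) \<^bold>= two \<^bold>* (One \<^bold># x),
     x \<^bold># y \<^bold>= y \<^bold># x,
     Len x \<^bold>= Len y \<^bold>\<longrightarrow> x \<^bold># z \<^bold>= y \<^bold># z,
     Len x \<^bold>= Len u \<^bold>+ Len v \<^bold>\<longrightarrow> x \<^bold># y \<^bold>= (u \<^bold># y) \<^bold>* (v \<^bold># y),
     x \<^bold>\<le> x \<^bold>+ y,
     x \<^bold>\<le> y \<^bold>\<and> \<^bold>\<not> (x \<^bold>= y) \<^bold>\<longrightarrow>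
       two \<^bold>* x \<^bold>+ One \<^bold>\<le> two \<^bold>* y \<^bold>\<and> \<^bold>\<not> (two \<^bold>* x \<^bold>+ One \<^bold>= two \<^bold>* y),
     x \<^bold>+ y \<^bold>= y \<^bold>+ x,
     x \<^bold>+ Zero \<^bold>= x,
     x \<^bold>+ (y \<^bold>+ One) \<^bold>= (x \<^bold>+ y) \<^bold>+ One,
     (x \<^bold>+ y) \<^bold>+ z \<^bold>= x \<^bold>+ (y \<^bold>+ z),
     x \<^bold>+ y \<^bold>\<le> x \<^bold>+ z \<^bold>\<longleftrightarrow> y \<^bold>\<le> z,
     x \<^bold>* Zero \<^bold>= Zero,
     x \<^bold>* (y \<^bold>+ One) \<^bold>= x \<^bold>* y \<^bold>+ x,
     x \<^bold>* y \<^bold>= y \<^bold>* x,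
     x \<^bold>* (y \<^bold>+ z) \<^bold>= x \<^bold>* y \<^bold>+ x \<^bold>* z,
     One \<^bold>\<le> x \<^bold>\<longrightarrow> (x \<^bold>* y \<^bold>\<le> x \<^bold>* z \<^bold>\<longleftrightarrow> y \<^bold>\<le> z),
     \<^bold>\<not> (x \<^bold>= Zero) \<^bold>\<longrightarrow> Len x \<^bold>= Len (Half x) \<^bold>+ One,
     x \<^bold>= Half y \<^bold>\<longleftrightarrow> (two \<^bold>* x \<^bold>= y \<^bold>\<or> two \<^bold>* x \<^bold>+ One \<^bold>= y) })"

text \<open>Polynomial induction on the variable 0 of \<open>\<phi>\<close>; the other variables are side parameters.\<close>

definition PIND :: "fm \<Rightarrow> fm" where
  "PIND \<phi> = (finst Zero \<phi> \<^bold>\<and> Forall (fsubst (\<lambda>i. if i = 0 then Half (Var 0) else Var i) \<phi> \<^bold>\<longrightarrow> \<phi>)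
     \<^bold>\<longrightarrow> Forall \<phi>)"

definition S12 :: "fm set"
  where "S12 = BASIC \<union> PIND ` Sigma1b"

definition Delta1b :: "fm set"
  where "Delta1b = {\<phi> \<in> Sigma1b. \<exists>\<psi>\<in>Pi1b. S12 \<turnstile> (\<phi> \<^bold>\<longleftrightarrow> \<psi>)}"


section \<open>The weak pigeonhole principle\<close>

text \<open>The variables 0 and 1 of \<open>\<phi>\<close> are the arguments x and y, and its variable i + 2 is its i-th
  parameter. In \<open>WPHP \<phi>\<close> the variable 0 is m and variable i + 1 is the i-th parameter of \<open>\<phi>\<close>.
  Under d quantifiers, \<open>app d a b \<phi>\<close> is \<open>\<phi>\<close> applied to the variables a and b.\<close>

definition app :: "nat \<Rightarrow> nat \<Rightarrow> nat \<Rightarrow> fm \<Rightarrow> fm" where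
  "app d a b = fsubst (case_nat (Var a) (case_nat (Var b) (\<lambda>i. Var (i + 1 + d))))"

definition WPHP :: "fm \<Rightarrow> fm" where
  "WPHP \<phi> = (let two = One \<^bold>+ One in
     BEx (two \<^bold>* Var 0) (BAll (Var 1) (\<^bold>\<not> app 2 1 0 \<phi>))
   \<^bold>\<or> BEx (two \<^bold>* Var 0) (BEx (two \<^bold>* Var 1) (\<^bold>\<not> (Var 1 \<^bold>= Var 0) \<^bold>\<and>
       BEx (Var 2) (app 3 2 0 \<phi> \<^bold>\<and> app 3 1 0 \<phi>)))
   \<^bold>\<or> BEx (two \<^bold>* Var 0) (BEx (Var 1) (BEx (Var 2) (\<^bold>\<not> (Var 1 \<^bold>= Var 0) \<^bold>\<and>
       (app 3 2 1 \<phi> \<^bold>\<and> app 3 2 0 \<phi>)))))"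


section \<open>Semantics\<close>

text \<open>Interpretations of L on the type \<open>'a\<close>. Satisfaction is relative to a universe \<open>D :: 'a set\<close>,
  so that (UNIV, M) is a structure M and (D, M) its substructure on a closed set D.\<close>

record 'a interp =
  zero :: 'a
  one :: 'a
  half :: "'a \<Rightarrow> 'a"
  len :: "'a \<Rightarrow> 'a"
  plus :: "'a \<Rightarrow> 'a \<Rightarrow> 'a"
  times :: "'a \<Rightarrow> 'a \<Rightarrow> 'a"
  smash :: "'a \<Rightarrow> 'a \<Rightarrow> 'a"
  less :: "'a \<Rightarrow> 'a \<Rightarrow> bool"

primrec val :: "'a interp \<Rightarrow> (nat \<Rightarrow> 'a) \<Rightarrow> trm \<Rightarrow> 'a" where
  "val M e (Var i) = e i"
| "val M e Zero = zero M"
| "val M e One = one M"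
| "val M e (Half t) = half M (val M e t)"
| "val M e (Len t) = len M (val M e t)"
| "val M e (s \<^bold>+ t) = plus M (val M e s) (val M e t)"
| "val M e (s \<^bold>* t) = times M (val M e s) (val M e t)"
| "val M e (s \<^bold># t) = smash M (val M e s) (val M e t)"

primrec sat :: "'a interp \<Rightarrow> 'a set \<Rightarrow> ('a \<times> 'a) set \<Rightarrow> (nat \<Rightarrow> 'a) \<Rightarrow> fm \<Rightarrow> bool" where
  "sat M D R e Fls \<longleftrightarrow> False"
| "sat M D R e (s \<^bold>= t) \<longleftrightarrow> val M e s = val M e t"
| "sat M D R e (s \<^bold>< t) \<longleftrightarrow> less M (val M e s) (val M e t)"
| "sat M D R e (Rel s t) \<longleftrightarrow> (val M e s, val M e t) \<in> R"
| "sat M D R e (\<phi> \<^bold>\<longrightarrow> \<psi>) \<longleftrightarrow> (sat M D R e \<phi> \<longrightarrow> sat M D R e \<psi>)"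
| "sat M D R e (Forall \<phi>) \<longleftrightarrow> (\<forall>x\<in>D. sat M D R (case_nat x e) \<phi>)"

definition standard :: "nat interp" where
  "standard = \<lparr>
     zero = 0,
     one = 1,
     half = (\<lambda>x. x div 2),
     len = (\<lambda>x. nat (bitlen (int x))),
     plus = (+),
     times = (*),
     smash = (\<lambda>x y. 2 ^ (nat (bitlen (int x)) * nat (bitlen (int y)))),
     less = (<) \<rparr>"

definition models_Th_N :: "'a interp \<Rightarrow> bool" where
  "models_Th_N M \<longleftrightarrow> (\<forall>\<phi>. R_free \<phi> \<longrightarrow> fvars \<phi> = {} \<longrightarrow>
     (\<forall>e. sat standard UNIV {} e \<phi>) \<longrightarrow> (\<forall>e. sat M UNIV {} e \<phi>))"

definition numeral_of :: "'a interp \<Rightarrow> nat \<Rightarrow> 'a"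
  where "numeral_of M k = ((\<lambda>x. plus M x (one M)) ^^ k) (zero M)"

definition nonstandard :: "'a interp \<Rightarrow> 'a \<Rightarrow> bool"
  where "nonstandard M x \<longleftrightarrow> x \<notin> range (numeral_of M)"


section \<open>Finite sets in the sense of M\<close>

definition seg :: "'a interp \<Rightarrow> 'a \<Rightarrow> 'a set"
  where "seg M x = {y. less M y x}"

definition leq :: "'a interp \<Rightarrow> 'a \<Rightarrow> 'a \<Rightarrow> bool"
  where "leq M x y \<longleftrightarrow> less M x y \<or> x = y"

text \<open>An element s of M codes the set of positions of the ones in its binary expansion:
  if \<open>len M z = y\<close> then \<open>smash M z (one M)\<close> is the y-th power of 2 in the sense of M.\<close>

definition ext :: "'a interp \<Rightarrow> 'a \<Rightarrow> 'a set" where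
  "ext M s = {y. \<exists>z u v. len M z = y \<and> less M v (smash M z (one M)) \<and>
     s = plus M (times M (plus M (times M (plus M (one M) (one M)) u) (one M)) (smash M z (one M))) v}"

text \<open>The pair (a, b) is coded by (a + b)(a + b) + a.\<close>

definition pair :: "'a interp \<Rightarrow> 'a \<Rightarrow> 'a \<Rightarrow> 'a" where
  "pair M a b = plus M (times M (plus M a b) (plus M a b)) a"

definition graph :: "'a interp \<Rightarrow> 'a \<Rightarrow> ('a \<times> 'a) set"
  where "graph M s = {(a, b). pair M a b \<in> ext M s}"

text \<open>The set coded by s has k elements in the sense of M: M contains a bijection onto [k].\<close>

definition has_card :: "'a interp \<Rightarrow> 'a \<Rightarrow> 'a \<Rightarrow> bool" where
  "has_card M s k \<longleftrightarrow>
     (\<exists>f h. bij_betw h (ext M s) (seg M k) \<and> ext M f = (\<lambda>x. pair M x (h x)) ` ext M s)"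

definition len_pow :: "'a interp \<Rightarrow> 'a \<Rightarrow> nat \<Rightarrow> 'a"
  where "len_pow M n c = (times M (len M n) ^^ c) (one M)"

definition cut :: "'a interp \<Rightarrow> 'a \<Rightarrow> 'a set" where
  "cut M n = {y. \<exists>c z. len M z = len_pow M n c \<and> less M y (smash M z (one M))}"


section \<open>Forcing\<close>

definition conditions :: "'a interp \<Rightarrow> 'a \<Rightarrow> 'a set" where
  "conditions M n = {\<sigma>.
     ext M \<sigma> \<subseteq> (\<lambda>(a, b). pair M a b) ` (seg M (plus M n (one M)) \<times> seg M n) \<and>
     single_valued (graph M \<sigma>) \<and> single_valued ((graph M \<sigma>)\<inverse>) \<and>
     (\<exists>c k. has_card M \<sigma> k \<and> leq M k (len_pow M n c))}"

text \<open>The order on conditions: \<open>extends M \<tau> \<sigma>\<close> is \<open>\<tau> \<le> \<sigma>\<close>.\<close>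

definition extends :: "'a interp \<Rightarrow> 'a \<Rightarrow> 'a \<Rightarrow> bool"
  where "extends M \<tau> \<sigma> \<longleftrightarrow> ext M \<sigma> \<subseteq> ext M \<tau>"

definition compatible :: "'a interp \<Rightarrow> 'a \<Rightarrow> 'a \<Rightarrow> 'a \<Rightarrow> bool"
  where "compatible M n \<sigma> \<tau> \<longleftrightarrow> (\<exists>\<rho>\<in>conditions M n. ext M \<rho> = ext M \<sigma> \<union> ext M \<tau>)"

text \<open>Definability (with parameters) in the expansion of M by a unary predicate for the set of
  conditions. The predicate P(x) is rendered by the atom R(x, x), with R interpreted as the
  diagonal of P, so no further language is needed.\<close>

definition P_definable :: "'a interp \<Rightarrow> 'a \<Rightarrow> 'a set \<Rightarrow> bool" where
  "P_definable M n D \<longleftrightarrow>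
     (\<exists>\<phi> e. D = {x. sat M UNIV (Id_on (conditions M n)) (case_nat x e) \<phi>})"

definition dense_in :: "'a interp \<Rightarrow> 'a \<Rightarrow> 'a set \<Rightarrow> bool"
  where "dense_in M n D \<longleftrightarrow> D \<subseteq> conditions M n \<and> (\<forall>\<sigma>\<in>conditions M n. \<exists>\<tau>\<in>D. extends M \<tau> \<sigma>)"

definition filter_of :: "'a interp \<Rightarrow> 'a \<Rightarrow> 'a set \<Rightarrow> bool" where
  "filter_of M n G \<longleftrightarrow> G \<subseteq> conditions M n \<and>
     (\<forall>\<sigma>\<in>G. \<forall>\<tau>\<in>G. compatible M n \<sigma> \<tau>) \<and>
     (\<forall>\<tau>\<in>G. \<forall>\<sigma>\<in>conditions M n. extends M \<tau> \<sigma> \<longrightarrow> \<sigma> \<in> G)"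

definition generic :: "'a interp \<Rightarrow> 'a \<Rightarrow> 'a set \<Rightarrow> bool" where
  "generic M n G \<longleftrightarrow> filter_of M n G \<and>
     (\<forall>D. P_definable M n D \<longrightarrow> dense_in M n D \<longrightarrow> G \<inter> D \<noteq> {})"

text \<open>\<open>forces M n \<sigma> e \<phi>\<close>: the condition \<open>\<sigma>\<close> forces the sentence obtained from \<open>\<phi>\<close> by
  taking the values of e as parameters.\<close>

definition forces :: "'a interp \<Rightarrow> 'a \<Rightarrow> 'a \<Rightarrow> (nat \<Rightarrow> 'a) \<Rightarrow> fm \<Rightarrow> bool" where
  "forces M n \<sigma> e \<phi> \<longleftrightarrow>
     (\<forall>G. generic M n G \<longrightarrow> \<sigma> \<in> G \<longrightarrow> sat M (cut M n) (\<Union>\<tau>\<in>G. graph M \<tau>) e \<phi>)"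


section \<open>WPHP-arrays\<close>

text \<open>The array is an element A of M coding a function on [2m] x [m]; its value \<open>F a b\<close> codes
  the set of conditions \<open>B a b\<close>. In the second and third conditions the two rows (or columns)
  may coincide, so the conditions within a single entry are pairwise incompatible.\<close>

definition WPHP_array :: "'a interp \<Rightarrow> 'a \<Rightarrow> 'a \<Rightarrow> 'a \<Rightarrow> 'a \<Rightarrow> 'a \<Rightarrow> bool" where
  "WPHP_array M n m k \<sigma> A \<longleftrightarrow>
    (let rows = seg M (times M (plus M (one M) (one M)) m); cols = seg M m in
     \<exists>F. ext M A = (\<lambda>(a, b). pair M (pair M a b) (F a b)) ` (rows \<times> cols) \<and>
     (let B = (\<lambda>a b. ext M (F a b)) in
       (\<forall>a\<in>rows. \<forall>b\<in>cols. \<forall>\<tau>\<in>B a b. \<tau> \<in> conditions M n \<and>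
          (\<exists>l. has_card M \<tau> l \<and> leq M l k) \<and>
          compatible M n \<tau> \<sigma> \<and> ext M \<tau> \<inter> ext M \<sigma> = {}) \<and>
       (\<forall>a\<in>rows. \<forall>a'\<in>rows. \<forall>b\<in>cols. a \<noteq> a' \<longrightarrow> B a b \<inter> B a' b = {}) \<and>
       (\<forall>a\<in>rows. \<forall>b\<in>cols. \<forall>b'\<in>cols. b \<noteq> b' \<longrightarrow> B a b \<inter> B a b' = {}) \<and>
       (\<forall>a\<in>rows. \<forall>a'\<in>rows. \<forall>b\<in>cols. \<forall>\<tau>\<in>B a b. \<forall>\<tau>'\<in>B a' b.
          \<tau> \<noteq> \<tau>' \<longrightarrow> \<not> compatible M n \<tau> \<tau>') \<and>
       (\<forall>a\<in>rows. \<forall>b\<in>cols. \<forall>b'\<in>cols. \<forall>\<tau>\<in>B a b. \<forall>\<tau>'\<in>B a b'.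
          \<tau> \<noteq> \<tau>' \<longrightarrow> \<not> compatible M n \<tau> \<tau>') \<and>
       (\<forall>\<rho>\<in>conditions M n. extends M \<rho> \<sigma> \<longrightarrow>
          (\<forall>a\<in>rows. \<exists>b\<in>cols. \<exists>\<tau>\<in>B a b. compatible M n \<tau> \<rho>))))"

end

theory Submission
  imports Defs "HOL-Library.Nat_Bijection" "HOL-Library.Countable"
begin

text \<open>Every generic expansion satisfies PIND for Sigma1b formulas, because a condition certifying
  \<open>\<phi>(0)\<close> can be extended bit by bit along x until either \<open>\<phi>(x)\<close> is certified or some prefix y of x has
  \<open>\<phi>(y div 2)\<close> certified and \<open>\<phi>(y)\<close> excluded. Hence a Delta1b formula \<open>\<phi>\<close>, equivalent to the Pi1b
  formula \<open>\<psi>\<close>, has in every generic expansion and for all arguments below 2m and m either a certificate of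
  \<open>\<phi>\<close> or one of \<open>\<not> \<psi>\<close>, both of size polynomial in |n|. Certificates of the two kinds for the same
  arguments are incompatible, so a decision tree of polynomial depth, which queries values and preimages
  of the generic bijection, decides \<open>\<phi>(a, b)\<close>. If the generic expansion of some filter violates WPHP, then
  some \<open>\<sigma>\<close> in that filter forces this in the form of density statements, and the paths over \<open>\<sigma>\<close>
  that lead to accepting leaves of the trees, with \<open>\<sigma>\<close> removed, form the array. All combinatorics takes
  place in the standard model and is transferred to M.\<close>

section \<open>Substitution and bounded quantifiers\<close>

text \<open>The size bound on conditions has a standard exponent and is external to M, so no
  statement about conditions transfers directly. What is transferred speaks of arbitrary partial
  injections with an explicit size parameter. Conditions come in afterwards: the numbers bounded by
  a power of |n| with standard exponent are closed under sum and product and lie below n, which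
  leaves room for every extension made.

  Certificates are used in place of truth because they are definable: a generic filter meets only
  dense sets definable from the set of conditions.

  That certificates of \<phi> and of \<not> \<psi> are incompatible is derived from a generic filter
  containing both, in whose expansion soundness of S12 makes \<phi> and \<psi> equivalent. The
  existence of this filter is where countability enters. The transferred construction carries the
  incompatibility as a hypothesis.

  If k bounds the certificates, a tree makes at most k rounds of queries, each adding at most 2k
  pairs; this gives the bound 2kk of the array. An accepting leaf merely excludes certificates of
  \<not> \<psi>; certificates of \<phi> are recovered from a generic filter through the
  leaf.\<close>

lemma val_cong: "(\<And>i. i \<in> tvars t \<Longrightarrow> e i = e' i) \<Longrightarrow> val M e t = val M e' t"
  by (induction t) auto

lemma val_tsubst: "val M e (tsubst f t) = val M (\<lambda>i. val M e (f i)) t"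
  by (induction t) auto

lemma val_tlift [simp]: "val M (case_nat x e) (tlift t) = val M e t"
  by (simp add: val_tsubst)

lemma case_nat_0_Suc [simp]: "case_nat (e 0) (\<lambda>i. e (Suc i)) = (e :: nat \<Rightarrow> 'a)"
  by (rule ext) (simp split: nat.split)

lemma sat_cong:
  "(\<And>i. i \<in> fvars \<phi> \<Longrightarrow> e i = e' i) \<Longrightarrow> sat M D R e \<phi> = sat M D R e' \<phi>"
proof (induction \<phi> arbitrary: e e')
  case (Eq s t) then show ?case using val_cong[of s e e'] val_cong[of t e e'] by simp
next
  case (Less s t) then show ?case using val_cong[of s e e'] val_cong[of t e e'] by simp
next
  case (Rel s t) then show ?case using val_cong[of s e e'] val_cong[of t e e'] by simp
next
  case (Imp \<phi> \<psi>)
  then have "sat M D R e \<phi> = sat M D R e' \<phi>" "sat M D R e \<psi> = sat M D R e' \<psi>"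
    by (metis UnCI fvars.simps(5))+
  then show ?case by simp
next
  case (Forall \<phi>)
  have "sat M D R (case_nat x e) \<phi> = sat M D R (case_nat x e') \<phi>" for x
    by (rule Forall.IH) (use Forall.prems in \<open>auto split: nat.split\<close>)
  then show ?case by simp
qed simp

lemma sat_fsubst: "sat M D R e (fsubst f \<phi>) = sat M D R (\<lambda>i. val M e (f i)) \<phi>"
proof (induction \<phi> arbitrary: e f)
  case (Forall \<phi>)
  have "(\<lambda>i. val M (case_nat x e) (case_nat (Var 0) (\<lambda>i. tlift (f i)) i))
      = case_nat x (\<lambda>i. val M e (f i))" for x
    by (rule HOL.ext) (simp split: nat.split)
  then show ?case by (simp add: Forall)
qed (simp_all add: val_tsubst)

lemma sat_finst [simp]: "sat M D R e (finst t \<phi>) = sat M D R (case_nat (val M e t) e) \<phi>"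
proof -
  have "(\<lambda>i. val M e (case_nat t Var i)) = case_nat (val M e t) e"
    by (rule HOL.ext) (simp split: nat.split)
  then show ?thesis by (simp add: sat_fsubst)
qed

lemma sat_flift [simp]: "sat M D R (case_nat x e) (flift \<phi>) = sat M D R e \<phi>"
  by (simp add: sat_fsubst)

lemma sat_Neg [simp]: "sat M D R e (\<^bold>\<not> \<phi>) \<longleftrightarrow> \<not> sat M D R e \<phi>"
  by (simp add: Neg_def)

lemma sat_Disj [simp]: "sat M D R e (\<phi> \<^bold>\<or> \<psi>) \<longleftrightarrow> sat M D R e \<phi> \<or> sat M D R e \<psi>"
  by (auto simp: Disj_def)

lemma sat_Conj [simp]: "sat M D R e (\<phi> \<^bold>\<and> \<psi>) \<longleftrightarrow> sat M D R e \<phi> \<and> sat M D R e \<psi>"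
  by (auto simp: Conj_def)

lemma sat_Iff [simp]: "sat M D R e (\<phi> \<^bold>\<longleftrightarrow> \<psi>) \<longleftrightarrow> (sat M D R e \<phi> \<longleftrightarrow> sat M D R e \<psi>)"
  by (auto simp: Iff_def)

lemma sat_Exists [simp]: "sat M D R e (Exists \<phi>) \<longleftrightarrow> (\<exists>x\<in>D. sat M D R (case_nat x e) \<phi>)"
  by (simp add: Exists_def)

lemma sat_Leq [simp]: "sat M D R e (s \<^bold>\<le> t) \<longleftrightarrow> leq M (val M e s) (val M e t)"
  by (simp add: Leq_def leq_def)

lemma sat_BAll [simp]:
  "sat M D R e (BAll t \<phi>) \<longleftrightarrow> (\<forall>x\<in>D. less M x (val M e t) \<longrightarrow> sat M D R (case_nat x e) \<phi>)"
  by (simp add: BAll_def)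

lemma sat_BEx [simp]:
  "sat M D R e (BEx t \<phi>) \<longleftrightarrow> (\<exists>x\<in>D. less M x (val M e t) \<and> sat M D R (case_nat x e) \<phi>)"
  by (simp add: BEx_def)

lemma sat_app:
  "sat M D R e (app d a b \<phi>) = sat M D R (case_nat (e a) (case_nat (e b) (\<lambda>i. e (i + 1 + d)))) \<phi>"
proof -
  have "(\<lambda>i. val M e (case_nat (Var a) (case_nat (Var b) (\<lambda>i. Var (i + 1 + d))) i)) =
     case_nat (e a) (case_nat (e b) (\<lambda>i. e (i + 1 + d)))"
    by (rule HOL.ext) (simp split: nat.split)
  then show ?thesis unfolding app_def sat_fsubst by presburger
qed

lemma tvars_tsubst: "tvars (tsubst f t) = (\<Union>i\<in>tvars t. tvars (f i))"
  by (induction t) auto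

lemma finite_tvars: "finite (tvars t)"
  by (induction t) auto

lemma finite_fvars: "finite (fvars \<phi>)"
proof (induction \<phi>)
  case (Forall \<phi>)
  then have "finite (Suc -` fvars \<phi>)" by (simp add: finite_vimageI)
  then show ?case by (simp add: vimage_def)
qed (simp_all add: finite_tvars)

lemma R_free_fsubst [simp]: "R_free (fsubst f \<phi>) = R_free \<phi>"
  by (induction \<phi> arbitrary: f) auto

lemma sat_R_free: "R_free \<phi> \<Longrightarrow> sat M D R e \<phi> = sat M D R' e \<phi>"
  by (induction \<phi> arbitrary: e) auto

section \<open>Transfer from the standard model\<close>

text \<open>\<open>rep M P Q\<close> says that one and the same formula of L defines P in M and Q in the standard
  model. In the rules below the right-hand side is a pattern variable wherever a quantifier is
  crossed, so that resolution synthesises Q from P.\<close>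

abbreviation std :: "nat interp" where "std \<equiv> standard"

definition trep :: "'a interp \<Rightarrow> ((nat \<Rightarrow> 'a) \<Rightarrow> 'a) \<Rightarrow> ((nat \<Rightarrow> nat) \<Rightarrow> nat) \<Rightarrow> bool"
  where "trep M f g \<longleftrightarrow> (\<exists>t. (\<forall>e. f e = val M e t) \<and> (\<forall>e. g e = val std e t))"

definition rep :: "'a interp \<Rightarrow> ((nat \<Rightarrow> 'a) \<Rightarrow> bool) \<Rightarrow> ((nat \<Rightarrow> nat) \<Rightarrow> bool) \<Rightarrow> bool"
  where "rep M P Q \<longleftrightarrow> (\<exists>\<phi>. R_free \<phi> \<and> (\<forall>e. P e = sat M UNIV {} e \<phi>) \<and>
    (\<forall>e. Q e = sat std UNIV {} e \<phi>))"

text \<open>\<open>models_Th_N\<close> speaks of sentences only, so free variables are removed one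
  at a time by passing to \<open>Forall\<close>, by induction on a bound for their indices.\<close>

lemma transfer_valid:
  assumes M: "models_Th_N M" and "R_free \<phi>" and "\<And>e. sat std UNIV {} e \<phi>"
  shows "sat M UNIV {} e \<phi>"
proof -
  have "\<forall>\<phi> e. fvars \<phi> \<subseteq> {..<k} \<longrightarrow> R_free \<phi> \<longrightarrow> (\<forall>e. sat std UNIV {} e \<phi>)
    \<longrightarrow> sat M UNIV {} e \<phi>" for k
  proof (induction k)
    case 0
    then show ?case using M unfolding models_Th_N_def by auto
  next
    case (Suc k)
    show ?case
    proof (intro allI impI)
      fix \<phi> e
      assume *: "fvars \<phi> \<subseteq> {..<Suc k}" "R_free \<phi>" "\<forall>e. sat std UNIV {} e \<phi>"
      have "sat M UNIV {} (\<lambda>i. e (Suc i)) (Forall \<phi>)"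
        using Suc.IH[rule_format, of "Forall \<phi>"] * by auto
      then have "sat M UNIV {} (case_nat (e 0) (\<lambda>i. e (Suc i))) \<phi>" by (metis UNIV_I sat.simps(6))
      then show "sat M UNIV {} e \<phi>" by simp
    qed
  qed
  moreover obtain k where "fvars \<phi> \<subseteq> {..<k}"
    using finite_fvars[of \<phi>] finite_nat_iff_bounded by blast
  ultimately show ?thesis using assms by blast
qed

lemma transfer: "models_Th_N M \<Longrightarrow> rep M P Q \<Longrightarrow> (\<And>e. Q e) \<Longrightarrow> P e"
  unfolding rep_def using transfer_valid by metis

lemma transfer_sentence: "models_Th_N M \<Longrightarrow> rep M (\<lambda>_. P) Q \<Longrightarrow> (\<And>e. Q e) \<Longrightarrow> P"
  by (rule transfer)

lemma trep_var: "trep M (\<lambda>e. e i) (\<lambda>e. e i)"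
  unfolding trep_def by (rule exI[of _ "Var i"]) simp

lemma trep_zero: "trep M (\<lambda>e. zero M) (\<lambda>e. zero std)"
  unfolding trep_def by (rule exI[of _ Zero]) simp

lemma trep_one: "trep M (\<lambda>e. one M) (\<lambda>e. one std)"
  unfolding trep_def by (rule exI[of _ One]) simp

lemma trep_half: "trep M f f' \<Longrightarrow> trep M (\<lambda>e. half M (f e)) (\<lambda>e. half std (f' e))"
  unfolding trep_def by (metis val.simps(4))

lemma trep_len: "trep M f f' \<Longrightarrow> trep M (\<lambda>e. len M (f e)) (\<lambda>e. len std (f' e))"
  unfolding trep_def by (metis val.simps(5))

lemma trep_plus:
  "trep M f f' \<Longrightarrow> trep M g g' \<Longrightarrow> trep M (\<lambda>e. plus M (f e) (g e)) (\<lambda>e. plus std (f' e) (g' e))"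
  unfolding trep_def by (metis val.simps(6))

lemma trep_times:
  "trep M f f' \<Longrightarrow> trep M g g' \<Longrightarrow> trep M (\<lambda>e. times M (f e) (g e)) (\<lambda>e. times std (f' e) (g' e))"
  unfolding trep_def by (metis val.simps(7))

lemma trep_smash:
  "trep M f f' \<Longrightarrow> trep M g g' \<Longrightarrow> trep M (\<lambda>e. smash M (f e) (g e)) (\<lambda>e. smash std (f' e) (g' e))"
  unfolding trep_def by (metis val.simps(8))

lemma trep_case_nat:
  "trep M f f' \<Longrightarrow> (\<And>i. trep M (g i) (g' i)) \<Longrightarrow>
   trep M (\<lambda>e. case_nat (f e) (\<lambda>i. g i e) v) (\<lambda>e. case_nat (f' e) (\<lambda>i. g' i e) v)"
  by (cases v) simp_all

lemma trep_numeral: "trep M (\<lambda>e. numeral_of M k) (\<lambda>e. numeral_of std k)"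
  unfolding numeral_of_def by (induction k) (auto intro: trep_zero trep_one trep_plus)

lemma trep_len_pow:
  assumes "trep M f f'"
  shows "trep M (\<lambda>e. len_pow M (f e) c) (\<lambda>e. len_pow std (f' e) c)"
  unfolding len_pow_def
  by (induction c) (simp_all add: trep_one trep_times trep_len assms)

lemma rep_False: "rep M (\<lambda>e. False) (\<lambda>e. False)"
  unfolding rep_def by (rule exI[of _ Fls]) simp

lemma rep_eq: "trep M f f' \<Longrightarrow> trep M g g' \<Longrightarrow> rep M (\<lambda>e. f e = g e) (\<lambda>e. f' e = g' e)"
  unfolding rep_def trep_def by (metis sat.simps(2) R_free.simps(2))

lemma rep_less:
  "trep M f f' \<Longrightarrow> trep M g g' \<Longrightarrow> rep M (\<lambda>e. less M (f e) (g e)) (\<lambda>e. less std (f' e) (g' e))"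
  unfolding rep_def trep_def by (metis sat.simps(3) R_free.simps(3))

lemma rep_imp: "rep M P P' \<Longrightarrow> rep M Q Q' \<Longrightarrow> rep M (\<lambda>e. P e \<longrightarrow> Q e) (\<lambda>e. P' e \<longrightarrow> Q' e)"
  unfolding rep_def by (metis sat.simps(5) R_free.simps(5))

lemma rep_not: "rep M P P' \<Longrightarrow> rep M (\<lambda>e. \<not> P e) (\<lambda>e. \<not> P' e)"
  using rep_imp[OF _ rep_False] by simp

lemma rep_disj: "rep M P P' \<Longrightarrow> rep M Q Q' \<Longrightarrow> rep M (\<lambda>e. P e \<or> Q e) (\<lambda>e. P' e \<or> Q' e)"
  using rep_imp[OF rep_not, of M P P' Q Q'] by (simp add: disj_imp)

lemma rep_conj: "rep M P P' \<Longrightarrow> rep M Q Q' \<Longrightarrow> rep M (\<lambda>e. P e \<and> Q e) (\<lambda>e. P' e \<and> Q' e)"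
  using rep_not[OF rep_disj[OF rep_not rep_not], of M P P' Q Q'] by simp

lemma rep_iff: "rep M P P' \<Longrightarrow> rep M Q Q' \<Longrightarrow> rep M (\<lambda>e. P e \<longleftrightarrow> Q e) (\<lambda>e. P' e \<longleftrightarrow> Q' e)"
  using rep_conj[OF rep_imp rep_imp, of M P P' Q Q' Q Q' P P'] by (simp add: iff_conv_conj_imp)

lemma rep_all:
  assumes "rep M (\<lambda>e. P (e 0) (\<lambda>i. e (Suc i))) Q"
  shows "rep M (\<lambda>e. \<forall>x. P x e) (\<lambda>e. \<forall>x. Q (case_nat x e))"
proof -
  obtain \<phi> where "R_free \<phi>" and \<phi>: "\<And>e. P (e 0) (\<lambda>i. e (Suc i)) = sat M UNIV {} e \<phi>"
    "\<And>e. Q e = sat std UNIV {} e \<phi>"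
    using assms unfolding rep_def by blast
  have "P x e = sat M UNIV {} (case_nat x e) \<phi>" for x e
    using \<phi>(1)[of "case_nat x e"] by simp
  with \<phi> \<open>R_free \<phi>\<close> show ?thesis
    unfolding rep_def by (intro exI[of _ "Forall \<phi>"]) simp
qed

lemma rep_ex:
  assumes "rep M (\<lambda>e. P (e 0) (\<lambda>i. e (Suc i))) Q"
  shows "rep M (\<lambda>e. \<exists>x. P x e) (\<lambda>e. \<exists>x. Q (case_nat x e))"
  using rep_not[OF rep_all[of M "\<lambda>x e. \<not> P x e", OF rep_not[OF assms]]] by simp

lemma rep_ball_finite:
  assumes "finite A" and "\<And>v. rep M (P v) (Q v)"
  shows "rep M (\<lambda>e. \<forall>v\<in>A. P v e) (\<lambda>e. \<forall>v\<in>A. Q v e)"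
  using assms(1)
proof (induction A rule: finite_induct)
  case empty
  then show ?case using rep_not[OF rep_False] by simp
next
  case (insert v A)
  then show ?case using rep_conj[OF assms(2)] by simp
qed

lemma rep_subst:
  assumes "rep M P Q" and "\<And>i. trep M (f i) (g i)"
  shows "rep M (\<lambda>e. P (\<lambda>i. f i e)) (\<lambda>e. Q (\<lambda>i. g i e))"
proof -
  obtain t where t: "\<And>i e. f i e = val M e (t i)" "\<And>i e. g i e = val std e (t i)"
    using assms(2) unfolding trep_def by metis
  obtain \<phi> where \<phi>: "R_free \<phi>" "\<And>e. P e = sat M UNIV {} e \<phi>" "\<And>e. Q e = sat std UNIV {} e \<phi>"
    using assms(1) unfolding rep_def by blast
  show ?thesis unfolding rep_def
    by (rule exI[of _ "fsubst t \<phi>"]) (simp add: \<phi> t sat_fsubst)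
qed

text \<open>A binary notion is transferred once, for the variables 0 and 1; substitution then gives
  its instances at arbitrary terms.\<close>

lemma rep_subst2:
  assumes "rep M (\<lambda>e. P (e 0) (e (Suc 0))) (\<lambda>e. Q (e 0) (e (Suc 0)))" "trep M f f'" "trep M g g'"
  shows "rep M (\<lambda>e. P (f e) (g e)) (\<lambda>e. Q (f' e) (g' e))"
  using rep_subst[OF assms(1), of "case_nat f (\<lambda>_. g)" "case_nat f' (\<lambda>_. g')"] assms(2,3)
  by (simp split: nat.split)

lemma rep_subst3:
  assumes "rep M (\<lambda>e. P (e 0) (e (Suc 0)) (e (Suc (Suc 0)))) (\<lambda>e. Q (e 0) (e (Suc 0)) (e (Suc (Suc 0))))"
    "trep M f f'" "trep M g g'" "trep M h h'"
  shows "rep M (\<lambda>e. P (f e) (g e) (h e)) (\<lambda>e. Q (f' e) (g' e) (h' e))"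
  using rep_subst[OF assms(1), of "case_nat f (case_nat g (\<lambda>_. h))" "case_nat f' (case_nat g' (\<lambda>_. h'))"]
    assms(2-4)
  by (simp split: nat.split)

lemmas trep_intros = trep_var trep_zero trep_one trep_half trep_len trep_plus trep_times trep_smash
  trep_case_nat trep_numeral trep_len_pow

lemmas rep_intros = rep_False rep_eq rep_less rep_not rep_imp rep_disj rep_conj rep_iff rep_all rep_ex

lemma leq_rep: "trep M f f' \<Longrightarrow> trep M g g' \<Longrightarrow> rep M (\<lambda>e. leq M (f e) (g e)) (\<lambda>e. leq std (f' e) (g' e))"
  unfolding leq_def by (intro rep_disj rep_less rep_eq)

lemma pair_rep:
  "trep M f f' \<Longrightarrow> trep M g g' \<Longrightarrow> trep M (\<lambda>e. pair M (f e) (g e)) (\<lambda>e. pair std (f' e) (g' e))"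
  unfolding pair_def by (intro trep_plus trep_times)

lemma ext_rep:
  assumes "trep M f f'" "trep M g g'"
  shows "rep M (\<lambda>e. f e \<in> ext M (g e)) (\<lambda>e. f' e \<in> ext std (g' e))"
proof -
  let ?P = "\<lambda>I y s. y \<in> ext I s"
  have "rep M (\<lambda>e. ?P M (e 0) (e (Suc 0))) (\<lambda>e. \<exists>x xa xb. len std x = e 0 \<and> less std xb (smash std x (one std)) \<and>
     e (Suc 0) = plus std (times std (plus std (times std (plus std (one std) (one std)) xa) (one std)) (smash std x (one std))) xb)"
    unfolding ext_def mem_Collect_eq
    \<comment> \<open>Resolution produces the standard side with nested \<open>case_nat\<close>
      assignments; \<open>back_subst\<close> leaves their simplification to a second goal.\<close>
    apply (rule back_subst[of "rep M _"])
     apply (rule rep_intros trep_intros)+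
    apply (simp)
    done
  then have "rep M (\<lambda>e. ?P M (e 0) (e (Suc 0))) (\<lambda>e. ?P std (e 0) (e (Suc 0)))"
    by (simp add: ext_def)
  from rep_subst2[OF this assms] show ?thesis .
qed

section \<open>First-order notions in M\<close>

text \<open>\<open>conditions\<close> refers to standard exponents and \<open>has_card\<close> to a function on M, so neither can be
  transferred as it stands; \<open>pinj\<close> and \<open>fo_card\<close> are their first-order parts.\<close>

definition sub :: "'a interp \<Rightarrow> 'a \<Rightarrow> 'a \<Rightarrow> bool"
  where "sub I s t \<longleftrightarrow> (\<forall>x. x \<in> ext I s \<longrightarrow> x \<in> ext I t)"

definition joins :: "'a interp \<Rightarrow> 'a \<Rightarrow> 'a \<Rightarrow> 'a \<Rightarrow> bool"
  where "joins I u s t \<longleftrightarrow> (\<forall>x. x \<in> ext I u \<longleftrightarrow> x \<in> ext I s \<or> x \<in> ext I t)"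

definition pinj :: "'a interp \<Rightarrow> 'a \<Rightarrow> 'a \<Rightarrow> bool" where
  "pinj I n s \<longleftrightarrow>
    (\<forall>z. z \<in> ext I s \<longrightarrow> (\<exists>a b. less I a (plus I n (one I)) \<and> less I b n \<and> z = pair I a b)) \<and>
    (\<forall>a b c. pair I a b \<in> ext I s \<longrightarrow> pair I a c \<in> ext I s \<longrightarrow> b = c) \<and>
    (\<forall>a b c. pair I a c \<in> ext I s \<longrightarrow> pair I b c \<in> ext I s \<longrightarrow> a = b)"

text \<open>There is no size bound on u, so the notion is first-order. For two conditions nothing is
  lost, because their union is small enough to be a condition.\<close>

definition compat :: "'a interp \<Rightarrow> 'a \<Rightarrow> 'a \<Rightarrow> 'a \<Rightarrow> bool"
  where "compat I n s t \<longleftrightarrow> (\<exists>u. pinj I n u \<and> sub I s u \<and> sub I t u)"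

definition fo_card :: "'a interp \<Rightarrow> 'a \<Rightarrow> 'a \<Rightarrow> bool" where
  "fo_card I s k \<longleftrightarrow> (\<exists>f.
    (\<forall>z. z \<in> ext I f \<longrightarrow> (\<exists>x y. x \<in> ext I s \<and> less I y k \<and> z = pair I x y)) \<and>
    (\<forall>x. x \<in> ext I s \<longrightarrow> (\<exists>y. pair I x y \<in> ext I f)) \<and>
    (\<forall>y. less I y k \<longrightarrow> (\<exists>x. pair I x y \<in> ext I f)) \<and>
    (\<forall>x y z. pair I x y \<in> ext I f \<longrightarrow> pair I x z \<in> ext I f \<longrightarrow> y = z) \<and>
    (\<forall>x y z. pair I x z \<in> ext I f \<longrightarrow> pair I y z \<in> ext I f \<longrightarrow> x = y))"

definition card_le :: "'a interp \<Rightarrow> 'a \<Rightarrow> 'a \<Rightarrow> bool"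
  where "card_le I s k \<longleftrightarrow> (\<exists>l. has_card I s l \<and> leq I l k)"

text \<open>Since pairing is injective, the coded set f determines the external function h, and
  quantifying over f alone is first-order.\<close>

lemma has_card_iff_fo_card:
  assumes inj: "\<And>a b c d. pair I a b = pair I c d \<longleftrightarrow> a = c \<and> b = d"
  shows "has_card I s k \<longleftrightarrow> fo_card I s k"
proof
  assume "has_card I s k"
  then obtain f h where h: "bij_betw h (ext I s) (seg I k)"
    and f: "ext I f = (\<lambda>x. pair I x (h x)) ` ext I s"
    unfolding has_card_def by blast
  have pf: "pair I x y \<in> ext I f \<longleftrightarrow> x \<in> ext I s \<and> y = h x" for x y
    unfolding f by (auto simp: inj)
  show "fo_card I s k" unfolding fo_card_def
  proof (rule exI[of _ f], intro conjI allI impI)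
    fix z assume "z \<in> ext I f"
    then show "\<exists>x y. x \<in> ext I s \<and> less I y k \<and> z = pair I x y"
      using h unfolding f by (auto simp: bij_betw_def seg_def)
  next
    fix y assume "less I y k"
    then show "\<exists>x. pair I x y \<in> ext I f"
      using h unfolding pf bij_betw_def seg_def by blast
  next
    fix x y z assume "pair I x z \<in> ext I f" "pair I y z \<in> ext I f"
    then show "x = y" using h unfolding pf bij_betw_def inj_on_def by blast
  qed (simp_all add: pf)
next
  assume "fo_card I s k"
  then obtain f where f: "\<And>z. z \<in> ext I f \<Longrightarrow> \<exists>x y. x \<in> ext I s \<and> less I y k \<and> z = pair I x y"
    "\<And>x. x \<in> ext I s \<Longrightarrow> \<exists>y. pair I x y \<in> ext I f"
    "\<And>y. less I y k \<Longrightarrow> \<exists>x. pair I x y \<in> ext I f"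
    "\<And>x y z. pair I x y \<in> ext I f \<Longrightarrow> pair I x z \<in> ext I f \<Longrightarrow> y = z"
    "\<And>x y z. pair I x z \<in> ext I f \<Longrightarrow> pair I y z \<in> ext I f \<Longrightarrow> x = y"
    unfolding fo_card_def by blast
  have dom: "x \<in> ext I s \<and> less I y k" if "pair I x y \<in> ext I f" for x y
    using f(1)[OF that] by (auto simp: inj)
  define h where "h x = (SOME y. pair I x y \<in> ext I f)" for x
  have h: "pair I x (h x) \<in> ext I f" if "x \<in> ext I s" for x
    unfolding h_def by (rule someI_ex) (rule f(2)[OF that])
  have "bij_betw h (ext I s) (seg I k)"
    unfolding bij_betw_def inj_on_def seg_def
  proof (intro conjI ballI impI set_eqI)
    fix x y assume "x \<in> ext I s" "y \<in> ext I s" "h x = h y"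
    then show "x = y" using h f(5) by metis
  next
    fix y show "(y \<in> h ` ext I s) = (y \<in> {y. less I y k})"
      using h f(3,4) dom by blast
  qed
  moreover have "ext I f = (\<lambda>x. pair I x (h x)) ` ext I s"
    using f(1,4) h by blast
  ultimately show "has_card I s k" unfolding has_card_def by blast
qed

lemma sub_rep:
  "trep M f f' \<Longrightarrow> trep M g g' \<Longrightarrow> rep M (\<lambda>e. sub M (f e) (g e)) (\<lambda>e. sub std (f' e) (g' e))"
  apply (rule rep_subst2[where P="sub M"]; assumption?)
  unfolding sub_def
  apply (rule back_subst[of "rep M _"])
   apply (rule rep_intros ext_rep trep_intros)+
  by simp

lemma joins_rep:
  "trep M f f' \<Longrightarrow> trep M g g' \<Longrightarrow> trep M h h' \<Longrightarrow>
   rep M (\<lambda>e. joins M (f e) (g e) (h e)) (\<lambda>e. joins std (f' e) (g' e) (h' e))"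
  apply (rule rep_subst3[where P="joins M"]; assumption?)
  unfolding joins_def
  apply (rule back_subst[of "rep M _"])
   apply (rule rep_intros ext_rep trep_intros)+
  by simp

lemma pinj_rep:
  "trep M f f' \<Longrightarrow> trep M g g' \<Longrightarrow> rep M (\<lambda>e. pinj M (f e) (g e)) (\<lambda>e. pinj std (f' e) (g' e))"
  apply (rule rep_subst2[where P="pinj M"]; assumption?)
  unfolding pinj_def
  apply (rule back_subst[of "rep M _"])
   apply (rule rep_intros ext_rep pair_rep trep_intros)+
  by simp

lemma compat_rep:
  "trep M f f' \<Longrightarrow> trep M g g' \<Longrightarrow> trep M h h' \<Longrightarrow>
   rep M (\<lambda>e. compat M (f e) (g e) (h e)) (\<lambda>e. compat std (f' e) (g' e) (h' e))"
  apply (rule rep_subst3[where P="compat M"]; assumption?)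
  unfolding compat_def
  apply (rule back_subst[of "rep M _"])
   apply (rule rep_intros pinj_rep sub_rep trep_intros)+
  by simp

lemma fo_card_rep:
  "trep M f f' \<Longrightarrow> trep M g g' \<Longrightarrow> rep M (\<lambda>e. fo_card M (f e) (g e)) (\<lambda>e. fo_card std (f' e) (g' e))"
  apply (rule rep_subst2[where P="fo_card M"]; assumption?)
  unfolding fo_card_def
  apply (rule back_subst[of "rep M _"])
   apply (rule rep_intros ext_rep pair_rep trep_intros)+
  by simp

section \<open>The standard model\<close>

lemma standard_simps [simp]:
  "zero std = 0" "one std = 1" "half std = (\<lambda>x. x div 2)"
  "plus std = (+)" "times std = (*)" "less std = (<)"
  "smash std x y = 2 ^ (len std x * len std y)"
  "leq std = (\<le>)"
  by (auto simp: standard_def leq_def fun_eq_iff)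

lemma numeral_of_standard [simp]: "numeral_of std k = k"
  by (induction k) (auto simp: numeral_of_def)

lemma len_pow_standard [simp]: "len_pow std n c = len std n ^ c"
  by (induction c) (auto simp: len_pow_def)

lemma len_le_iff: "len std x \<le> l \<longleftrightarrow> x < 2 ^ l"
proof -
  have "len std x \<le> l \<longleftrightarrow> bitlen (int x) \<le> int l"
    by (simp add: standard_def nat_le_iff)
  also have "\<dots> \<longleftrightarrow> int x < int (2 ^ l)"
    by (simp add: bitlen_le_iff_power)
  finally show ?thesis by linarith
qed

lemma lt_2_pow_len: "x < 2 ^ len std x"
  using len_le_iff by blast

lemma less_len_iff: "l < len std x \<longleftrightarrow> 2 ^ l \<le> x"
  using len_le_iff[of x l] by linarith

lemma len_0 [simp]: "len std 0 = 0"
  using len_le_iff[of 0 0] by simp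

lemma len_1 [simp]: "len std (Suc 0) = 1" "len std 1 = 1"
  using len_le_iff[of 1 1] len_le_iff[of 1 0] by simp_all

lemma len_pow2 [simp]: "len std (2 ^ l) = Suc l"
  using len_le_iff[of "2^l" l] len_le_iff[of "2^l" "Suc l"] by simp

text \<open>So every number is a length, and the smash of this witness with 1 is
  \<open>2 ^ l\<close>, as \<open>ext\<close> requires.\<close>

lemma len_pow2_diff_1 [simp]: "len std (2 ^ l - Suc 0) = l"
proof (rule antisym)
  show "len std (2 ^ l - Suc 0) \<le> l" by (simp add: len_le_iff)
  have "2 ^ l - Suc 0 < 2 ^ len std (2 ^ l - Suc 0)" by (rule lt_2_pow_len)
  then have "2 ^ l \<le> (2::nat) ^ len std (2 ^ l - Suc 0)" by linarith
  then show "l \<le> len std (2 ^ l - Suc 0)" by simp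
qed

lemma len_mono: "x \<le> y \<Longrightarrow> len std x \<le> len std y"
  using len_le_iff[of x "len std y"] lt_2_pow_len[of y] by linarith

lemma len_eq_0_iff [simp]: "len std x = 0 \<longleftrightarrow> x = 0"
  using len_le_iff[of x 0] by auto

lemma len_le_self: "len std x \<le> x"
  unfolding len_le_iff by (rule less_exp)

lemma len_eqI: "x < 2 ^ l \<Longrightarrow> 2 ^ l \<le> 2 * x \<Longrightarrow> len std x = l"
proof (rule antisym)
  assume "2 ^ l \<le> 2 * x"
  also have "\<dots> < 2 ^ Suc (len std x)" using lt_2_pow_len[of x] by simp
  finally have "l < Suc (len std x)" by (meson not_less_eq power_strict_increasing_iff one_less_numeral_iff semiring_norm(76))
  then show "l \<le> len std x" by simp
qed (simp add: len_le_iff)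

lemma two_len_ge: "x \<noteq> 0 \<Longrightarrow> 2 ^ len std x \<le> 2 * x"
  using less_len_iff[of "len std x - 1" x] by (cases "len std x") simp_all

lemma len_double: "x \<noteq> 0 \<Longrightarrow> len std (2 * x) = Suc (len std x)"
  using lt_2_pow_len[of x] two_len_ge[of x] by (intro len_eqI) simp_all

lemma len_double_1: "len std (Suc (2 * x)) = Suc (len std x)"
  using lt_2_pow_len[of x] two_len_ge[of x] by (cases "x = 0") (auto intro!: len_eqI)

lemma len_half: "x \<noteq> 0 \<Longrightarrow> len std x = Suc (len std (x div 2))"
  using len_double[of "x div 2"] len_double_1[of "x div 2"]
  by (cases "even x") (auto elim!: evenE oddE)

lemma pair_standard: "pair std a b = (a + b) * (a + b) + a"
  by (simp add: pair_def)

text \<open>As a is at most a + b, the code lies between the square of a + b and the next square. It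
  therefore determines a + b, and then a.\<close>

lemma pair_standard_inj [simp]: "pair std a b = pair std c d \<longleftrightarrow> a = c \<and> b = d"
proof
  assume eq: "pair std a b = pair std c d"
  have *: "pair std a b < pair std c d" if "a + b < c + d" for a b c d
  proof -
    have "Suc (a + b) * Suc (a + b) \<le> (c + d) * (c + d)"
      using that by (intro mult_le_mono) simp_all
    then show ?thesis by (simp add: pair_standard)
  qed
  from *[of a b c d] *[of c d a b] eq have "a + b = c + d" by linarith
  with eq show "a = c \<and> b = d" by (simp add: pair_standard)
qed simp

text \<open>The formula in \<open>ext\<close> writes s as (2u + 1) times the y-th power of 2 plus a
  remainder v below that power, which says that bit y of s is one.\<close>

lemma ext_standard: "ext std s = set_decode s"
proof -
  have "(\<exists>z u v. len std z = y \<and> v < 2 ^ (len std z * 1) \<and>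
    s = ((1 + 1) * u + 1) * 2 ^ (len std z * 1) + v) \<longleftrightarrow> odd (s div 2 ^ y)" for y
  proof
    assume "odd (s div 2 ^ y)"
    then obtain u where "s div 2 ^ y = 2 * u + 1" by (rule oddE)
    then have "s div 2 ^ y = (1 + 1) * u + 1" by simp
    then have "s = ((1 + 1) * u + 1) * 2 ^ y + s mod 2 ^ y" by (metis div_mult_mod_eq)
    then show "\<exists>z u v. len std z = y \<and> v < 2 ^ (len std z * 1) \<and>
        s = ((1 + 1) * u + 1) * 2 ^ (len std z * 1) + v"
      by (intro exI[of _ "2 ^ y - Suc 0"] exI[of _ u] exI[of _ "s mod 2 ^ y"]) simp
  next
    assume "\<exists>z u v. len std z = y \<and> v < 2 ^ (len std z * 1) \<and>
      s = ((1 + 1) * u + 1) * 2 ^ (len std z * 1) + v"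
    then obtain u v where v: "v < 2 ^ y" and s: "s = ((1 + 1) * u + 1) * 2 ^ y + v" by auto
    have "s div 2 ^ y = (1 + 1) * u + 1"
      unfolding s using v by (subst div_mult_self3) simp_all
    then show "odd (s div 2 ^ y)" by simp
  qed
  then show ?thesis unfolding ext_def set_decode_def by simp
qed

lemma finite_ext_standard [simp]: "finite (ext std s)"
  by (simp add: ext_standard)

lemma ext_standard_inj [simp]: "ext std s = ext std t \<longleftrightarrow> s = t"
  unfolding ext_standard by (metis set_decode_inverse)

lemma ext_set_encode [simp]: "finite A \<Longrightarrow> ext std (set_encode A) = A"
  unfolding ext_standard by simp

lemma has_card_standard: "has_card std s k \<longleftrightarrow> card (ext std s) = k"
proof
  assume "has_card std s k"
  then obtain h where "bij_betw h (ext std s) (seg std k)" unfolding has_card_def by blast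
  then have "card (ext std s) = card (seg std k)" by (rule bij_betw_same_card)
  then show "card (ext std s) = k" by (simp add: seg_def)
next
  assume "card (ext std s) = k"
  then obtain h where "bij_betw h (ext std s) {0..<k}"
    using ex_bij_betw_finite_nat[OF finite_ext_standard] by blast
  moreover have "{0..<k} = seg std k" by (auto simp: seg_def)
  ultimately show "has_card std s k" unfolding has_card_def
    by (intro exI[of _ "set_encode ((\<lambda>x. pair std x (h x)) ` ext std s)"] exI[of _ h]) simp
qed

lemma card_le_standard: "card_le std s k \<longleftrightarrow> card (ext std s) \<le> k"
  by (simp add: card_le_def has_card_standard)

lemma sub_standard: "sub std s t \<longleftrightarrow> ext std s \<subseteq> ext std t"
  unfolding sub_def by blast

lemma joins_standard: "joins std u s t \<longleftrightarrow> ext std u = ext std s \<union> ext std t"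
  unfolding joins_def by blast

section \<open>Certificates\<close>

text \<open>Kleene's three-valued semantics: the partial injection r from [n + 1] to [n] certifies that \<open>\<phi>\<close>
  has truth value b. A pair is certified to lie outside R if it is out of range or clashes with r.\<close>

primrec dec :: "'a interp \<Rightarrow> 'a \<Rightarrow> ('a \<times> 'a) set \<Rightarrow> bool \<Rightarrow> (nat \<Rightarrow> 'a) \<Rightarrow> fm \<Rightarrow> bool" where
  "dec I n r b e Fls \<longleftrightarrow> \<not> b"
| "dec I n r b e (s \<^bold>= t) \<longleftrightarrow> (val I e s = val I e t) = b"
| "dec I n r b e (s \<^bold>< t) \<longleftrightarrow> less I (val I e s) (val I e t) = b"
| "dec I n r b e (Rel s t) \<longleftrightarrow> (if b then (val I e s, val I e t) \<in> r else
     \<not> less I (val I e s) (plus I n (one I)) \<or> \<not> less I (val I e t) n \<or>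
     (\<exists>y. y \<noteq> val I e t \<and> (val I e s, y) \<in> r) \<or> (\<exists>x. x \<noteq> val I e s \<and> (x, val I e t) \<in> r))"
| "dec I n r b e (\<phi> \<^bold>\<longrightarrow> \<psi>) \<longleftrightarrow> (if b then dec I n r False e \<phi> \<or> dec I n r True e \<psi>
     else dec I n r True e \<phi> \<and> dec I n r False e \<psi>)"
| "dec I n r b e (Forall \<phi>) \<longleftrightarrow> (if b then \<forall>x. dec I n r True (case_nat x e) \<phi>
     else \<exists>x. dec I n r False (case_nat x e) \<phi>)"

text \<open>Refuting R(x, y) takes a clashing pair in r, not the mere absence of (x, y), so
  refutations survive extension just as confirmations do.\<close>

lemma dec_mono: "r \<subseteq> r' \<Longrightarrow> dec I n r b e \<phi> \<Longrightarrow> dec I n r' b e \<phi>"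
proof (induction \<phi> arbitrary: b e)
  case (Rel s t)
  then show ?case by (auto split: if_splits)
next
  case (Imp \<phi> \<psi>)
  then show ?case by (auto split: if_splits)
next
  case (Forall \<phi>)
  then show ?case by (auto split: if_splits)
qed simp_all

lemma dec_Neg [simp]: "dec I n r b e (\<^bold>\<not> \<phi>) \<longleftrightarrow> dec I n r (\<not> b) e \<phi>"
  by (simp add: Neg_def)

lemma dec_BAll:
  "dec I n r True e (BAll t \<phi>) \<longleftrightarrow> (\<forall>x. less I x (val I e t) \<longrightarrow> dec I n r True (case_nat x e) \<phi>)"
  "dec I n r False e (BAll t \<phi>) \<longleftrightarrow> (\<exists>x. less I x (val I e t) \<and> dec I n r False (case_nat x e) \<phi>)"
  by (auto simp: BAll_def)

lemma dec_BEx: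
  "dec I n r True e (BEx t \<phi>) \<longleftrightarrow> (\<exists>x. less I x (val I e t) \<and> dec I n r True (case_nat x e) \<phi>)"
  "dec I n r False e (BEx t \<phi>) \<longleftrightarrow> (\<forall>x. less I x (val I e t) \<longrightarrow> dec I n r False (case_nat x e) \<phi>)"
  by (auto simp: BEx_def Exists_def Conj_def)

lemma trep_lift:
  assumes "trep M f g"
  shows "trep M (\<lambda>e. f (\<lambda>i. e (Suc i))) (\<lambda>e. g (\<lambda>i. e (Suc i)))"
proof -
  obtain t where t: "\<And>e. f e = val M e t" "\<And>e. g e = val std e t"
    using assms unfolding trep_def by blast
  show ?thesis unfolding trep_def by (rule exI[of _ "tlift t"]) (simp add: t val_tsubst)
qed

lemma trep_val_env:
  assumes "\<And>v. trep M (f v) (g v)"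
  shows "trep M (\<lambda>e. val M (\<lambda>v. f v e) t) (\<lambda>e. val std (\<lambda>v. g v e) t)"
  by (induction t) (simp_all del: standard_simps add: assms trep_intros)

lemma graph_rep:
  "trep M f f' \<Longrightarrow> trep M g g' \<Longrightarrow> trep M h h' \<Longrightarrow>
   rep M (\<lambda>e. (f e, g e) \<in> graph M (h e)) (\<lambda>e. (f' e, g' e) \<in> graph std (h' e))"
  unfolding graph_def by (simp add: ext_rep pair_rep)

text \<open>For each fixed formula, induction on it outside M turns \<open>dec\<close> into a
  formula of L that mentions the partial injection only through its code.\<close>

lemma dec_rep:
  assumes "trep M fn gn" "trep M fs gs" "\<And>v. trep M (f v) (g v)"
  shows "rep M (\<lambda>e. dec M (fn e) (graph M (fs e)) b (\<lambda>v. f v e) \<phi>)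
    (\<lambda>e. dec std (gn e) (graph std (gs e)) b (\<lambda>v. g v e) \<phi>)"
  using assms
proof (induction \<phi> arbitrary: b fn gn fs gs f g)
  case Fls
  then show ?case by (cases b) (simp_all add: rep_False rep_not[OF rep_False, simplified])
next
  case (Eq s t)
  then show ?case by (cases b) (simp_all add: rep_not rep_eq trep_val_env)
next
  case (Less s t)
  then show ?case
    by (cases b) (simp_all del: standard_simps add: rep_not rep_less trep_val_env)
next
  case (Rel s t)
  note [simp del] = standard_simps
  note val = trep_val_env[of M f g, OF Rel(3)]
  show ?case
  proof (cases b)
    case True
    then show ?thesis by (simp add: graph_rep val Rel)
  next
    case False
    have "rep M
     (\<lambda>e. \<not> less M (val M (\<lambda>v. f v e) s) (plus M (fn e) (one M)) \<or>
           \<not> less M (val M (\<lambda>v. f v e) t) (fn e) \<or>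
           (\<exists>y. y \<noteq> val M (\<lambda>v. f v e) t \<and> (val M (\<lambda>v. f v e) s, y) \<in> graph M (fs e)) \<or>
           (\<exists>x. x \<noteq> val M (\<lambda>v. f v e) s \<and> (x, val M (\<lambda>v. f v e) t) \<in> graph M (fs e)))
     (\<lambda>e. \<not> less std (val std (\<lambda>v. g v e) s) (plus std (gn e) (one std)) \<or>
           \<not> less std (val std (\<lambda>v. g v e) t) (gn e) \<or>
           (\<exists>y. y \<noteq> val std (\<lambda>v. g v e) t \<and>
                (val std (\<lambda>v. g v e) s, y) \<in> graph std (gs e)) \<or>
           (\<exists>x. x \<noteq> val std (\<lambda>v. g v e) s \<and>
                (x, val std (\<lambda>v. g v e) t) \<in> graph std (gs e)))"
      apply (rule back_subst[of "rep M _"])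
       apply (rule rep_intros graph_rep trep_intros Rel trep_lift val trep_lift[OF val] trep_lift[OF Rel(2)])+
      by simp
    with False show ?thesis by simp
  qed
next
  case (Imp \<phi> \<psi>)
  show ?case
  proof (cases b)
    case True
    then show ?thesis using rep_disj[OF Imp.IH(1)[OF Imp.prems] Imp.IH(2)[OF Imp.prems]] by simp
  next
    case False
    then show ?thesis using rep_conj[OF Imp.IH(1)[OF Imp.prems] Imp.IH(2)[OF Imp.prems]] by simp
  qed
next
  case (Forall \<phi>)
  have *: "rep M (\<lambda>e. dec M (fn (\<lambda>i. e (Suc i))) (graph M (fs (\<lambda>i. e (Suc i)))) b
       (case_nat (e 0) (\<lambda>v. f v (\<lambda>i. e (Suc i)))) \<phi>)
     (\<lambda>e. dec std (gn (\<lambda>i. e (Suc i))) (graph std (gs (\<lambda>i. e (Suc i)))) b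
       (case_nat (e 0) (\<lambda>v. g v (\<lambda>i. e (Suc i)))) \<phi>)" for b
    by (rule Forall.IH) (rule trep_lift trep_case_nat trep_var Forall.prems)+
  show ?case
  proof (cases b)
    case True
    then show ?thesis using rep_all[OF *[of True]] by simp
  next
    case False
    then show ?thesis using rep_ex[OF *[of False]] by simp
  qed
qed

section \<open>Partial injections in the standard model\<close>

definition PI :: "nat \<Rightarrow> (nat \<times> nat) set \<Rightarrow> bool" where
  "PI n r \<longleftrightarrow> r \<subseteq> {..n} \<times> {..<n} \<and> single_valued r \<and> single_valued (r\<inverse>)"

definition code :: "(nat \<times> nat) set \<Rightarrow> nat"
  where "code r = set_encode (case_prod (pair std) ` r)"

lemma PI_I:
  assumes "r \<subseteq> {..n} \<times> {..<n}" "\<And>x y z. (x, y) \<in> r \<Longrightarrow> (x, z) \<in> r \<Longrightarrow> y = z"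
    "\<And>x y z. (x, z) \<in> r \<Longrightarrow> (y, z) \<in> r \<Longrightarrow> x = y"
  shows "PI n r"
  unfolding PI_def single_valued_def converse_iff using assms by blast

lemma PI_bounds: "PI n r \<Longrightarrow> (x, y) \<in> r \<Longrightarrow> x \<le> n \<and> y < n"
  unfolding PI_def by auto

lemma PI_fun: "PI n r \<Longrightarrow> (x, y) \<in> r \<Longrightarrow> (x, z) \<in> r \<Longrightarrow> y = z"
  unfolding PI_def single_valued_def by blast

lemma PI_inj: "PI n r \<Longrightarrow> (x, z) \<in> r \<Longrightarrow> (y, z) \<in> r \<Longrightarrow> x = y"
  unfolding PI_def single_valued_def by blast

lemma PI_subset: "PI n r \<Longrightarrow> q \<subseteq> r \<Longrightarrow> PI n q"
  unfolding PI_def single_valued_def converse_iff by blast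

lemma PI_finite: "PI n r \<Longrightarrow> finite r"
  unfolding PI_def using finite_subset by blast

text \<open>A violation of single-valuedness or injectivity involves only two pairs, and any two
  pairs lie together in one of the three pairwise unions.\<close>

lemma PI_Un3: "PI n (a \<union> b) \<Longrightarrow> PI n (a \<union> c) \<Longrightarrow> PI n (b \<union> c) \<Longrightarrow> PI n (a \<union> b \<union> c)"
  unfolding PI_def single_valued_def converse_iff by blast

lemma inj_pair_standard: "inj_on (case_prod (pair std)) A"
  by (auto simp: inj_on_def)

lemma ext_code: "finite r \<Longrightarrow> ext std (code r) = case_prod (pair std) ` r"
  by (simp add: code_def)

lemma graph_code [simp]: "finite r \<Longrightarrow> graph std (code r) = r"
  unfolding graph_def ext_code by auto

lemma card_ext_code [simp]: "finite r \<Longrightarrow> card (ext std (code r)) = card r"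
  by (simp add: ext_code card_image inj_pair_standard)

text \<open>A code may contain numbers that are not pairs, which \<open>graph\<close> ignores; the
  second conjunct excludes them.\<close>

lemma pinj_standard:
  "pinj std n s \<longleftrightarrow>
     PI n (graph std s) \<and> ext std s = case_prod (pair std) ` graph std s"
  (is "?L \<longleftrightarrow> ?R")
proof
  assume L: ?L
  have "PI n (graph std s)"
    by (rule PI_I; use L in \<open>fastforce simp: pinj_def graph_def\<close>)
  moreover have "ext std s = case_prod (pair std) ` graph std s"
    using L by (force simp: pinj_def graph_def)
  ultimately show ?R by blast
next
  assume R: ?R
  then have "z \<in> ext std s \<Longrightarrow> \<exists>a b. a \<le> n \<and> b < n \<and> z = pair std a b" for z
    using PI_bounds[of n "graph std s"] by auto
  moreover have "pair std a b \<in> ext std s \<longleftrightarrow> (a, b) \<in> graph std s" for a b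
    by (simp add: graph_def)
  ultimately show ?L unfolding pinj_def using R PI_fun PI_inj by (auto simp: less_Suc_eq_le)
qed

lemma pinj_code: "PI n r \<Longrightarrow> pinj std n (code r)"
  using PI_finite by (simp add: pinj_standard ext_code)

lemma card_graph: "pinj std n s \<Longrightarrow> card (graph std s) = card (ext std s)"
  unfolding pinj_standard by (metis card_image inj_pair_standard)

lemma graph_mono: "sub std s t \<Longrightarrow> graph std s \<subseteq> graph std t"
  unfolding sub_standard graph_def by blast

lemma sub_iff_graph:
  assumes "pinj std n s"
  shows "sub std s t \<longleftrightarrow> graph std s \<subseteq> graph std t"
proof
  assume "graph std s \<subseteq> graph std t"
  moreover have "case_prod (pair std) ` graph std t \<subseteq> ext std t"
    by (auto simp: graph_def)
  ultimately show "sub std s t" using assms unfolding sub_standard pinj_standard by blast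
qed (rule graph_mono)

section \<open>Size bounds in the standard model\<close>

lemma power_sum_le: "(2::nat) \<le> l \<Longrightarrow> l ^ a + l ^ b \<le> l ^ (a + b + 1)"
proof -
  assume l: "2 \<le> l"
  have "l ^ a \<le> l ^ (a + b)" "l ^ b \<le> l ^ (a + b)"
    using l by (simp_all add: power_increasing)
  then have "l ^ a + l ^ b \<le> 2 * l ^ (a + b)" by simp
  also have "\<dots> \<le> l * l ^ (a + b)" using l by (rule mult_right_mono) simp
  finally show ?thesis by simp
qed

lemma len_half_le: "len std (x div 2) \<le> len std x"
  by (rule len_mono) simp

lemma len_add_le: "1 \<le> a \<Longrightarrow> 1 \<le> b \<Longrightarrow> len std x \<le> a \<Longrightarrow> len std y \<le> b \<Longrightarrow>
  len std (x + y) \<le> a + b"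
proof -
  assume ab: "1 \<le> a" "1 \<le> b" and "len std x \<le> a" "len std y \<le> b"
  then have "x < 2 ^ a" "y < 2 ^ b" by (simp_all add: len_le_iff)
  moreover have "2 ^ a + 2 ^ b \<le> (2::nat) ^ (a + b)"
  proof -
    obtain p q where pq: "2 ^ a = 2 + (p::nat)" "2 ^ b = 2 + (q::nat)"
      using self_le_power[of 2 a] self_le_power[of 2 b] ab by (metis le_add_diff_inverse one_le_numeral
          less_eq_Suc_le One_nat_def)
    show ?thesis unfolding power_add pq by (simp add: algebra_simps)
  qed
  ultimately show ?thesis by (simp add: len_le_iff)
qed

lemma len_mult_le: "len std x \<le> a \<Longrightarrow> len std y \<le> b \<Longrightarrow> len std (x * y) \<le> a + b"
  unfolding len_le_iff power_add by (rule mult_strict_mono) simp_all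

definition val_bound :: "trm \<Rightarrow> nat \<Rightarrow> bool" where
  "val_bound t c \<longleftrightarrow> (\<forall>l e. 2 \<le> l \<longrightarrow> (\<forall>v\<in>tvars t. len std (e v) \<le> l) \<longrightarrow>
    len std (val std e t) \<le> l ^ c)"

text \<open>\<open>p * q + 1\<close> is the bound for a smash; sums and products obey it too, by
  \<open>plus_le_times_1\<close>. The summand 1 counts as the power with exponent 0 and is absorbed
  by \<open>power_sum_le\<close>, whence the form of the exponent.\<close>

lemma val_bound_binary:
  assumes st: "val_bound s a" "val_bound t b"
    and f: "\<And>x y p q. 1 \<le> p \<Longrightarrow> 1 \<le> q \<Longrightarrow> len std x \<le> p \<Longrightarrow> len std y \<le> q \<Longrightarrow>
      len std (f x y) \<le> p * q + 1"
    and r: "tvars r = tvars s \<union> tvars t" "\<And>e. val std e r = f (val std e s) (val std e t)"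
  shows "val_bound r (a + b + 0 + 1)"
  unfolding val_bound_def
proof (intro allI impI)
  fix l :: nat and e assume l: "2 \<le> l" and e: "\<forall>v\<in>tvars r. len std (e v) \<le> l"
  have "len std (f (val std e s) (val std e t)) \<le> l ^ a * l ^ b + 1"
    by (rule f) (use st l e in \<open>simp_all add: val_bound_def r\<close>)
  also have "\<dots> = l ^ (a + b) + l ^ 0" by (simp add: power_add)
  also have "\<dots> \<le> l ^ (a + b + 0 + 1)" by (rule power_sum_le[OF l])
  finally show "len std (val std e r) \<le> l ^ (a + b + 0 + 1)" unfolding r(2) .
qed

lemma plus_le_times_1: "1 \<le> p \<Longrightarrow> 1 \<le> q \<Longrightarrow> p + q \<le> p * q + (1::nat)"
  by (cases p; cases q) simp_all

lemma len_val_bound: "\<exists>c. val_bound t c"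
proof (induction t)
  case (Var i)
  show ?case unfolding val_bound_def by (rule exI[of _ 1]) simp
next
  case Zero
  show ?case by (simp add: val_bound_def)
next
  case One
  show ?case unfolding val_bound_def by (rule exI[of _ 0]) simp
next
  case (Half t)
  then show ?case
    using len_half_le le_trans unfolding val_bound_def tvars.simps val.simps standard_simps by meson
next
  case (Len t)
  then show ?case using len_le_self le_trans unfolding val_bound_def tvars.simps val.simps by meson
next
  case (Plus s t)
  then obtain a b where "val_bound s a" "val_bound t b" by blast
  then have "val_bound (s \<^bold>+ t) (a + b + 0 + 1)"
    by (rule val_bound_binary[where f = "(+)"], intro le_trans[OF len_add_le plus_le_times_1]) simp_all
  then show ?case by blast
next
  case (Times s t)
  then obtain a b where "val_bound s a" "val_bound t b" by blast
  then have "val_bound (s \<^bold>* t) (a + b + 0 + 1)"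
    by (rule val_bound_binary[where f = "(*)"], intro le_trans[OF len_mult_le plus_le_times_1]) simp_all
  then show ?case by blast
next
  case (Smash s t)
  then obtain a b where "val_bound s a" "val_bound t b" by blast
  then have "val_bound (s \<^bold># t) (a + b + 0 + 1)"
    by (rule val_bound_binary) (auto intro: mult_le_mono)
  then show ?case by blast
qed

section \<open>Deciding formulas by small extensions, and shrinking certificates\<close>

definition env_le :: "fm \<Rightarrow> nat \<Rightarrow> (nat \<Rightarrow> nat) \<Rightarrow> bool"
  where "env_le \<phi> l e \<longleftrightarrow> (\<forall>v\<in>fvars \<phi>. len std (e v) \<le> l)"

text \<open>The exponent c depends on the formula alone, so it remains a standard number when the
  statement is transferred to M.\<close>

definition decides :: "fm \<Rightarrow> nat \<Rightarrow> bool" where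
  "decides \<phi> c \<longleftrightarrow> (\<forall>l e n r. 2 \<le> l \<longrightarrow> env_le \<phi> l e \<longrightarrow> PI n r \<longrightarrow> card r + l ^ c \<le> n \<longrightarrow>
     (\<exists>q. r \<subseteq> q \<and> PI n q \<and> card q \<le> card r + l ^ c \<and> (dec std n q True e \<phi> \<or> dec std n q False e \<phi>)))"

definition shrinks :: "fm \<Rightarrow> bool \<Rightarrow> nat \<Rightarrow> bool" where
  "shrinks \<phi> b c \<longleftrightarrow> (\<forall>l e n r. 2 \<le> l \<longrightarrow> env_le \<phi> l e \<longrightarrow> dec std n r b e \<phi> \<longrightarrow>
     (\<exists>q. q \<subseteq> r \<and> finite q \<and> card q \<le> l ^ c \<and> dec std n q b e \<phi>))"

lemma fvars_BAll: "fvars (BAll t \<phi>) = tvars t \<union> {i. Suc i \<in> fvars \<phi>}"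
  by (auto simp: BAll_def tvars_tsubst)

lemma fvars_BEx: "fvars (BEx t \<phi>) = tvars t \<union> {i. Suc i \<in> fvars \<phi>}"
  by (auto simp: BEx_def Exists_def Conj_def Neg_def tvars_tsubst)

lemma env_le_case_nat:
  assumes "env_le (BAll t \<phi>) l e" "l \<le> l'" "len std x \<le> l'"
  shows "env_le \<phi> l' (case_nat x e)"
  unfolding env_le_def
proof
  fix v assume "v \<in> fvars \<phi>"
  then show "len std (case_nat x e v) \<le> l'"
    using assms le_trans[of "len std (e (v - 1))" l l']
    unfolding env_le_def fvars_BAll by (cases v) auto
qed

lemma env_le_BEx_iff: "env_le (BEx t \<phi>) l e \<longleftrightarrow> env_le (BAll t \<phi>) l e"
  unfolding env_le_def fvars_BAll fvars_BEx ..

text \<open>With a positive exponent, \<open>l ^ c\<close> bounds the lengths of the old assignment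
  and of all elements below t, so it can replace l under the quantifier.\<close>

lemma bound_term:
  "\<exists>c\<ge>1. \<forall>\<phi> l e. 2 \<le> l \<longrightarrow> env_le (BAll t \<phi>) l e \<longrightarrow> len std (val std e t) \<le> l ^ c"
proof -
  obtain c where "val_bound t c" using len_val_bound by blast
  note c = this[unfolded val_bound_def, rule_format]
  have "len std (val std e t) \<le> l ^ (Suc c)" if "2 \<le> l" "env_le (BAll t \<phi>) l e" for l e \<phi>
  proof -
    have "len std (val std e t) \<le> l ^ c"
      using that by (intro c) (auto simp: env_le_def fvars_BAll)
    also have "\<dots> \<le> l ^ Suc c" using that by (intro power_increasing) simp_all
    finally show ?thesis .
  qed
  then show ?thesis by (intro exI[of _ "Suc c"]) simp
qed

text \<open>D is preserved by extension, so the elements of X can be treated one after the other,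
  each at the cost of k pairs.\<close>

lemma extend_all:
  assumes mono: "\<And>x q r. q \<subseteq> r \<Longrightarrow> D x q \<Longrightarrow> D x r"
    and step: "\<And>x r. x \<in> X \<Longrightarrow> PI n r \<Longrightarrow> card r + k \<le> n \<Longrightarrow>
      \<exists>q. r \<subseteq> q \<and> PI n q \<and> card q \<le> card r + k \<and> D x q"
    and X: "finite X" and r: "PI n r" "card r + card X * k \<le> n"
  shows "\<exists>q. r \<subseteq> q \<and> PI n q \<and> card q \<le> card r + card X * k \<and> (\<forall>x\<in>X. D x q)"
  using X step r(2)
proof (induction X rule: finite_induct)
  case empty
  then show ?case using r(1) by auto
next
  case (insert x X)
  have "\<exists>q. r \<subseteq> q \<and> PI n q \<and> card q \<le> card r + card X * k \<and> (\<forall>x\<in>X. D x q)"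
    by (rule insert.IH) (use insert.prems insert.hyps in simp_all)
  then obtain q where q: "r \<subseteq> q" "PI n q" "card q \<le> card r + card X * k" "\<forall>x\<in>X. D x q"
    by blast
  obtain p where p: "q \<subseteq> p" "PI n p" "card p \<le> card q + k" "D x p"
    using insert.prems(1)[of x q] insert.prems(2) insert.hyps q by auto
  show ?case
    using p q mono[OF p(1)] insert.hyps by (intro exI[of _ p]) auto
qed

text \<open>A sharp bound leaves at most \<open>l ^ b\<close> instances, and all of them are
  decided; each costs \<open>(l ^ b) ^ c\<close> pairs because its argument also has length at most
  \<open>l ^ b\<close>.\<close>

lemma decide_bounded:
  assumes IH: "decides \<phi> c"
  shows "\<exists>d. decides (BAll (Len t) \<phi>) d \<and> decides (BEx (Len t) \<phi>) d"
proof -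
  note IH = IH[unfolded decides_def, rule_format]
  obtain b where b1: "b \<ge> 1" and "\<forall>\<phi> l e. 2 \<le> l \<longrightarrow> env_le (BAll t \<phi>) l e \<longrightarrow>
      len std (val std e t) \<le> l ^ b"
    using bound_term[of t] by blast
  then have b: "val std e (Len t) \<le> l ^ b" if "2 \<le> l" "env_le (BAll (Len t) \<phi>) l e" for l e
    using that by (simp add: env_le_def fvars_BAll)
  have "\<exists>q. r \<subseteq> q \<and> PI n q \<and> card q \<le> card r + l ^ (b + b * c) \<and>
       (dec std n q True e (BAll (Len t) \<phi>) \<or> dec std n q False e (BAll (Len t) \<phi>)) \<and>
       (dec std n q True e (BEx (Len t) \<phi>) \<or> dec std n q False e (BEx (Len t) \<phi>))"
    if l: "2 \<le> l" and e: "env_le (BAll (Len t) \<phi>) l e" and r: "PI n r"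
      and n: "card r + l ^ (b + b * c) \<le> n" for l n e r
  proof -
    define u where "u = val std e (Len t)"
    have u: "u \<le> l ^ b" unfolding u_def using b[OF l e] .
    have lb: "l \<le> l ^ b" using b1 l by (intro self_le_power) simp_all
    have uk: "u * (l ^ b) ^ c \<le> l ^ (b + b * c)"
      using mult_le_mono1[OF u, of "(l ^ b) ^ c"] by (simp add: power_add power_mult)
    have "\<exists>q. r \<subseteq> q \<and> PI n q \<and> card q \<le> card r + card {..<u} * (l ^ b) ^ c \<and>
       (\<forall>x\<in>{..<u}. dec std n q True (case_nat x e) \<phi> \<or> dec std n q False (case_nat x e) \<phi>)"
    proof (rule extend_all)
      fix x q assume "x \<in> {..<u}" and q: "PI n q" "card q + (l ^ b) ^ c \<le> n"
      then have x: "x < u" by simp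
      have "len std x \<le> l ^ b"
        using len_le_self[of x] x u by linarith
      then show "\<exists>p. q \<subseteq> p \<and> PI n p \<and> card p \<le> card q + (l ^ b) ^ c \<and>
          (dec std n p True (case_nat x e) \<phi> \<or> dec std n p False (case_nat x e) \<phi>)"
        using l lb q by (intro IH env_le_case_nat[OF e lb]) simp_all
    next
      show "card r + card {..<u} * (l ^ b) ^ c \<le> n" using n uk by simp
    next
      fix x p q
      assume pq: "p \<subseteq> q" and "dec std n p True (case_nat x e) \<phi> \<or> dec std n p False (case_nat x e) \<phi>"
      then show "dec std n q True (case_nat x e) \<phi> \<or> dec std n q False (case_nat x e) \<phi>"
        using dec_mono[OF pq] by meson
    qed (rule r finite_lessThan)+
    then obtain q where q: "r \<subseteq> q" "PI n q" "card q \<le> card r + u * (l ^ b) ^ c"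
       "\<forall>x < u. dec std n q True (case_nat x e) \<phi> \<or> dec std n q False (case_nat x e) \<phi>"
      by auto
    then have "dec std n q True e (BAll (Len t) \<phi>) \<or> dec std n q False e (BAll (Len t) \<phi>)"
      "dec std n q True e (BEx (Len t) \<phi>) \<or> dec std n q False e (BEx (Len t) \<phi>)"
      unfolding dec_BAll dec_BEx standard_simps u_def by metis+
    moreover have "card q \<le> card r + l ^ (b + b * c)" using q(3) uk by linarith
    ultimately show ?thesis using q(1,2) by blast
  qed
  then show ?thesis unfolding decides_def env_le_BEx_iff by (intro exI[of _ "b + b * c"]) meson
qed

lemma decided_already:
  assumes "\<And>n r e. dec std n r True e \<phi> \<or> dec std n r False e \<phi>"
  shows "\<exists>c. decides \<phi> c"
  unfolding decides_def
proof (intro exI[of _ 0] allI impI)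
  fix l n :: nat and e r
  assume "PI n r"
  then show "\<exists>q. r \<subseteq> q \<and> PI n q \<and> card q \<le> card r + l ^ 0 \<and>
      (dec std n q True e \<phi> \<or> dec std n q False e \<phi>)"
    using assms by (intro exI[of _ r]) simp
qed

lemma decide:
  assumes "\<phi> \<in> sharply_bounded"
  shows "\<exists>c. decides \<phi> c"
  using assms
proof (induction \<phi>)
  case (4 s t)
  show ?case
    unfolding decides_def
  proof (intro exI[of _ 0] allI impI)
    fix l n :: nat and e r
    assume r: "PI n r" and n: "card r + l ^ 0 \<le> n"
    define a b where "a = val std e s" and "b = val std e t"
    show "\<exists>q. r \<subseteq> q \<and> PI n q \<and> card q \<le> card r + l ^ 0 \<and>
       (dec std n q True e (Rel s t) \<or> dec std n q False e (Rel s t))"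
    \<comment> \<open>If both points are in range and free, the pair itself is added and certifies
      R. Otherwise r contains the pair or a clash with it, or the pair is out of range, so r already
      decides the atom.\<close>
    proof (cases "a \<le> n \<and> b < n \<and> a \<notin> Domain r \<and> b \<notin> Range r")
      case True
      have "PI n (insert (a, b) r)"
        by (rule PI_I) (use True r PI_bounds[OF r] in \<open>auto dest: PI_fun PI_inj\<close>)
      moreover have "card (insert (a, b) r) \<le> card r + l ^ 0"
        by (simp add: card_insert_if PI_finite[OF r])
      ultimately show ?thesis
        by (intro exI[of _ "insert (a, b) r"]) (auto simp: a_def b_def)
    next
      case False
      then have "dec std n r True e (Rel s t) \<or> dec std n r False e (Rel s t)"
        by (auto simp: a_def[symmetric] b_def[symmetric])
      then show ?thesis using r by (intro exI[of _ r]) simp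
    qed
  qed
next
  case (5 \<phi> \<psi>)
  obtain a where a: "decides \<phi> a"
    using 5(3) by blast
  obtain b where b: "decides \<psi> b"
    using 5(4) by blast
  note a = a[unfolded decides_def, rule_format]
  note b = b[unfolded decides_def, rule_format]
  show ?case
    unfolding decides_def
  proof (intro exI[of _ "a + b + 1"] allI impI)
    fix l n :: nat and e r
    assume l: "2 \<le> l" and e: "env_le (\<phi> \<^bold>\<longrightarrow> \<psi>) l e" and r: "PI n r" and n: "card r + l ^ (a + b + 1) \<le> n"
    have ab: "l ^ a + l ^ b \<le> l ^ (a + b + 1)" by (rule power_sum_le[OF l])
    have e': "env_le \<phi> l e" "env_le \<psi> l e" using e by (auto simp: env_le_def)
    obtain q where q: "r \<subseteq> q" "PI n q" "card q \<le> card r + l ^ a"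
        "dec std n q True e \<phi> \<or> dec std n q False e \<phi>"
      using a[OF l e'(1) r] n ab by auto
    obtain p where p: "q \<subseteq> p" "PI n p" "card p \<le> card q + l ^ b"
        "dec std n p True e \<psi> \<or> dec std n p False e \<psi>"
      using b[OF l e'(2) q(2)] q n ab by auto
    have "dec std n p True e (\<phi> \<^bold>\<longrightarrow> \<psi>) \<or> dec std n p False e (\<phi> \<^bold>\<longrightarrow> \<psi>)"
      using q(4) p(4) dec_mono[OF p(1)] by auto
    then show "\<exists>q. r \<subseteq> q \<and> PI n q \<and> card q \<le> card r + l ^ (a + b + 1) \<and>
       (dec std n q True e (\<phi> \<^bold>\<longrightarrow> \<psi>) \<or> dec std n q False e (\<phi> \<^bold>\<longrightarrow> \<psi>))"
      using p q ab by (intro exI[of _ p]) auto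
  qed
next
  case (6 \<phi> t)
  then show ?case using decide_bounded[of \<phi> _ t] by blast
next
  case (7 \<phi> t)
  then show ?case using decide_bounded[of \<phi> _ t] by blast
qed (rule decided_already, simp)+

text \<open>The union of the small certificates of the polynomially many instances is still of
  polynomial size.\<close>

lemma shrink_bounded:
  assumes IH: "shrinks \<phi> b c"
  shows "\<exists>d. \<forall>l e n r. 2 \<le> l \<longrightarrow> env_le (BAll (Len t) \<phi>) l e \<longrightarrow>
     (\<forall>x < val std e (Len t). dec std n r b (case_nat x e) \<phi>) \<longrightarrow>
     (\<exists>q. q \<subseteq> r \<and> finite q \<and> card q \<le> l ^ d \<and>
       (\<forall>x < val std e (Len t). dec std n q b (case_nat x e) \<phi>))"
proof -
  note IH = IH[unfolded shrinks_def, rule_format]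
  obtain a where a1: "a \<ge> 1" and "\<forall>\<phi> l e. 2 \<le> l \<longrightarrow> env_le (BAll t \<phi>) l e \<longrightarrow>
      len std (val std e t) \<le> l ^ a"
    using bound_term[of t] by blast
  then have a: "val std e (Len t) \<le> l ^ a" if "2 \<le> l" "env_le (BAll (Len t) \<phi>) l e" for l e
    using that by (simp add: env_le_def fvars_BAll)
  show ?thesis
  proof (intro exI[of _ "a + a * c"] allI impI)
    fix l n :: nat and e r
    assume l: "2 \<le> l" and e: "env_le (BAll (Len t) \<phi>) l e"
      and r: "\<forall>x < val std e (Len t). dec std n r b (case_nat x e) \<phi>"
    define u where "u = val std e (Len t)"
    have u: "u \<le> l ^ a" unfolding u_def using a[OF l e] .
    have la: "l \<le> l ^ a" using a1 l by (intro self_le_power) simp_all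
    have "\<exists>q. q \<subseteq> r \<and> finite q \<and> card q \<le> (l ^ a) ^ c \<and> dec std n q b (case_nat x e) \<phi>"
      if x: "x < u" for x
    proof -
      have "len std x \<le> l ^ a" using len_le_self[of x] x u by linarith
      then show ?thesis
        using l la r x by (intro IH env_le_case_nat[OF e la]) (simp_all add: u_def)
    qed
    then obtain q where q: "\<And>x. x < u \<Longrightarrow> q x \<subseteq> r \<and> finite (q x) \<and> card (q x) \<le> (l ^ a) ^ c \<and>
        dec std n (q x) b (case_nat x e) \<phi>"
      by metis
    have "card (\<Union>x<u. q x) \<le> (\<Sum>x<u. card (q x))" by (rule card_UN_le) simp
    also have "\<dots> \<le> (\<Sum>x<u. (l ^ a) ^ c)" by (rule sum_mono) (use q in simp)
    also have "\<dots> \<le> l ^ (a + a * c)"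
      using mult_le_mono1[OF u, of "(l ^ a) ^ c"] by (simp add: power_add power_mult)
    finally have "card (\<Union>x<u. q x) \<le> l ^ (a + a * c)" .
    moreover have "\<forall>x<u. dec std n (\<Union>x<u. q x) b (case_nat x e) \<phi>"
    proof (intro allI impI)
      fix x assume "x < u"
      then show "dec std n (\<Union>x<u. q x) b (case_nat x e) \<phi>"
        using q[of x] by (metis UN_upper dec_mono lessThan_iff)
    qed
    ultimately show "\<exists>q. q \<subseteq> r \<and> finite q \<and> card q \<le> l ^ (a + a * c) \<and>
       (\<forall>x < val std e (Len t). dec std n q b (case_nat x e) \<phi>)"
      unfolding u_def[symmetric] using q by (intro exI[of _ "\<Union>x<u. q x"]) blast
  qed
qed

text \<open>The certificate of a single witness suffices. The number of candidates does not matter,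
  so the bound t may be any term; it only limits the length of the witness.\<close>

lemma shrink_witness:
  assumes IH: "shrinks \<phi> b c"
  shows "\<exists>d. \<forall>l e n r. 2 \<le> l \<longrightarrow> env_le (BAll t \<phi>) l e \<longrightarrow>
     (\<exists>x < val std e t. dec std n r b (case_nat x e) \<phi>) \<longrightarrow>
     (\<exists>q. q \<subseteq> r \<and> finite q \<and> card q \<le> l ^ d \<and>
       (\<exists>x < val std e t. dec std n q b (case_nat x e) \<phi>))"
proof -
  note IH = IH[unfolded shrinks_def, rule_format]
  obtain a where a1: "a \<ge> 1" and a: "\<forall>\<phi> l e. 2 \<le> l \<longrightarrow> env_le (BAll t \<phi>) l e \<longrightarrow>
      len std (val std e t) \<le> l ^ a"
    using bound_term[of t] by blast
  show ?thesis
  proof (intro exI[of _ "a * c"] allI impI)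
    fix l n :: nat and e r
    assume l: "2 \<le> l" and e: "env_le (BAll t \<phi>) l e"
      and "\<exists>x < val std e t. dec std n r b (case_nat x e) \<phi>"
    then obtain x where x: "x < val std e t" "dec std n r b (case_nat x e) \<phi>" by blast
    have la: "l \<le> l ^ a" using a1 l by (intro self_le_power) simp_all
    have "len std x \<le> len std (val std e t)" using x by (intro len_mono) simp
    then have "len std x \<le> l ^ a" using a l e by (meson le_trans)
    then have "\<exists>q. q \<subseteq> r \<and> finite q \<and> card q \<le> (l ^ a) ^ c \<and> dec std n q b (case_nat x e) \<phi>"
      using l la x by (intro IH env_le_case_nat[OF e la]) simp_all
    then show "\<exists>q. q \<subseteq> r \<and> finite q \<and> card q \<le> l ^ (a * c) \<and>
       (\<exists>x < val std e t. dec std n q b (case_nat x e) \<phi>)"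
      using x(1) by (auto simp: power_mult)
  qed
qed

lemma shrink_atomic:
  assumes "\<And>n r e. dec std n r b e \<phi> \<Longrightarrow> dec std n {} b e \<phi>"
  shows "\<exists>c. shrinks \<phi> b c"
  unfolding shrinks_def
proof (intro exI[of _ 0] allI impI)
  fix l n :: nat and e r
  assume "dec std n r b e \<phi>"
  then show "\<exists>q. q \<subseteq> r \<and> finite q \<and> card q \<le> l ^ 0 \<and> dec std n q b e \<phi>"
    using assms by (intro exI[of _ "{}"]) simp
qed

lemma shrink:
  assumes "\<phi> \<in> sharply_bounded"
  shows "\<exists>c. shrinks \<phi> b c"
  using assms
proof (induction \<phi> arbitrary: b)
  case (4 s t)
  show ?case
    unfolding shrinks_def
  proof (intro exI[of _ 0] allI impI)
    fix l n :: nat and e r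
    assume d: "dec std n r b e (Rel s t)"
    define x y where "x = val std e s" and "y = val std e t"
    note xy = x_def[symmetric] y_def[symmetric]
    have "\<exists>q. q \<subseteq> r \<and> (q = {} \<or> (\<exists>p. q = {p})) \<and> dec std n q b e (Rel s t)"
    proof (cases b)
      case True
      with d have "{(x, y)} \<subseteq> r" "dec std n {(x, y)} b e (Rel s t)" by (simp_all add: xy)
      then show ?thesis by blast
    next
      case False
      with d consider "\<not> x < n + 1 \<or> \<not> y < n" | z where "z \<noteq> y" "(x, z) \<in> r"
        | z where "z \<noteq> x" "(z, y) \<in> r"
        unfolding dec.simps xy standard_simps by (auto split: if_splits)
      then show ?thesis
      proof cases
        case 1
        with False have "dec std n {} b e (Rel s t)" by (simp add: xy)
        then show ?thesis by blast
      next
        case 2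
        with False have "dec std n {(x, z)} b e (Rel s t)" "{(x, z)} \<subseteq> r" by (simp_all add: xy)
        then show ?thesis by blast
      next
        case 3
        with False have "dec std n {(z, y)} b e (Rel s t)" "{(z, y)} \<subseteq> r" by (simp_all add: xy)
        then show ?thesis by blast
      qed
    qed
    then obtain q where "q \<subseteq> r" "q = {} \<or> (\<exists>p. q = {p})" "dec std n q b e (Rel s t)" by blast
    then show "\<exists>q. q \<subseteq> r \<and> finite q \<and> card q \<le> l ^ 0 \<and> dec std n q b e (Rel s t)"
      by (intro exI[of _ q]) (auto simp del: dec.simps)
  qed
next
  case (5 \<phi> \<psi>)
  \<comment> \<open>The antecedent of an implication takes the opposite truth value, which is why
    the induction is over all b.\<close>
  obtain a where a: "shrinks \<phi> (\<not> b) a"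
    using 5(3)[of "\<not> b"] by blast
  obtain c where c: "shrinks \<psi> b c"
    using 5(4)[of b] by blast
  note a = a[unfolded shrinks_def, rule_format]
  note c = c[unfolded shrinks_def, rule_format]
  show ?case
    unfolding shrinks_def
  proof (intro exI[of _ "a + c + 1"] allI impI)
    fix l n :: nat and e r
    assume l: "2 \<le> l" and e: "env_le (\<phi> \<^bold>\<longrightarrow> \<psi>) l e" and d: "dec std n r b e (\<phi> \<^bold>\<longrightarrow> \<psi>)"
    have ac: "l ^ a + l ^ c \<le> l ^ (a + c + 1)" by (rule power_sum_le[OF l])
    have e': "env_le \<phi> l e" "env_le \<psi> l e" using e by (auto simp: env_le_def)
    have "\<exists>q. q \<subseteq> r \<and> finite q \<and> card q \<le> l ^ a + l ^ c \<and> dec std n q b e (\<phi> \<^bold>\<longrightarrow> \<psi>)"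
    proof (cases b)
      case True
      with d consider "dec std n r (\<not> b) e \<phi>" | "dec std n r b e \<psi>" by auto
      then show ?thesis
      proof cases
        case 1
        from a[OF l e'(1) this] True show ?thesis by (auto intro: trans_le_add1)
      next
        case 2
        from c[OF l e'(2) this] True show ?thesis by (auto intro: trans_le_add2)
      qed
    next
      case False
      with d have "dec std n r (\<not> b) e \<phi>" "dec std n r b e \<psi>" by auto
      then obtain p q where "p \<subseteq> r" "finite p" "card p \<le> l ^ a" "dec std n p (\<not> b) e \<phi>"
          "q \<subseteq> r" "finite q" "card q \<le> l ^ c" "dec std n q b e \<psi>"
        using a[OF l e'(1)] c[OF l e'(2)] by meson
      moreover have "card (p \<union> q) \<le> card p + card q" by (rule card_Un_le)
      moreover have "dec std n (p \<union> q) (\<not> b) e \<phi>" "dec std n (p \<union> q) b e \<psi>"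
        using calculation dec_mono[of p "p \<union> q"] dec_mono[of q "p \<union> q"] by (metis Un_upper1, metis Un_upper2)
      ultimately show ?thesis using False by (intro exI[of _ "p \<union> q"]) auto
    qed
    then show "\<exists>q. q \<subseteq> r \<and> finite q \<and> card q \<le> l ^ (a + c + 1) \<and> dec std n q b e (\<phi> \<^bold>\<longrightarrow> \<psi>)"
      using ac by (meson le_trans)
  qed
next
  case (6 \<phi> t)
  obtain c where c: "shrinks \<phi> b c"
    using 6(2)[of b] by blast
  show ?case
  proof (cases b)
    case True
    then have "b = True" by simp
    show ?thesis using shrink_bounded[OF c, of t] unfolding \<open>b = True\<close> shrinks_def dec_BAll standard_simps .
  next
    case False
    then have "b = False" by simp
    show ?thesis using shrink_witness[OF c, of "Len t"] unfolding \<open>b = False\<close> shrinks_def dec_BAll standard_simps .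
  qed
next
  case (7 \<phi> t)
  obtain c where c: "shrinks \<phi> b c"
    using 7(2)[of b] by blast
  show ?case
  proof (cases b)
    case True
    then have "b = True" by simp
    show ?thesis using shrink_witness[OF c, of "Len t"] unfolding \<open>b = True\<close> shrinks_def dec_BEx env_le_BEx_iff standard_simps .
  next
    case False
    then have "b = False" by simp
    show ?thesis using shrink_bounded[OF c, of t] unfolding \<open>b = False\<close> shrinks_def dec_BEx env_le_BEx_iff standard_simps .
  qed
qed (rule shrink_atomic, simp)+

text \<open>Only confirmations are considered: refuting an existential quantifier whose bound is not
  sharp may involve exponentially many instances.\<close>

lemma shrink_Sigma1b:
  assumes "\<phi> \<in> Sigma1b"
  shows "\<exists>c. shrinks \<phi> True c"
  using assms
proof (induction \<phi>)
  case (2 \<phi> t)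
  then obtain c where c: "shrinks \<phi> True c"
    by blast
  show ?case
    using shrink_witness[OF c, of t] unfolding shrinks_def dec_BEx env_le_BEx_iff standard_simps .
qed (rule shrink)

lemma shrink_Pi1b:
  assumes "\<phi> \<in> Pi1b"
  shows "\<exists>c. shrinks \<phi> False c"
  using assms
proof (induction \<phi>)
  case (2 \<phi> t)
  then obtain c where c: "shrinks \<phi> False c"
    by blast
  show ?case
    using shrink_witness[OF c, of t] unfolding shrinks_def dec_BAll standard_simps .
qed (rule shrink)

section \<open>Combinatorics of partial injections\<close>

lemma PI_card_Domain_Range:
  assumes "PI n r"
  shows "card (Domain r) = card r" "card (Range r) = card r"
proof -
  have "inj_on fst r" "inj_on snd r"
    unfolding inj_on_def using PI_fun[OF assms] PI_inj[OF assms] by auto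
  then show "card (Domain r) = card r" "card (Range r) = card r"
    by (simp_all add: Domain_fst Range_snd card_image)
qed

text \<open>r has fewer than n pairs, so some value below n is not yet taken.\<close>

lemma extend_point_dom:
  assumes "PI n r" "card r < n" "x \<le> n"
  obtains q where "r \<subseteq> q" "PI n q" "card q \<le> Suc (card r)" "x \<in> Domain q"
proof (cases "x \<in> Domain r")
  case True
  then show ?thesis using assms that[of r] by simp
next
  case False
  have "\<exists>y<n. y \<notin> Range r"
  proof (rule ccontr)
    assume "\<not> (\<exists>y<n. y \<notin> Range r)"
    then have "{..<n} \<subseteq> Range r" by auto
    then have "card {..<n} \<le> card (Range r)"
      by (rule card_mono[OF finite_Range[OF PI_finite[OF assms(1)]]])
    then show False using assms(2) PI_card_Domain_Range[OF assms(1)] by simp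
  qed
  then obtain y where y: "y < n" "y \<notin> Range r" by blast
  have "PI n (insert (x, y) r)"
    by (rule PI_I) (use False y assms(3) PI_bounds[OF assms(1)] PI_fun[OF assms(1)] PI_inj[OF assms(1)] in auto)
  moreover have "card (insert (x, y) r) \<le> Suc (card r)"
    by (simp add: card_insert_if PI_finite[OF assms(1)])
  ultimately show ?thesis using that[of "insert (x, y) r"] by blast
qed

lemma extend_point_ran:
  assumes "PI n r" "card r < n" "y < n"
  obtains q where "r \<subseteq> q" "PI n q" "card q \<le> Suc (card r)" "y \<in> Range q"
proof (cases "y \<in> Range r")
  case True
  then show ?thesis using assms that[of r] by simp
next
  case False
  have "\<exists>x\<le>n. x \<notin> Domain r"
  proof (rule ccontr)
    assume "\<not> (\<exists>x\<le>n. x \<notin> Domain r)"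
    then have "{..n} \<subseteq> Domain r" by auto
    then have "card {..n} \<le> card (Domain r)"
      by (rule card_mono[OF finite_Domain[OF PI_finite[OF assms(1)]]])
    then show False using assms(2) PI_card_Domain_Range[OF assms(1)] by simp
  qed
  then obtain x where x: "x \<le> n" "x \<notin> Domain r" by blast
  have "PI n (insert (x, y) r)"
    by (rule PI_I) (use False x assms(3) PI_bounds[OF assms(1)] PI_fun[OF assms(1)] PI_inj[OF assms(1)] in auto)
  moreover have "card (insert (x, y) r) \<le> Suc (card r)"
    by (simp add: card_insert_if PI_finite[OF assms(1)])
  ultimately show ?thesis using that[of "insert (x, y) r"] by blast
qed

lemma extend_dom:
  assumes "X \<subseteq> {..n}" and r: "PI n r" "card r + card X \<le> n"
  shows "\<exists>q. r \<subseteq> q \<and> PI n q \<and> card q \<le> card r + card X \<and> X \<subseteq> Domain q"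
proof -
  have "\<exists>q. r \<subseteq> q \<and> PI n q \<and> card q \<le> card r + card X * 1 \<and> (\<forall>x\<in>X. x \<in> Domain q)"
  proof (rule extend_all)
    fix x q assume "x \<in> X" and q: "PI n q" "card q + 1 \<le> n"
    then have "x \<le> n" using assms(1) by auto
    with extend_point_dom[OF q(1), of x] q(2)
    show "\<exists>p. q \<subseteq> p \<and> PI n p \<and> card p \<le> card q + 1 \<and> x \<in> Domain p" by (metis Suc_eq_plus1 Suc_le_eq)
  next
    show "finite X" by (rule finite_subset[OF assms(1)]) simp
  qed (use r in auto)
  then show ?thesis by auto
qed

lemma extend_ran:
  assumes "X \<subseteq> {..<n}" and r: "PI n r" "card r + card X \<le> n"
  shows "\<exists>q. r \<subseteq> q \<and> PI n q \<and> card q \<le> card r + card X \<and> X \<subseteq> Range q"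
proof -
  have "\<exists>q. r \<subseteq> q \<and> PI n q \<and> card q \<le> card r + card X * 1 \<and> (\<forall>x\<in>X. x \<in> Range q)"
  proof (rule extend_all)
    fix x q assume "x \<in> X" and q: "PI n q" "card q + 1 \<le> n"
    then have "x < n" using assms(1) by auto
    with extend_point_ran[OF q(1), of x] q(2)
    show "\<exists>p. q \<subseteq> p \<and> PI n p \<and> card p \<le> card q + 1 \<and> x \<in> Range p" by (metis Suc_eq_plus1 Suc_le_eq)
  next
    show "finite X" by (rule finite_subset[OF assms(1)]) simp
  qed (use r in auto)
  then show ?thesis by auto
qed

text \<open>The chain climbs from 0 to z through the numbers obtained from z by dropping low bits,
  adding at most k pairs per bit. Where this is impossible, x is recorded as a failure of the
  induction step at the current q, and q is kept unchanged from there on.\<close>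

lemma pind_chain:
  assumes "PI n r" "Q 0 r"
  shows "\<exists>q. r \<subseteq> q \<and> PI n q \<and> card q \<le> card r + len std z * k \<and>
    (Q z q \<or> (\<exists>x\<le>z. Q (x div 2) q \<and> \<not> (\<exists>p. q \<subseteq> p \<and> PI n p \<and> card p \<le> card q + k \<and> Q x p)))"
proof (induction z rule: less_induct)
  case (less z)
  show ?case
  proof (cases "z = 0")
    case True
    then show ?thesis using assms by (intro exI[of _ r]) simp
  next
    case False
    then obtain q where q: "r \<subseteq> q" "PI n q" "card q \<le> card r + len std (z div 2) * k"
      "Q (z div 2) q \<or>
        (\<exists>x\<le>z div 2. Q (x div 2) q \<and> \<not> (\<exists>p. q \<subseteq> p \<and> PI n p \<and> card p \<le> card q + k \<and> Q x p))"
      using less.IH[of "z div 2"] by auto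
    have l: "len std z * k = len std (z div 2) * k + k" using len_half[OF False] by simp
    show ?thesis
    proof (cases "\<exists>x\<le>z. Q (x div 2) q \<and> \<not> (\<exists>p. q \<subseteq> p \<and> PI n p \<and> card p \<le> card q + k \<and> Q x p)")
      case True
      then show ?thesis using q(1-3) l by (intro exI[of _ q]) simp
    next
      case none: False
      then have "Q (z div 2) q" using q(4) by (meson div_le_dividend le_trans)
      then obtain p where "q \<subseteq> p" "PI n p" "card p \<le> card q + k" "Q z p"
        using none by blast
      then show ?thesis using q(1,3) l by (intro exI[of _ p]) auto
    qed
  qed
qed

text \<open>The number j bounds the pairs that a C0-certificate can lack on the path, hence the
  remaining rounds of queries. The clauses say that a leaf excludes C0-certificates, that leaves are
  pairwise incompatible, and that every \<rho> containing a C1-certificate meets a leaf, given room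
  to answer the remaining queries.\<close>

definition leaf_set :: "nat \<Rightarrow> nat \<Rightarrow> ((nat \<times> nat) set \<Rightarrow> bool) \<Rightarrow> ((nat \<times> nat) set \<Rightarrow> bool) \<Rightarrow> nat \<Rightarrow>
    (nat \<times> nat) set \<Rightarrow> (nat \<times> nat) set set \<Rightarrow> bool" where
  "leaf_set n k C0 C1 j \<pi> S \<longleftrightarrow> (\<forall>\<tau>\<in>S. PI n \<tau> \<and> \<pi> \<subseteq> \<tau> \<and> card (\<tau> - \<pi>) \<le> 2 * k * j \<and>
        (\<forall>u c. PI n u \<longrightarrow> \<tau> \<subseteq> u \<longrightarrow> c \<subseteq> u \<longrightarrow> \<not> C0 c)) \<and>
      (\<forall>\<tau>\<in>S. \<forall>\<tau>'\<in>S. \<tau> \<noteq> \<tau>' \<longrightarrow> \<not> (\<exists>u. PI n u \<and> \<tau> \<subseteq> u \<and> \<tau>' \<subseteq> u)) \<and>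
      (\<forall>\<rho> c. PI n \<rho> \<longrightarrow> \<pi> \<subseteq> \<rho> \<longrightarrow> c \<subseteq> \<rho> \<longrightarrow> C1 c \<longrightarrow> card \<rho> + 2 * k * j \<le> n \<longrightarrow>
        (\<exists>\<tau>\<in>S. \<exists>u. PI n u \<and> \<tau> \<subseteq> u \<and> \<rho> \<subseteq> u))"

text \<open>The members of S are the leaves labelled 1 of a decision tree over \<open>\<pi>\<close>: as long as both labels are
  possible, it queries the domain and the range of some C1-certificate. Each C0-certificate compatible
  with the path clashes with that C1-certificate, so it loses a pair not yet on the path.\<close>

lemma decision_tree:
  fixes n k j :: nat and C0 C1 :: "(nat \<times> nat) set \<Rightarrow> bool" and \<sigma> \<pi> :: "(nat \<times> nat) set"
  assumes clash: "\<And>u c0 c1. PI n u \<Longrightarrow> \<sigma> \<subseteq> u \<Longrightarrow> c0 \<subseteq> u \<Longrightarrow> c1 \<subseteq> u \<Longrightarrow> C0 c0 \<Longrightarrow> C1 c1 \<Longrightarrow> False"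
    and k: "\<And>c. C1 c \<Longrightarrow> card c \<le> k"
    and \<pi>: "PI n \<pi>" "\<sigma> \<subseteq> \<pi>"
    and j: "\<And>u c. PI n u \<Longrightarrow> \<pi> \<subseteq> u \<Longrightarrow> c \<subseteq> u \<Longrightarrow> C0 c \<Longrightarrow> card (c - \<pi>) \<le> j"
  shows "\<exists>S. leaf_set n k C0 C1 j \<pi> S"
  using \<pi> j
proof (induction j arbitrary: \<pi>)
  case 0
  show ?case
  proof (cases "\<exists>u c. PI n u \<and> \<pi> \<subseteq> u \<and> c \<subseteq> u \<and> C0 c")
    case True
    then obtain u c where c: "PI n u" "\<pi> \<subseteq> u" "c \<subseteq> u" "C0 c" by blast
    have "finite (c - \<pi>)" using PI_finite[OF c(1)] c(3) finite_subset by blast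
    \<comment> \<open>With no pair missing, the C0-certificate lies on the path itself. It clashes
      with every C1-certificate, so the tree has no accepting leaf.\<close>
    then have c\<pi>: "c \<subseteq> \<pi>" using "0.prems"(3)[OF c] by simp
    have "\<not> C1 c1" if "PI n \<rho>" "\<pi> \<subseteq> \<rho>" "c1 \<subseteq> \<rho>" for \<rho> c1
      using clash[OF that(1) _ _ that(3) c(4)] that(2) "0.prems"(2) c\<pi> by blast
    then show ?thesis unfolding leaf_set_def by (intro exI[of _ "{}"]) blast
  next
    case False
    then show ?thesis using "0.prems"(1) unfolding leaf_set_def by (intro exI[of _ "{\<pi>}"]) auto
  qed
next
  case (Suc j)
  show ?case
  proof (cases "\<exists>u c. PI n u \<and> \<pi> \<subseteq> u \<and> c \<subseteq> u \<and> C1 c")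
    case False
    then show ?thesis unfolding leaf_set_def by (intro exI[of _ "{}"]) auto
  next
    case True
    then obtain u1 c1 where c1: "PI n u1" "\<pi> \<subseteq> u1" "c1 \<subseteq> u1" "C1 c1" by blast
    have fin1: "finite c1" using PI_finite[OF c1(1)] c1(3) finite_subset by blast
    have PI1: "PI n c1" using PI_subset[OF c1(1,3)] .
    \<comment> \<open>E is the set of possible answers: extensions of \<pi> that settle every point
      of c1 and whose new pairs all pass through such a point.\<close>
    define E where "E = {\<tau>. PI n \<tau> \<and> \<pi> \<subseteq> \<tau> \<and> Domain c1 \<subseteq> Domain \<tau> \<and> Range c1 \<subseteq> Range \<tau> \<and>
      (\<forall>x y. (x, y) \<in> \<tau> \<longrightarrow> (x, y) \<notin> \<pi> \<longrightarrow> x \<in> Domain c1 \<or> y \<in> Range c1)}"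
    \<comment> \<open>A new pair of \<tau> passes through a queried point, which \<tau>' settles as
      well; inside a common extension both settle it by the same pair.\<close>
    have E_anti: "\<tau> = \<tau>'" if "\<tau> \<in> E" "\<tau>' \<in> E" "PI n u" "\<tau> \<subseteq> u" "\<tau>' \<subseteq> u" for \<tau> \<tau>' u
    proof -
      have "\<tau> \<subseteq> \<tau>'" if E: "\<tau> \<in> E" "\<tau>' \<in> E" and u: "\<tau> \<subseteq> u" "\<tau>' \<subseteq> u" for \<tau> \<tau>'
      proof clarify
        fix x y assume xy: "(x, y) \<in> \<tau>"
        show "(x, y) \<in> \<tau>'"
        proof (cases "(x, y) \<in> \<pi>")
          case True
          then show ?thesis using E(2) unfolding E_def by blast
        next
          case False
          then consider "x \<in> Domain c1" | "y \<in> Range c1" using E(1) xy unfolding E_def by blast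
          then show ?thesis
          proof cases
            case 1
            then obtain z where z: "(x, z) \<in> \<tau>'" using E(2) unfolding E_def by blast
            then have "z = y" using PI_fun[OF \<open>PI n u\<close>, of x z y] xy u by blast
            with z show ?thesis by simp
          next
            case 2
            then obtain z where z: "(z, y) \<in> \<tau>'" using E(2) unfolding E_def by blast
            then have "z = x" using PI_inj[OF \<open>PI n u\<close>, of z y x] xy u by blast
            with z show ?thesis by simp
          qed
        qed
      qed
      then show ?thesis using that by blast
    qed
    \<comment> \<open>Each new pair is charged to a queried point, and c1 has at most k points on
      either side.\<close>
    have E_card: "card (\<tau> - \<pi>) \<le> 2 * k" if "\<tau> \<in> E" for \<tau>
    proof -
      have \<tau>: "PI n \<tau>" using that unfolding E_def by blast
      note fin = PI_finite[OF \<tau>]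
      define P Q where "P = {p \<in> \<tau>. fst p \<in> Domain c1}" and "Q = {p \<in> \<tau>. snd p \<in> Range c1}"
      have "card P \<le> card (Domain c1)"
      proof (rule card_inj_on_le)
        show "inj_on fst P" unfolding inj_on_def P_def using PI_fun[OF \<tau>] by auto
      qed (auto simp: P_def finite_Domain[OF fin1])
      moreover have "card Q \<le> card (Range c1)"
      proof (rule card_inj_on_le)
        show "inj_on snd Q" unfolding inj_on_def Q_def using PI_inj[OF \<tau>] by auto
      qed (auto simp: Q_def finite_Range[OF fin1])
      moreover have "card (P \<union> Q) \<le> card P + card Q" by (rule card_Un_le)
      moreover have "card (\<tau> - \<pi>) \<le> card (P \<union> Q)"
      proof (rule card_mono)
        show "finite (P \<union> Q)" using fin unfolding P_def Q_def by simp
        have "x \<in> Domain c1 \<or> y \<in> Range c1" if "(x, y) \<in> \<tau>" "(x, y) \<notin> \<pi>" for x y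
          using \<open>\<tau> \<in> E\<close> that unfolding E_def by blast
        then show "\<tau> - \<pi> \<subseteq> P \<union> Q" unfolding P_def Q_def by force
      qed
      ultimately show ?thesis using k[OF c1(4)] PI_card_Domain_Range[OF PI1] by linarith
    qed
    have E_step: "card (c - \<tau>) \<le> j" if \<tau>: "\<tau> \<in> E" and u: "PI n u" "\<tau> \<subseteq> u" "c \<subseteq> u" "C0 c" for \<tau> u c
    proof -
      have \<pi>u: "\<pi> \<subseteq> u" using \<tau> u(2) unfolding E_def by blast
      have "\<exists>p. p \<in> c \<and> p \<in> \<tau> \<and> p \<notin> \<pi>"
      proof (rule ccontr)
        assume "\<not> ?thesis"
        then have c\<tau>: "\<And>p. p \<in> c \<Longrightarrow> p \<in> \<tau> \<Longrightarrow> p \<in> u1" using c1(2) by blast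
        \<comment> \<open>\<tau> settles x and lies in u together with c, so the pair of c at x
          belongs to \<tau>. As c and \<tau> are assumed to meet only within \<pi>, this pair lies
          in u1, where c1 lies too.\<close>
        have ux: "y = z" if xy: "(x, y) \<in> c" "(x, z) \<in> c1" for x y z
        proof -
          have "x \<in> Domain \<tau>" using \<tau> that unfolding E_def by blast
          then obtain w where w: "(x, w) \<in> \<tau>" by blast
          have "w = y" using PI_fun[OF u(1), of x w y] w u xy by blast
          with w xy c\<tau> have "(x, y) \<in> u1" by blast
          then show ?thesis using PI_fun[OF c1(1), of x y z] xy c1 by blast
        qed
        have uy: "x = z" if xy: "(x, y) \<in> c" "(z, y) \<in> c1" for x y z
        proof -
          have "y \<in> Range \<tau>" using \<tau> that unfolding E_def by blast
          then obtain w where w: "(w, y) \<in> \<tau>" by blast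
          have "w = x" using PI_inj[OF u(1), of w y x] w u xy by blast
          with w xy c\<tau> have "(x, y) \<in> u1" by blast
          then show ?thesis using PI_inj[OF c1(1), of x y z] xy c1 by blast
        qed
        have cc: "PI n (c \<union> c1)"
        proof (rule PI_I)
          show "c \<union> c1 \<subseteq> {..n} \<times> {..<n}" using u(1,3) c1(1,3) unfolding PI_def by blast
        next
          fix x y z assume "(x, y) \<in> c \<union> c1" "(x, z) \<in> c \<union> c1"
          then show "y = z"
            using PI_fun[OF PI_subset[OF u(1,3)], of x y z] PI_fun[OF PI1, of x y z] ux[of x y z] ux[of x z y] by blast
        next
          fix x y z assume "(x, z) \<in> c \<union> c1" "(y, z) \<in> c \<union> c1"
          then show "x = y"
            using PI_inj[OF PI_subset[OF u(1,3)], of x z y] PI_inj[OF PI1, of x z y] uy[of x z y] uy[of y z x] by blast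
        qed
        \<comment> \<open>This union would contain certificates of both kinds over \<sigma>. Hence
          every answer puts a new pair of c on the path, and j drops by one.\<close>
        have "PI n (\<pi> \<union> c \<union> c1)"
          by (rule PI_Un3[OF PI_subset[OF u(1)] PI_subset[OF c1(1)] cc]) (use \<pi>u u c1 in auto)
        from clash[OF this _ _ _ u(4) c1(4)] Suc.prems(2) show False by blast
      qed
      then obtain p where p: "p \<in> c" "p \<in> \<tau>" "p \<notin> \<pi>" by blast
      have "finite c" using PI_finite[OF PI_subset[OF u(1,3)]] .
      moreover have "\<pi> \<subseteq> \<tau>" using \<tau> unfolding E_def by blast
      ultimately have "card (c - \<tau>) < card (c - \<pi>)"
        using p by (intro psubset_card_mono) auto
      moreover have "card (c - \<pi>) \<le> Suc j" by (rule Suc.prems(3)[OF u(1) \<pi>u u(3,4)])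
      ultimately show ?thesis by simp
    qed
    have "\<exists>S. leaf_set n k C0 C1 j \<tau> S" if \<tau>: "\<tau> \<in> E" for \<tau>
    proof (rule Suc.IH)
      show "PI n \<tau>" "\<sigma> \<subseteq> \<tau>" using \<tau> Suc.prems(2) unfolding E_def by blast+
    qed (rule E_step[OF \<tau>])
    then obtain S where S: "\<And>\<tau>. \<tau> \<in> E \<Longrightarrow> leaf_set n k C0 C1 j \<tau> (S \<tau>)" by metis
    have S1: "PI n \<tau>" "\<mu> \<subseteq> \<tau>" "card (\<tau> - \<mu>) \<le> 2 * k * j" if "\<mu> \<in> E" "\<tau> \<in> S \<mu>" for \<mu> \<tau>
      using bspec[OF conjunct1[OF S[OF that(1), unfolded leaf_set_def]] that(2)] by simp_all
    have S2: "\<not> C0 c" if "\<mu> \<in> E" "\<tau> \<in> S \<mu>" "PI n u" "\<tau> \<subseteq> u" "c \<subseteq> u" for \<mu> \<tau> u c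
      using bspec[OF conjunct1[OF S[OF that(1), unfolded leaf_set_def]] that(2)] that(3-5) by simp
    have S3: "\<tau> = \<tau>'" if "\<mu> \<in> E" "\<tau> \<in> S \<mu>" "\<tau>' \<in> S \<mu>" "PI n u" "\<tau> \<subseteq> u" "\<tau>' \<subseteq> u" for \<mu> \<tau> \<tau>' u
      using conjunct1[OF conjunct2[OF S[OF that(1), unfolded leaf_set_def]]] that(2-) by blast
    have S4: "\<exists>\<tau>\<in>S \<mu>. \<exists>u. PI n u \<and> \<tau> \<subseteq> u \<and> \<rho> \<subseteq> u"
      if "\<mu> \<in> E" "PI n \<rho>" "\<mu> \<subseteq> \<rho>" "c \<subseteq> \<rho>" "C1 c" "card \<rho> + 2 * k * j \<le> n" for \<mu> \<rho> c
      by (rule conjunct2[OF conjunct2[OF S[OF that(1), unfolded leaf_set_def]], rule_format, OF that(2-)])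
    show ?thesis
      unfolding leaf_set_def
    proof (intro exI[of _ "\<Union>\<tau>\<in>E. S \<tau>"] conjI ballI allI impI)
      fix \<tau> assume "\<tau> \<in> (\<Union>\<tau>\<in>E. S \<tau>)"
      then obtain \<mu> where \<mu>: "\<mu> \<in> E" "\<tau> \<in> S \<mu>" by blast
      note \<tau> = S1[OF \<mu>] S2[OF \<mu>]
      have \<pi>\<mu>: "\<pi> \<subseteq> \<mu>" using \<mu>(1) unfolding E_def by blast
      show "PI n \<tau>" by (rule \<tau>(1))
      show "\<pi> \<subseteq> \<tau>" using \<pi>\<mu> \<tau>(2) by blast
      have "\<tau> - \<pi> = (\<tau> - \<mu>) \<union> (\<mu> - \<pi>)" using \<pi>\<mu> \<tau>(2) by blast
      then have "card (\<tau> - \<pi>) \<le> card (\<tau> - \<mu>) + card (\<mu> - \<pi>)" by (metis card_Un_le)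
      also have "\<dots> \<le> 2 * k * Suc j" using \<tau>(3) E_card[OF \<mu>(1)] by simp
      finally show "card (\<tau> - \<pi>) \<le> 2 * k * Suc j" .
      fix u c assume "PI n u" "\<tau> \<subseteq> u" "c \<subseteq> u"
      then show "\<not> C0 c" by (rule \<tau>(4))
    next
      fix \<tau> \<tau>' assume "\<tau> \<in> (\<Union>\<tau>\<in>E. S \<tau>)" "\<tau>' \<in> (\<Union>\<tau>\<in>E. S \<tau>)" and ne: "\<tau> \<noteq> \<tau>'"
      then obtain \<mu> \<mu>' where \<mu>: "\<mu> \<in> E" "\<tau> \<in> S \<mu>" "\<mu>' \<in> E" "\<tau>' \<in> S \<mu>'" by blast
      show "\<not> (\<exists>u. PI n u \<and> \<tau> \<subseteq> u \<and> \<tau>' \<subseteq> u)"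
      proof
        assume "\<exists>u. PI n u \<and> \<tau> \<subseteq> u \<and> \<tau>' \<subseteq> u"
        then obtain u where u: "PI n u" "\<tau> \<subseteq> u" "\<tau>' \<subseteq> u" by blast
        have "\<mu> \<subseteq> u" "\<mu>' \<subseteq> u" using S1(2)[OF \<mu>(1,2)] S1(2)[OF \<mu>(3,4)] u by blast+
        then have "\<mu> = \<mu>'" by (rule E_anti[OF \<mu>(1,3) u(1)])
        with S3[OF \<mu>(1,2) _ u] \<mu>(4) ne show False by blast
      qed
    next
      fix \<rho> c assume \<rho>: "PI n \<rho>" "\<pi> \<subseteq> \<rho>" "c \<subseteq> \<rho>" "C1 c" and card: "card \<rho> + 2 * k * Suc j \<le> n"
      have kc: "card c1 \<le> k" by (rule k[OF c1(4)])
      note cD = PI_card_Domain_Range[OF PI1]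
      have "Domain c1 \<subseteq> {..n}" "Range c1 \<subseteq> {..<n}" using PI1 unfolding PI_def by auto
      \<comment> \<open>\<rho> is extended so that it answers all queries, by at most k pairs for
        the domain and then at most k for the range; the hypothesis on \<open>card \<rho>\<close>
        provides the room.\<close>
      then obtain q where q: "\<rho> \<subseteq> q" "PI n q" "card q \<le> card \<rho> + card (Domain c1)" "Domain c1 \<subseteq> Domain q"
        using extend_dom[OF \<open>Domain c1 \<subseteq> {..n}\<close> \<rho>(1)] card kc cD by auto
      obtain p where p: "q \<subseteq> p" "PI n p" "card p \<le> card q + card (Range c1)" "Range c1 \<subseteq> Range p"
        using extend_ran[OF \<open>Range c1 \<subseteq> {..<n}\<close> q(2)] card kc cD q(3) by auto
      \<comment> \<open>The part of p that answers the queries is a member of E, and the remaining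
        search takes place in its subtree.\<close>
      define \<mu> where "\<mu> = \<pi> \<union> {t \<in> p. fst t \<in> Domain c1 \<or> snd t \<in> Range c1}"
      have \<mu>p: "\<mu> \<subseteq> p" unfolding \<mu>_def using \<rho>(2) q(1) p(1) by blast
      have "Domain c1 \<subseteq> Domain \<mu>"
      proof
        fix x assume x: "x \<in> Domain c1"
        then obtain y where "(x, y) \<in> p" using q(4) p(1) by blast
        with x show "x \<in> Domain \<mu>" unfolding \<mu>_def by force
      qed
      moreover have "Range c1 \<subseteq> Range \<mu>"
      proof
        fix y assume y: "y \<in> Range c1"
        then obtain x where "(x, y) \<in> p" using p(4) by blast
        with y show "y \<in> Range \<mu>" unfolding \<mu>_def by force
      qed
      moreover have "PI n \<mu>" by (rule PI_subset[OF p(2) \<mu>p])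
      ultimately have \<mu>E: "\<mu> \<in> E" unfolding E_def by (auto simp: \<mu>_def)
      have "card p + 2 * k * j \<le> n" using card p(3) q(3) kc cD by simp
      moreover have "c \<subseteq> p" using \<rho>(3) q(1) p(1) by blast
      ultimately have "\<exists>\<tau>\<in>S \<mu>. \<exists>u. PI n u \<and> \<tau> \<subseteq> u \<and> p \<subseteq> u"
        using S4[OF \<mu>E p(2) \<mu>p _ \<rho>(4)] by blast
      then obtain \<tau> u where \<tau>: "\<tau> \<in> S \<mu>" "PI n u" "\<tau> \<subseteq> u" "p \<subseteq> u" by blast
      then have "\<rho> \<subseteq> u" using q(1) p(1) by blast
      with \<tau> \<mu>E show "\<exists>\<tau>\<in>\<Union>\<tau>\<in>E. S \<tau>. \<exists>u. PI n u \<and> \<tau> \<subseteq> u \<and> \<rho> \<subseteq> u" by blast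
    qed
  qed
qed

section \<open>Transferred facts\<close>

lemma pinj_sub: "pinj I n t \<Longrightarrow> sub I s t \<Longrightarrow> pinj I n s"
  unfolding pinj_def sub_def by metis

text \<open>This codes the accepting leaves of the tree over \<sigma>, with \<sigma> removed from
  each. The size 2kk is the bound 2kj of \<open>leaf_set\<close> for j = k: initially a
  C0-certificate may lack all of its at most k pairs.\<close>

definition good_entry ::
  "'a interp \<Rightarrow> 'a \<Rightarrow> 'a \<Rightarrow> 'a \<Rightarrow> ('a \<Rightarrow> bool) \<Rightarrow> ('a \<Rightarrow> bool) \<Rightarrow> 'a \<Rightarrow> bool" where
  "good_entry I n k \<sigma> C0 C1 s \<longleftrightarrow>
    (\<forall>\<tau>. \<tau> \<in> ext I s \<longrightarrow> pinj I n \<tau> \<and>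
      card_le I \<tau> (times I (plus I (one I) (one I)) (times I k k)) \<and>
      (\<exists>u. pinj I n u \<and> joins I u \<tau> \<sigma>) \<and> (\<forall>x. \<not> (x \<in> ext I \<tau> \<and> x \<in> ext I \<sigma>)) \<and>
      (\<forall>u c. pinj I n u \<longrightarrow> sub I \<tau> u \<longrightarrow> sub I \<sigma> u \<longrightarrow> sub I c u \<longrightarrow> card_le I c k \<longrightarrow> \<not> C0 c)) \<and>
    (\<forall>\<tau> \<tau>'. \<tau> \<in> ext I s \<longrightarrow> \<tau>' \<in> ext I s \<longrightarrow> compat I n \<tau> \<tau>' \<longrightarrow> \<tau> = \<tau>') \<and>
    (\<forall>\<rho> c l. pinj I n \<rho> \<longrightarrow> sub I \<sigma> \<rho> \<longrightarrow> sub I c \<rho> \<longrightarrow> card_le I c k \<longrightarrow> C1 c \<longrightarrow> card_le I \<rho> l \<longrightarrow>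
      leq I (plus I l (times I (plus I (one I) (one I)) (times I k k))) n \<longrightarrow>
      (\<exists>\<tau>. \<tau> \<in> ext I s \<and> compat I n \<tau> \<rho>))"

lemma good_entry_exists:
  assumes \<sigma>: "pinj std n \<sigma>"
    and clash: "\<And>u c0 c1. pinj std n u \<Longrightarrow> sub std \<sigma> u \<Longrightarrow> sub std c0 u \<Longrightarrow>
      sub std c1 u \<Longrightarrow> card_le std c0 k \<Longrightarrow> card_le std c1 k \<Longrightarrow> C0 c0 \<Longrightarrow> C1 c1 \<Longrightarrow> False"
  shows "\<exists>s. good_entry std n k \<sigma> C0 C1 s"
proof -
  define g where "g = graph std \<sigma>"
  \<comment> \<open>C0 and C1 are properties of codes, whereas the tree works with relations; D also
    incorporates the size bound k.\<close>
  define D where "D C r \<longleftrightarrow> (\<exists>c. pinj std n c \<and> graph std c = r \<and> card_le std c k \<and> C c)" for C r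
  have DI: "D C (graph std c)" if "pinj std n u" "sub std c u" "card_le std c k" "C c" for C c u
    using pinj_sub[OF that(1,2)] that(3,4) unfolding D_def by blast
  have Dk: "card r \<le> k" if "D C r" for C r
  proof -
    obtain c where c: "pinj std n c" "graph std c = r" "card_le std c k"
      using \<open>D C r\<close> unfolding D_def by blast
    from c(3) card_graph[OF c(1)] show ?thesis unfolding c(2) card_le_standard by simp
  qed
  have g: "PI n g" using \<sigma> unfolding g_def pinj_standard by blast
  have code_sub: "sub std c (code u)" if "pinj std n c" "graph std c \<subseteq> u" "PI n u" for c u
    unfolding sub_iff_graph[OF that(1)] graph_code[OF PI_finite[OF that(3)]] by (rule that(2))
  have clash': False
    if u: "PI n u" "g \<subseteq> u" "c0 \<subseteq> u" "c1 \<subseteq> u" and c0: "D C0 c0" and c1: "D C1 c1" for u c0 c1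
  proof -
    obtain a where a: "pinj std n a" "graph std a = c0" "card_le std a k" "C0 a"
      using c0 unfolding D_def by blast
    obtain b where b: "pinj std n b" "graph std b = c1" "card_le std b k" "C1 b"
      using c1 unfolding D_def by blast
    show False
    proof (rule clash[OF pinj_code[OF u(1)] _ _ _ a(3) b(3) a(4) b(4)])
      show "sub std \<sigma> (code u)" by (rule code_sub[OF \<sigma> _ u(1)]) (use u(2) in \<open>simp add: g_def\<close>)
      show "sub std a (code u)" by (rule code_sub[OF a(1) _ u(1)]) (use u(3) a(2) in simp)
      show "sub std b (code u)" by (rule code_sub[OF b(1) _ u(1)]) (use u(4) b(2) in simp)
    qed
  qed
  have C0k: "card (c - g) \<le> k" if "PI n u" "g \<subseteq> u" "c \<subseteq> u" "D C0 c" for u c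
  proof -
    have "card (c - g) \<le> card c" by (rule card_mono[OF PI_finite[OF PI_subset[OF that(1,3)]] Diff_subset])
    with Dk[OF that(4)] show ?thesis by linarith
  qed
  obtain S where
    S1: "\<forall>t\<in>S. PI n t \<and> g \<subseteq> t \<and> card (t - g) \<le> 2 * k * k \<and>
        (\<forall>u c. PI n u \<longrightarrow> t \<subseteq> u \<longrightarrow> c \<subseteq> u \<longrightarrow> \<not> D C0 c)" and
    S2: "\<forall>t\<in>S. \<forall>t'\<in>S. t \<noteq> t' \<longrightarrow> \<not> (\<exists>u. PI n u \<and> t \<subseteq> u \<and> t' \<subseteq> u)" and
    S3: "\<forall>\<rho> c. PI n \<rho> \<longrightarrow> g \<subseteq> \<rho> \<longrightarrow> c \<subseteq> \<rho> \<longrightarrow> D C1 c \<longrightarrow> card \<rho> + 2 * k * k \<le> n \<longrightarrow>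
        (\<exists>t\<in>S. \<exists>u. PI n u \<and> t \<subseteq> u \<and> \<rho> \<subseteq> u)"
    by (rule exE[OF decision_tree[of n g "D C0" "D C1" k g k, unfolded leaf_set_def]])
      (assumption | elim conjE | rule clash' Dk g subset_refl C0k that)+
  note S1 = bspec[OF S1] and S2 = S2[rule_format] and S3 = S3[rule_format]
  define s where "s = set_encode ((\<lambda>t. code (t - g)) ` S)"
  have "S \<subseteq> Pow ({..n} \<times> {..<n})" using S1 unfolding PI_def by blast
  then have "finite S" using finite_subset by blast
  then have s: "ext std s = (\<lambda>t. code (t - g)) ` S" unfolding s_def by simp
  have gr: "graph std (code (t - g)) = t - g" "pinj std n (code (t - g))" if "t \<in> S" for t
    using S1[OF that] PI_subset[of n t "t - g"] pinj_code PI_finite by auto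
  have "good_entry std n k \<sigma> C0 C1 s"
    unfolding good_entry_def
  proof (intro conjI allI impI)
    fix \<tau> assume "\<tau> \<in> ext std s"
    then obtain t where t: "t \<in> S" "\<tau> = code (t - g)" unfolding s by blast
    note S1t = S1[OF t(1)]
    show "pinj std n \<tau>" using gr[OF t(1)] t(2) by simp
    have fin: "finite (t - g)" using PI_finite S1t by blast
    show "card_le std \<tau> (times std (plus std (one std) (one std)) (times std k k))"
      using S1t fin unfolding card_le_standard t(2) by (simp add: mult.assoc)
    have ext\<sigma>: "ext std \<sigma> = case_prod (pair std) ` g"
      using \<sigma> unfolding pinj_standard g_def by blast
    have "joins std (code t) \<tau> \<sigma>"
      unfolding joins_standard t(2) ext\<sigma> ext_code[OF fin] ext_code[OF PI_finite[of n t, OF S1t[THEN conjunct1]]]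
        image_Un[symmetric] using S1t by (simp add: Un_absorb2)
    then show "\<exists>u. pinj std n u \<and> joins std u \<tau> \<sigma>" using pinj_code S1t by blast
    fix x show "\<not> (x \<in> ext std \<tau> \<and> x \<in> ext std \<sigma>)"
      unfolding t(2) ext\<sigma> ext_code[OF fin] by auto
  next
    fix \<tau> u c assume "\<tau> \<in> ext std s" and u: "pinj std n u" "sub std \<tau> u" "sub std \<sigma> u"
      "sub std c u" "card_le std c k"
    then obtain t where t: "t \<in> S" "\<tau> = code (t - g)" unfolding s by blast
    have "t - g \<subseteq> graph std u" using graph_mono[OF u(2)] gr[OF t(1)] t(2) by simp
    moreover have "g \<subseteq> graph std u" using graph_mono[OF u(3)] unfolding g_def .
    ultimately have "t \<subseteq> graph std u" by blast
    then have "\<not> D C0 (graph std c)"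
      using S1[OF t(1)] graph_mono[OF u(4)] u(1) unfolding pinj_standard by blast
    then show "\<not> C0 c" using DI[OF u(1,4,5), of C0] by blast
  next
    fix \<tau> \<tau>' assume "\<tau> \<in> ext std s" "\<tau>' \<in> ext std s" "compat std n \<tau> \<tau>'"
    then obtain t t' u where t: "t \<in> S" "\<tau> = code (t - g)" and t': "t' \<in> S" "\<tau>' = code (t' - g)"
      and u: "pinj std n u" "sub std \<tau> u" "sub std \<tau>' u" unfolding s compat_def by blast
    have "t - g \<subseteq> graph std u" using graph_mono[OF u(2)] gr[OF t(1)] t(2) by simp
    moreover have "t' - g \<subseteq> graph std u" using graph_mono[OF u(3)] gr[OF t'(1)] t'(2) by simp
    moreover have "PI n (graph std u)" using u(1) unfolding pinj_standard by blast
    ultimately have "PI n ((t - g) \<union> (t' - g))" using PI_subset by (meson Un_least)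
    \<comment> \<open>The antichain property holds for the leaves with \<sigma> included. It passes
      to the reduced leaves because each of them is compatible with g, and pairwise compatibility of
      the three relations suffices.\<close>
    moreover have "PI n ((t - g) \<union> g)" "PI n ((t' - g) \<union> g)"
      by (rule PI_subset[of n t], use S1[OF t(1)] in blast, use S1[OF t(1)] in blast)
        (rule PI_subset[of n t'], use S1[OF t'(1)] in blast, use S1[OF t'(1)] in blast)
    ultimately have "PI n ((t - g) \<union> (t' - g) \<union> g)" by (rule PI_Un3)
    moreover have "t \<subseteq> (t - g) \<union> (t' - g) \<union> g" "t' \<subseteq> (t - g) \<union> (t' - g) \<union> g" by blast+
    ultimately have "t = t'" using S2[OF t(1) t'(1)] by blast
    then show "\<tau> = \<tau>'" using t t' by simp
  next
    fix \<rho> c l assume \<rho>: "pinj std n \<rho>" "sub std \<sigma> \<rho>" "sub std c \<rho>" "card_le std c k"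
      "C1 c" "card_le std \<rho> l"
      "leq std (plus std l (times std (plus std (one std) (one std))
        (times std k k))) n"
    have "card (graph std \<rho>) + 2 * k * k \<le> n"
      using \<rho>(6,7) card_graph[OF \<rho>(1)] unfolding card_le_standard by simp
    moreover have "PI n (graph std \<rho>)" using \<rho>(1) unfolding pinj_standard by blast
    moreover have "g \<subseteq> graph std \<rho>" using graph_mono[OF \<rho>(2)] unfolding g_def .
    ultimately obtain t u where t: "t \<in> S" "PI n u" "t \<subseteq> u" "graph std \<rho> \<subseteq> u"
      using S3[OF _ _ graph_mono[OF \<rho>(3)] DI[where C = C1, OF \<rho>(1,3,4,5)]] by blast
    have "sub std (code (t - g)) (code u)"
      by (rule code_sub[OF gr(2)[OF t(1)] _ t(2)]) (use gr(1)[OF t(1)] t(3) in auto)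
    moreover have "sub std \<rho> (code u)" by (rule code_sub[OF \<rho>(1) t(4,2)])
    ultimately show "\<exists>\<tau>. \<tau> \<in> ext std s \<and> compat std n \<tau> \<rho>"
      using pinj_code[OF t(2)] t(1) unfolding s compat_def by blast
  qed
  then show ?thesis by blast
qed

text \<open>The entries are chosen in the standard model, where every finite set has a code. A
  choice made outside M need not be coded in M.\<close>

lemma array_exists:
  assumes "\<And>a b. a < l \<Longrightarrow> b < m \<Longrightarrow> \<exists>s. P a b s"
  shows "\<exists>A. (\<forall>z. z \<in> ext std A \<longrightarrow> (\<exists>a b s. a < l \<and> b < m \<and> z = pair std (pair std a b) s)) \<and>
    (\<forall>a b. a < l \<longrightarrow> b < m \<longrightarrow> (\<exists>s. pair std (pair std a b) s \<in> ext std A \<and> P a b s)) \<and>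
    (\<forall>a b s s'. pair std (pair std a b) s \<in> ext std A \<longrightarrow>
      pair std (pair std a b) s' \<in> ext std A \<longrightarrow> s = s')"
proof -
  obtain F where F: "\<And>a b. a < l \<Longrightarrow> b < m \<Longrightarrow> P a b (F a b)" using assms by metis
  define A where "A = (\<lambda>(a, b). pair std (pair std a b) (F a b)) ` ({..<l} \<times> {..<m})"
  have "finite A" unfolding A_def by simp
  then have "ext std (set_encode A) = A" by simp
  moreover have "pair std (pair std a b) s \<in> A \<longleftrightarrow> a < l \<and> b < m \<and> s = F a b" for a b s
    unfolding A_def by auto
  ultimately show ?thesis using F
    by (intro exI[of _ "set_encode A"]) (auto simp: A_def)
qed

section \<open>Transfer into a model of true arithmetic\<close>

locale arith_model =
  fixes M :: "'a interp"
  assumes Th: "models_Th_N M"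
begin

abbreviation two where "two \<equiv> plus M (one M) (one M)"

lemmas transfer_M = transfer_sentence[OF Th]

lemma pair_inj: "pair M a b = pair M c d \<longleftrightarrow> a = c \<and> b = d"
proof -
  have "\<forall>a b c d. pair M a b = pair M c d \<longleftrightarrow> a = c \<and> b = d"
    apply (rule transfer_M)
     apply (rule rep_intros pair_rep trep_intros)+
    by (simp del: One_nat_def)
  then show ?thesis by blast
qed

lemma has_card_fo: "has_card M s k \<longleftrightarrow> fo_card M s k"
  by (rule has_card_iff_fo_card) (rule pair_inj)

lemma card_le_rep:
  assumes "trep M f f'" "trep M g g'"
  shows "rep M (\<lambda>e. card_le M (f e) (g e)) (\<lambda>e. card_le std (f' e) (g' e))"
proof -
  have "has_card std s k \<longleftrightarrow> fo_card std s k" for s k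
    by (rule has_card_iff_fo_card) simp
  moreover have "rep M (\<lambda>e. \<exists>l. fo_card M (e 0) l \<and> leq M l (e (Suc 0)))
      (\<lambda>e. \<exists>l. fo_card std (e 0) l \<and> leq std l (e (Suc 0)))"
    apply (rule back_subst[of "rep M _"])
     apply (rule rep_intros fo_card_rep leq_rep trep_intros)+
    by simp
  ultimately have "rep M (\<lambda>e. card_le M (e 0) (e (Suc 0))) (\<lambda>e. card_le std (e 0) (e (Suc 0)))"
    unfolding card_le_def has_card_fo by simp
  from rep_subst2[OF this assms] show ?thesis .
qed

lemmas transfer_rules = rep_intros leq_rep pair_rep ext_rep sub_rep joins_rep pinj_rep compat_rep card_le_rep
  dec_rep trep_intros

text \<open>The construction of all entries and their collection into one code form a single
  first-order statement about M, so A is an element of M. The incompatibility of certificates is a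
  premise, to be discharged in M by generic filters. The parameters p enter as the assignment of the
  free variables.\<close>

lemma array_transfer:
  "\<forall>n m k \<sigma>. pinj M n \<sigma> \<longrightarrow>
    (\<forall>a b. less M a (times M two m) \<longrightarrow> less M b m \<longrightarrow> (\<forall>u c0 c1. pinj M n u \<longrightarrow> sub M \<sigma> u \<longrightarrow>
       sub M c0 u \<longrightarrow> sub M c1 u \<longrightarrow> card_le M c0 k \<longrightarrow> card_le M c1 k \<longrightarrow>
       dec M n (graph M c0) False (case_nat a (case_nat b p)) \<psi> \<longrightarrow>
       dec M n (graph M c1) True (case_nat a (case_nat b p)) \<phi> \<longrightarrow> False)) \<longrightarrow>
    (\<exists>A. (\<forall>z. z \<in> ext M A \<longrightarrow>
        (\<exists>a b s. less M a (times M two m) \<and> less M b m \<and> z = pair M (pair M a b) s)) \<and>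
      (\<forall>a b. less M a (times M two m) \<longrightarrow> less M b m \<longrightarrow> (\<exists>s. pair M (pair M a b) s \<in> ext M A \<and>
        good_entry M n k \<sigma> (\<lambda>c. dec M n (graph M c) False (case_nat a (case_nat b p)) \<psi>)
          (\<lambda>c. dec M n (graph M c) True (case_nat a (case_nat b p)) \<phi>) s)) \<and>
      (\<forall>a b s s'. pair M (pair M a b) s \<in> ext M A \<longrightarrow> pair M (pair M a b) s' \<in> ext M A \<longrightarrow> s = s'))"
  unfolding good_entry_def
  apply (rule transfer[OF Th, where e = p])
   apply (rule transfer_rules)+
  apply (simp only: nat.case)
  apply (fold good_entry_def)
  unfolding standard_simps
  apply (intro allI impI array_exists good_entry_exists; blast?)
  done
end

text \<open>\<open>x ^ c / exp x\<close> tends to 0, and x = l ln 2 turns \<open>exp x\<close> into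
  the l-th power of 2. The threshold \<open>ln 2 ^ c / 2\<close> cancels the factor so introduced
  and lowers the exponent to l - 1, because n is only known to be at least the power of 2 with
  exponent |n| - 1.\<close>

lemma eventually_power_le: "\<exists>l0. \<forall>l\<ge>l0. l ^ c \<le> 2 ^ (l - 1)" for c :: nat
proof -
  have "((\<lambda>x::real. x ^ c / exp x) \<longlongrightarrow> 0) at_top" by (rule tendsto_power_div_exp_0)
  moreover have "0 < ln 2 ^ c / (2::real)" by simp
  ultimately have "eventually (\<lambda>x::real. x ^ c / exp x < ln 2 ^ c / 2) at_top"
    by (rule order_tendstoD)
  then obtain x0 :: real where x0: "\<And>x. x \<ge> x0 \<Longrightarrow> x ^ c / exp x < ln 2 ^ c / 2"
    unfolding eventually_at_top_linorder by blast
  obtain l0 :: nat where l0: "x0 / ln 2 \<le> real l0" using real_arch_simple by blast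
  have "l ^ c \<le> 2 ^ (l - 1)" if l: "l \<ge> Suc l0" for l
  proof -
    have "x0 / ln 2 \<le> real l" using l0 l by simp
    then have "x0 \<le> real l * ln 2" by (simp add: field_simps)
    from x0[OF this] have "(real l * ln 2) ^ c / 2 ^ l < ln 2 ^ c / 2"
      by (simp add: exp_of_nat_mult)
    then have "real l ^ c * ln 2 ^ c < 2 ^ l / 2 * ln 2 ^ c" by (simp add: field_simps)
    then have "real l ^ c < 2 ^ l / 2" by (simp add: mult_less_cancel_right)
    also have "\<dots> = 2 ^ (l - 1)" using l by (cases l) simp_all
    finally have "real (l ^ c) < real (2 ^ (l - 1))" by simp
    then show ?thesis by linarith
  qed
  then show ?thesis by blast
qed

lemma eventually_len_pow_le: "\<exists>n0. \<forall>n\<ge>n0. len std n ^ c \<le> n"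
proof -
  obtain l0 :: nat where l0: "\<And>l. l \<ge> l0 \<Longrightarrow> l ^ c \<le> 2 ^ (l - 1)" using eventually_power_le by blast
  have "len std n ^ c \<le> n" if "n \<ge> 2 ^ l0" for n
  proof -
    have n: "n \<noteq> 0" using that by (metis not_one_le_zero one_le_numeral one_le_power le_trans)
    have "l0 < len std n" unfolding less_len_iff by (rule that)
    then have "len std n ^ c \<le> 2 ^ (len std n - 1)" by (intro l0) simp
    also have "\<dots> \<le> n" using less_len_iff[of "len std n - 1" n] n len_eq_0_iff[of n]
      by (metis diff_less gr0I zero_less_one)
    finally show ?thesis .
  qed
  then show ?thesis by blast
qed

lemma len_ge_2: "2 \<le> n \<Longrightarrow> 2 \<le> len std n"
  using less_len_iff[of 1 n] by simp

context arith_model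
begin

section \<open>Order, codes and polynomial bounds in M\<close>

lemma less_irrefl [rule_format]:
  "\<forall>x. \<not> less M x x"
  apply (rule transfer_M)
   apply (rule transfer_rules)+
  by simp

lemma less_trans [rule_format]:
  "\<forall>x y z. less M x y \<longrightarrow> less M y z \<longrightarrow> less M x z"
  apply (rule transfer_M)
   apply (rule transfer_rules)+
  by simp

lemma less_linear [rule_format]:
  "\<forall>x y. less M x y \<or> x = y \<or> less M y x"
  apply (rule transfer_M)
   apply (rule transfer_rules)+
  by (simp add: linorder_neq_iff[symmetric] linorder_less_linear)

lemma leq_refl: "leq M x x"
  by (simp add: leq_def)

lemma leq_trans: "leq M x y \<Longrightarrow> leq M y z \<Longrightarrow> leq M x z"
  unfolding leq_def using less_trans by blast

lemma not_less: "\<not> less M x y \<longleftrightarrow> leq M y x"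
  unfolding leq_def using less_linear less_irrefl less_trans by blast

lemma len_mono_M [rule_format]:
  "\<forall>x y. leq M x y \<longrightarrow> leq M (len M x) (len M y)"
  apply (rule transfer_M)
   apply (rule transfer_rules)+
  by (simp add: len_mono)

lemma half_le [rule_format]:
  "\<forall>x. leq M (half M x) x"
  apply (rule transfer_M)
   apply (rule transfer_rules)+
  by simp

lemma ex_len [rule_format]:
  "\<forall>l. \<exists>z. len M z = l"
  apply (rule transfer_M)
   apply (rule transfer_rules)+
  apply simp
  using len_pow2_diff_1 by blast

lemma less_smash_iff [rule_format]:
  "\<forall>y z. less M y (smash M z (one M)) \<longleftrightarrow> leq M (len M y) (len M z)"
  apply (rule transfer_M)
   apply (rule transfer_rules)+
  by (simp add: len_le_iff)

lemma ex_joins [rule_format]: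
  "\<forall>s t. \<exists>u. joins M u s t"
proof -
  have *: "\<exists>u. joins std u s t" for s t
    by (rule exI[of _ "set_encode (ext std s \<union> ext std t)"]) (simp add: joins_standard)
  show ?thesis
    apply (rule transfer_M)
     apply (rule transfer_rules)+
    by (simp add: *)
qed

lemma card_le_joins [rule_format]:
  "\<forall>u s t k l. joins M u s t \<longrightarrow> card_le M s k \<longrightarrow> card_le M t l \<longrightarrow> card_le M u (plus M k l)"
proof -
  have *: "card_le std u (k + l)"
    if "joins std u s t" "card_le std s k" "card_le std t l" for u s t k l
    using that card_Un_le[of "ext std s" "ext std t"]
    unfolding joins_standard card_le_standard by simp
  show ?thesis
    apply (rule transfer_M)
     apply (rule transfer_rules)+
    by (simp add: *)
qed

lemma card_le_sub [rule_format]: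
  "\<forall>s t k. sub M s t \<longrightarrow> card_le M t k \<longrightarrow> card_le M s k"
proof -
  have *: "card_le std s k" if "sub std s t" "card_le std t k" for s t k
    using that card_mono[OF finite_ext_standard, of "ext std s" t]
    unfolding sub_standard card_le_standard by linarith
  show ?thesis
    apply (rule transfer_M)
     apply (rule transfer_rules)+
    by (simp add: *)
qed

lemma card_le_mono: "card_le M s k \<Longrightarrow> leq M k l \<Longrightarrow> card_le M s l"
  unfolding card_le_def using leq_trans by blast

lemma compat3:
  "compat M n a b \<Longrightarrow> compat M n a c \<Longrightarrow> compat M n b c \<Longrightarrow>
   \<exists>u. pinj M n u \<and> sub M a u \<and> sub M b u \<and> sub M c u"
proof -
  have *: "\<exists>u. pinj std n u \<and> sub std a u \<and> sub std b u \<and> sub std c u"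
    if abc: "compat std n a b" "compat std n a c" "compat std n b c" for n a b c
  proof -
    have pi: "pinj std n a" "pinj std n b" "pinj std n c"
      using abc(1,3) unfolding compat_def by (metis pinj_sub)+
    have un: "PI n (graph std a \<union> graph std b)" if ab: "compat std n a b" for a b
    proof -
      obtain u where u: "pinj std n u" "sub std a u" "sub std b u"
        using ab unfolding compat_def by blast
      then have "PI n (graph std u)" unfolding pinj_standard by blast
      then show ?thesis by (rule PI_subset) (use graph_mono u in blast)
    qed
    define u where "u = graph std a \<union> graph std b \<union> graph std c"
    have u: "PI n u" unfolding u_def by (rule PI_Un3[OF un[OF abc(1)] un[OF abc(2)] un[OF abc(3)]])
    have "sub std x (code u)" if "pinj std n x" "graph std x \<subseteq> u" for x
      unfolding sub_iff_graph[OF that(1)] graph_code[OF PI_finite[OF u]] by (rule that(2))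
    from this[OF pi(1)] this[OF pi(2)] this[OF pi(3)] pinj_code[OF u] show ?thesis
      unfolding u_def by blast
  qed
  have "\<forall>n a b c. compat M n a b \<longrightarrow> compat M n a c \<longrightarrow> compat M n b c \<longrightarrow>
      (\<exists>u. pinj M n u \<and> sub M a u \<and> sub M b u \<and> sub M c u)"
    apply (rule transfer_M)
     apply (rule transfer_rules)+
    by (simp add: *)
  then show "compat M n a b \<Longrightarrow> compat M n a c \<Longrightarrow> compat M n b c \<Longrightarrow>
     \<exists>u. pinj M n u \<and> sub M a u \<and> sub M b u \<and> sub M c u" by blast
qed

lemma len_pow_add:
  "leq M two n \<Longrightarrow> leq M x (len_pow M n a) \<Longrightarrow> leq M y (len_pow M n b) \<Longrightarrow>
   leq M (plus M x y) (len_pow M n (a + b + 1))"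
proof -
  have *: "x + y \<le> len std n ^ (a + b + 1)"
    if "2 \<le> n" "x \<le> len std n ^ a" "y \<le> len std n ^ b" for n x y
    using power_sum_le[OF len_ge_2[OF that(1)], of a b] that by linarith
  have "\<forall>n x y. leq M two n \<longrightarrow> leq M x (len_pow M n a) \<longrightarrow> leq M y (len_pow M n b) \<longrightarrow>
     leq M (plus M x y) (len_pow M n (a + b + 1))"
    apply (rule transfer_M)
     apply (rule transfer_rules)+
    using * by simp
  then show "leq M two n \<Longrightarrow> leq M x (len_pow M n a) \<Longrightarrow> leq M y (len_pow M n b) \<Longrightarrow>
   leq M (plus M x y) (len_pow M n (a + b + 1))" by blast
qed

lemma len_pow_mult:
  "leq M x (len_pow M n a) \<Longrightarrow> leq M y (len_pow M n b) \<Longrightarrow> leq M (times M x y) (len_pow M n (a + b))"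
proof -
  have "\<forall>n x y. leq M x (len_pow M n a) \<longrightarrow> leq M y (len_pow M n b) \<longrightarrow>
     leq M (times M x y) (len_pow M n (a + b))"
    apply (rule transfer_M)
     apply (rule transfer_rules)+
    by (simp add: power_add mult_le_mono)
  then show "leq M x (len_pow M n a) \<Longrightarrow> leq M y (len_pow M n b) \<Longrightarrow>
    leq M (times M x y) (len_pow M n (a + b))" by blast
qed

lemma len_pow_mono: "leq M two n \<Longrightarrow> a \<le> b \<Longrightarrow> leq M (len_pow M n a) (len_pow M n b)"
proof -
  assume ab: "a \<le> b"
  have *: "len std n ^ a \<le> len std n ^ b" if "2 \<le> n" for n
    using len_ge_2[OF that] ab by (intro power_increasing) simp_all
  have "\<forall>n. leq M two n \<longrightarrow> leq M (len_pow M n a) (len_pow M n b)"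
    apply (rule transfer_M)
     apply (rule transfer_rules)+
    using * by simp
  then show "leq M two n \<Longrightarrow> leq M (len_pow M n a) (len_pow M n b)" by blast
qed

lemma len_plus [rule_format]:
  "\<forall>x y. leq M (len M (plus M x y)) (plus M (plus M (len M x) (len M y)) (one M))"
proof -
  have *: "len std (x + y) \<le> len std x + len std y + 1" for x y
  proof (cases "x = 0 \<or> y = 0")
    case True
    then show ?thesis by auto
  next
    case False
    then have "1 \<le> len std x" "1 \<le> len std y"
      using len_eq_0_iff by (metis One_nat_def Suc_leI gr_zeroI)+
    then show ?thesis using len_add_le[OF _ _ le_refl le_refl, of x y] by simp
  qed
  show ?thesis
    apply (rule transfer_M)
     apply (rule transfer_rules)+
    using * by simp
qed

lemma len_times [rule_format]:
  "\<forall>x y. leq M (len M (times M x y)) (plus M (len M x) (len M y))"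
  apply (rule transfer_M)
   apply (rule transfer_rules)+
  by (simp add: len_mult_le)

lemma len_smash [rule_format]:
  "\<forall>x y. leq M (len M (smash M x y)) (plus M (times M (len M x) (len M y)) (one M))"
  apply (rule transfer_M)
   apply (rule transfer_rules)+
  by simp

lemma len_le [rule_format]:
  "\<forall>x. leq M (len M x) x"
  apply (rule transfer_M)
   apply (rule transfer_rules)+
  by (simp add: len_le_self)

lemma zero_one: "leq M (len M (zero M)) (one M)" "leq M (len M (one M)) (one M)" "leq M (zero M) (one M)"
proof -
  have "leq M (len M (zero M)) (one M) \<and> leq M (len M (one M)) (one M) \<and> leq M (zero M) (one M)"
    apply (rule transfer_M)
     apply (rule transfer_rules)+
    by simp
  then show "leq M (len M (zero M)) (one M)" "leq M (len M (one M)) (one M)" "leq M (zero M) (one M)" by blast+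
qed

text \<open>M is an end extension of the standard numbers; hence a nonstandard element exceeds every
  numeral.\<close>

lemma less_numeral: "less M x (numeral_of M k) \<Longrightarrow> \<exists>j<k. x = numeral_of M j"
proof (induction k)
  case 0
  have "\<forall>x. \<not> less M x (numeral_of M 0)"
    apply (rule transfer_M)
     apply (rule transfer_rules)+
    by simp
  with 0 show ?case by blast
next
  case (Suc k)
  have "\<forall>x. less M x (numeral_of M (Suc k)) \<longrightarrow> less M x (numeral_of M k) \<or> x = numeral_of M k"
    apply (rule transfer_M)
     apply (rule transfer_rules)+
    by auto
  with Suc show ?case using less_SucI by blast
qed

lemma decide_transfer:
  assumes "\<phi> \<in> sharply_bounded"
  shows "\<exists>c. \<forall>n \<sigma> s. leq M two n \<longrightarrow> (\<forall>v\<in>fvars \<phi>. leq M (len M (e v)) (len_pow M n c0)) \<longrightarrow>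
    pinj M n \<sigma> \<longrightarrow> card_le M \<sigma> s \<longrightarrow> leq M (plus M s (len_pow M n c)) n \<longrightarrow>
    (\<exists>\<rho>. sub M \<sigma> \<rho> \<and> pinj M n \<rho> \<and> card_le M \<rho> (plus M s (len_pow M n c)) \<and>
      (dec M n (graph M \<rho>) True e \<phi> \<or> dec M n (graph M \<rho>) False e \<phi>))"
proof -
  obtain c where c: "decides \<phi> c"
    using decide[OF assms] by blast
  note c = c[unfolded decides_def, rule_format]
  \<comment> \<open>The parameters have length at most |n| to the power c0. As l serves this number
    raised by one further factor |n|, so that l is at least 2 even for c0 = 0; then
    \<open>l ^ c\<close> is |n| to the power d.\<close>
  define d where "d = (c0 + 1) * c"
  have std: "\<exists>\<rho>. sub std \<sigma> \<rho> \<and> pinj std n \<rho> \<and> card_le std \<rho> (s + len std n ^ d) \<and>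
      (dec std n (graph std \<rho>) True e \<phi> \<or> dec std n (graph std \<rho>) False e \<phi>)"
    if n: "2 \<le> n" and e: "\<forall>v\<in>fvars \<phi>. len std (e v) \<le> len std n ^ c0"
      and \<sigma>: "pinj std n \<sigma>" and s: "card_le std \<sigma> s" and sn: "s + len std n ^ d \<le> n"
    for n \<sigma> s e
  proof -
    let ?l = "len std n ^ (c0 + 1)"
    have l2: "2 \<le> len std n" by (rule len_ge_2[OF n])
    have "len std n \<le> ?l" using l2 by (intro self_le_power) simp_all
    then have l: "2 \<le> ?l" using l2 by linarith
    have "len std n ^ c0 \<le> ?l" using l2 by (intro power_increasing) simp_all
    then have "env_le \<phi> ?l e" using e le_trans unfolding env_le_def by blast
    moreover have g: "PI n (graph std \<sigma>)" using \<sigma> unfolding pinj_standard by blast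
    moreover have ld: "?l ^ c = len std n ^ d" unfolding d_def power_mult ..
    moreover have card: "card (graph std \<sigma>) \<le> s"
      using s card_graph[OF \<sigma>] unfolding card_le_standard by simp
    ultimately obtain q where q: "graph std \<sigma> \<subseteq> q" "PI n q" "card q \<le> card (graph std \<sigma>) + ?l ^ c"
      "dec std n q True e \<phi> \<or> dec std n q False e \<phi>"
      using c[OF l, of e n "graph std \<sigma>"] sn by auto
    have "card_le std (code q) (s + len std n ^ d)"
      using q(3) card unfolding card_le_standard card_ext_code[OF PI_finite[OF q(2)]] ld by linarith
    moreover have "sub std \<sigma> (code q)"
      unfolding sub_iff_graph[OF \<sigma>] graph_code[OF PI_finite[OF q(2)]] by (rule q(1))
    ultimately show ?thesis
      using q(4) pinj_code[OF q(2)] by (intro exI[of _ "code q"]) (simp add: graph_code[OF PI_finite[OF q(2)]])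
  qed
  show ?thesis
    apply (rule exI[of _ d])
    apply (rule transfer[OF Th, where e = e])
     apply (rule transfer_rules rep_ball_finite[OF finite_fvars])+
    apply (simp only: nat.case)
    unfolding standard_simps len_pow_standard
    apply (intro allI impI std; (assumption | simp))
    done
qed

text \<open>The exponent is chosen before e, so one bound covers all assignments with values of the
  given length.\<close>

lemma shrink_transfer:
  assumes "\<exists>c. shrinks \<phi> b c"
  shows "\<exists>c. \<forall>e n \<sigma>. leq M two n \<longrightarrow> (\<forall>v\<in>fvars \<phi>. leq M (len M (e v)) (len_pow M n c0)) \<longrightarrow>
    pinj M n \<sigma> \<longrightarrow> dec M n (graph M \<sigma>) b e \<phi> \<longrightarrow>
    (\<exists>\<tau>. sub M \<tau> \<sigma> \<and> pinj M n \<tau> \<and> card_le M \<tau> (len_pow M n c) \<and> dec M n (graph M \<tau>) b e \<phi>)"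
proof -
  obtain c where c: "shrinks \<phi> b c"
    using assms by blast
  note c = c[unfolded shrinks_def, rule_format]
  define d where "d = (c0 + 1) * c"
  have std: "\<exists>\<tau>. sub std \<tau> \<sigma> \<and> pinj std n \<tau> \<and> card_le std \<tau> (len std n ^ d) \<and>
      dec std n (graph std \<tau>) b e \<phi>"
    if n: "2 \<le> n" and e: "\<forall>v\<in>fvars \<phi>. len std (e v) \<le> len std n ^ c0"
      and \<sigma>: "pinj std n \<sigma>" and dec: "dec std n (graph std \<sigma>) b e \<phi>"
    for n \<sigma> e
  proof -
    let ?l = "len std n ^ (c0 + 1)"
    have l2: "2 \<le> len std n" by (rule len_ge_2[OF n])
    have "len std n \<le> ?l" using l2 by (intro self_le_power) simp_all
    then have l: "2 \<le> ?l" using l2 by linarith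
    have "len std n ^ c0 \<le> ?l" using l2 by (intro power_increasing) simp_all
    then have "env_le \<phi> ?l e" using e le_trans unfolding env_le_def by blast
    then obtain q where q: "q \<subseteq> graph std \<sigma>" "card q \<le> ?l ^ c" "dec std n q b e \<phi>"
      using c[OF l _ dec] by blast
    have g: "PI n (graph std \<sigma>)" using \<sigma> unfolding pinj_standard by blast
    have PIq: "PI n q" by (rule PI_subset[OF g q(1)])
    note fin = PI_finite[OF PIq]
    have ld: "?l ^ c = len std n ^ d" unfolding d_def power_mult ..
    have "card_le std (code q) (len std n ^ d)"
      using q(2) unfolding card_le_standard card_ext_code[OF fin] ld .
    moreover have "sub std (code q) \<sigma>"
      unfolding sub_iff_graph[OF pinj_code[OF PIq]] graph_code[OF fin] by (rule q(1))
    ultimately show ?thesis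
      using q(3) pinj_code[OF PIq] by (intro exI[of _ "code q"]) (simp add: graph_code[OF fin])
  qed
  have "\<forall>n \<sigma>. leq M two n \<longrightarrow> (\<forall>v\<in>fvars \<phi>. leq M (len M (e v)) (len_pow M n c0)) \<longrightarrow>
    pinj M n \<sigma> \<longrightarrow> dec M n (graph M \<sigma>) b e \<phi> \<longrightarrow>
    (\<exists>\<tau>. sub M \<tau> \<sigma> \<and> pinj M n \<tau> \<and> card_le M \<tau> (len_pow M n d) \<and> dec M n (graph M \<tau>) b e \<phi>)" for e
    apply (rule transfer[OF Th, where e = e])
     apply (rule transfer_rules rep_ball_finite[OF finite_fvars])+
    apply (simp only: nat.case)
    unfolding standard_simps len_pow_standard
    apply (intro allI impI std; (assumption | simp))
    done
  then show ?thesis by blast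
qed

text \<open>The number of steps is the length of z, which may be nonstandard, so the chain cannot be
  built by an external induction. The sizes s, k and l are arbitrary elements of M, which keeps the
  statement first-order.\<close>

lemma pind_transfer:
  "\<forall>n \<sigma> s k z. pinj M n \<sigma> \<longrightarrow> card_le M \<sigma> s \<longrightarrow> dec M n (graph M \<sigma>) True (case_nat (zero M) e) \<phi> \<longrightarrow>
    (\<exists>\<rho> l. sub M \<sigma> \<rho> \<and> pinj M n \<rho> \<and> card_le M \<rho> l \<and> leq M l (plus M s (times M (len M z) k)) \<and>
      (dec M n (graph M \<rho>) True (case_nat z e) \<phi> \<or>
       (\<exists>x. leq M x z \<and> dec M n (graph M \<rho>) True (case_nat (half M x) e) \<phi> \<and>
         \<not> (\<exists>\<pi>. sub M \<rho> \<pi> \<and> pinj M n \<pi> \<and> card_le M \<pi> (plus M l k) \<and>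
              dec M n (graph M \<pi>) True (case_nat x e) \<phi>))))"
proof -
  have std: "\<exists>\<rho> l. sub std \<sigma> \<rho> \<and> pinj std n \<rho> \<and> card_le std \<rho> l \<and> l \<le> s + len std z * k \<and>
      (dec std n (graph std \<rho>) True (case_nat z e) \<phi> \<or>
       (\<exists>x. x \<le> z \<and> dec std n (graph std \<rho>) True (case_nat (x div 2) e) \<phi> \<and>
         \<not> (\<exists>\<pi>. sub std \<rho> \<pi> \<and> pinj std n \<pi> \<and> card_le std \<pi> (l + k) \<and>
              dec std n (graph std \<pi>) True (case_nat x e) \<phi>)))"
    if \<sigma>: "pinj std n \<sigma>" and s: "card_le std \<sigma> s"
      and 0: "dec std n (graph std \<sigma>) True (case_nat 0 e) \<phi>"
    for n \<sigma> s k z e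
  proof -
    define Q where "Q x r = dec std n r True (case_nat x e) \<phi>" for x r
    have g: "PI n (graph std \<sigma>)" using \<sigma> unfolding pinj_standard by blast
    obtain q where q: "graph std \<sigma> \<subseteq> q" "PI n q" "card q \<le> card (graph std \<sigma>) + len std z * k"
      "Q z q \<or> (\<exists>x\<le>z. Q (x div 2) q \<and> \<not> (\<exists>p. q \<subseteq> p \<and> PI n p \<and> card p \<le> card q + k \<and> Q x p))"
      using pind_chain[of n "graph std \<sigma>" Q z k] g 0 unfolding Q_def by blast
    note fin = PI_finite[OF q(2)]
    note gq = graph_code[OF fin]
    have "sub std \<sigma> (code q)" unfolding sub_iff_graph[OF \<sigma>] gq by (rule q(1))
    moreover have "card q \<le> s + len std z * k"
      using q(3) s card_graph[OF \<sigma>] unfolding card_le_standard by simp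
    moreover have "card_le std (code q) (card q)" unfolding card_le_standard card_ext_code[OF fin] ..
    moreover have "Q z q \<or> (\<exists>x. x \<le> z \<and> Q (x div 2) q \<and>
        \<not> (\<exists>\<pi>. sub std (code q) \<pi> \<and> pinj std n \<pi> \<and> card_le std \<pi> (card q + k) \<and>
              Q x (graph std \<pi>)))"
      using q(4)
    proof (elim disjE exE conjE)
      fix x assume x: "x \<le> z" "Q (x div 2) q" "\<not> (\<exists>p. q \<subseteq> p \<and> PI n p \<and> card p \<le> card q + k \<and> Q x p)"
      have False if \<pi>: "sub std (code q) \<pi>" "pinj std n \<pi>" "card_le std \<pi> (card q + k)"
        "Q x (graph std \<pi>)" for \<pi>
      proof -
        have "q \<subseteq> graph std \<pi>" using graph_mono[OF \<pi>(1)] unfolding gq .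
        moreover have "PI n (graph std \<pi>)" using \<pi>(2) unfolding pinj_standard by blast
        moreover have "card (graph std \<pi>) \<le> card q + k"
          using \<pi>(3) card_graph[OF \<pi>(2)] unfolding card_le_standard by simp
        ultimately show False using x(3) \<pi>(4) by blast
      qed
      then show ?thesis using x(1,2) by blast
    qed blast
    ultimately show ?thesis using pinj_code[OF q(2)]
      by (intro exI[of _ "code q"] exI[of _ "card q"]) (simp add: gq Q_def)
  qed
  show ?thesis
    apply (rule transfer[OF Th, where e = e])
     apply (rule transfer_rules)+
    apply (simp only: nat.case)
    unfolding standard_simps
    apply (intro allI impI std; assumption)
    done
qed
end

section \<open>Generic filters\<close>

instance trm :: countable by countable_datatype
instance fm :: countable by countable_datatype

section \<open>Small numbers, the cut and the conditions\<close>

locale forcing_setting = arith_model M for M :: "'a interp" +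
  fixes n :: 'a
  assumes nonst: "nonstandard M n"
begin

abbreviation C where "C \<equiv> conditions M n"

abbreviation cert where "cert \<tau> \<equiv> dec M n (graph M \<tau>)"

abbreviation RG :: "'a set \<Rightarrow> ('a \<times> 'a) set" where "RG G \<equiv> \<Union>\<tau>\<in>G. graph M \<tau>"

text \<open>The exponent c is standard, so this is a cut of M and not a coded set. Closure under sum
  and product lets sizes be handled below without naming exponents.\<close>

definition small :: "'a \<Rightarrow> bool"
  where "small k \<longleftrightarrow> (\<exists>c. leq M k (len_pow M n c))"

lemma numeral_le_n: "leq M (numeral_of M k) n"
  using less_numeral[of n k] nonst not_less unfolding nonstandard_def by blast

lemma two_le_n: "leq M two n"
proof -
  have "numeral_of M 2 = two"
    apply (rule transfer_M)
     apply (rule transfer_rules)+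
    by simp
  then show ?thesis using numeral_le_n[of 2] by simp
qed

text \<open>For fixed c the inequality holds from some standard n0 on, and the nonstandard n lies
  above n0.\<close>

lemma len_pow_le_n: "leq M (len_pow M n c) n"
proof -
  obtain n0 where n0: "\<And>n. n \<ge> n0 \<Longrightarrow> len std n ^ c \<le> n" using eventually_len_pow_le[of c] by blast
  have "\<forall>n. leq M (numeral_of M n0) n \<longrightarrow> leq M (len_pow M n c) n"
    apply (rule transfer_M)
     apply (rule transfer_rules)+
    by (simp add: n0)
  then show ?thesis using numeral_le_n by blast
qed

lemma small_le_n: "small k \<Longrightarrow> leq M k n"
  unfolding small_def using len_pow_le_n leq_trans by blast

lemma small_mono: "leq M k l \<Longrightarrow> small l \<Longrightarrow> small k"
  unfolding small_def using leq_trans by blast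

lemma small_plus: "small k \<Longrightarrow> small l \<Longrightarrow> small (plus M k l)"
  unfolding small_def using len_pow_add[OF two_le_n] by blast

lemma small_times: "small k \<Longrightarrow> small l \<Longrightarrow> small (times M k l)"
  unfolding small_def using len_pow_mult by blast

lemma small_len_pow: "small (len_pow M n c)"
  unfolding small_def using leq_refl by blast

lemma small_one: "small (one M)"
  using small_len_pow[of 0] by (simp add: len_pow_def)

lemma cut_iff: "y \<in> cut M n \<longleftrightarrow> small (len M y)"
proof
  assume "y \<in> cut M n"
  then show "small (len M y)" unfolding cut_def small_def less_smash_iff by auto
next
  assume "small (len M y)"
  then obtain c where c: "leq M (len M y) (len_pow M n c)" unfolding small_def by blast
  obtain z where z: "len M z = len_pow M n c" using ex_len by blast
  from c z show "y \<in> cut M n" unfolding cut_def less_smash_iff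
    by (intro CollectI exI[of _ c] exI[of _ z]) simp
qed

lemma cut_mono: "leq M x y \<Longrightarrow> y \<in> cut M n \<Longrightarrow> x \<in> cut M n"
  unfolding cut_iff using small_mono[OF len_mono_M] .

lemma cut_less: "less M x y \<Longrightarrow> y \<in> cut M n \<Longrightarrow> x \<in> cut M n"
  by (rule cut_mono) (auto simp: leq_def)

text \<open>I is a substructure: the length of a sum, product or smash is bounded by sums and
  products of lengths and 1, which stay small.\<close>

lemma val_cut: "(\<And>v. v \<in> tvars t \<Longrightarrow> e v \<in> cut M n) \<Longrightarrow> val M e t \<in> cut M n"
proof (induction t)
  case Zero
  show ?case using small_mono[OF zero_one(1) small_one] by (simp add: cut_iff)
next
  case One
  show ?case using small_mono[OF zero_one(2) small_one] by (simp add: cut_iff)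
next
  case (Half t)
  then show ?case using cut_mono[OF half_le] by simp
next
  case (Len t)
  then show ?case using cut_mono[OF len_le] by simp
next
  case (Plus s t)
  then have "small (len M (val M e s))" "small (len M (val M e t))" unfolding cut_iff by simp_all
  then show ?case using small_mono[OF len_plus] small_plus small_one unfolding cut_iff by simp
next
  case (Times s t)
  then have "small (len M (val M e s))" "small (len M (val M e t))" unfolding cut_iff by simp_all
  then show ?case using small_mono[OF len_times] small_plus unfolding cut_iff by simp
next
  case (Smash s t)
  then have "small (len M (val M e s))" "small (len M (val M e t))" unfolding cut_iff by simp_all
  then show ?case using small_mono[OF len_smash] small_plus small_times small_one unfolding cut_iff by simp
qed simp

lemma conditions_iff: "\<sigma> \<in> C \<longleftrightarrow> pinj M n \<sigma> \<and> (\<exists>k. small k \<and> card_le M \<sigma> k)"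
proof -
  have "ext M \<sigma> \<subseteq> (\<lambda>(a, b). pair M a b) ` (seg M (plus M n (one M)) \<times> seg M n) \<longleftrightarrow>
    (\<forall>z. z \<in> ext M \<sigma> \<longrightarrow> (\<exists>a b. less M a (plus M n (one M)) \<and> less M b n \<and> z = pair M a b))"
    unfolding seg_def by fastforce
  moreover have "(\<exists>c k. has_card M \<sigma> k \<and> leq M k (len_pow M n c)) \<longleftrightarrow> (\<exists>k. small k \<and> card_le M \<sigma> k)"
    unfolding small_def card_le_def using leq_trans leq_refl by meson
  moreover have "single_valued (graph M \<sigma>) \<longleftrightarrow>
     (\<forall>a b c. pair M a b \<in> ext M \<sigma> \<longrightarrow> pair M a c \<in> ext M \<sigma> \<longrightarrow> b = c)"
    unfolding single_valued_def graph_def by simp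
  moreover have "single_valued ((graph M \<sigma>)\<inverse>) \<longleftrightarrow>
     (\<forall>a b c. pair M a c \<in> ext M \<sigma> \<longrightarrow> pair M b c \<in> ext M \<sigma> \<longrightarrow> a = b)"
    unfolding single_valued_def graph_def by auto
  ultimately show ?thesis unfolding conditions_def pinj_def mem_Collect_eq by argo
qed

lemma condition_sub: "\<sigma> \<in> C \<Longrightarrow> sub M \<tau> \<sigma> \<Longrightarrow> \<tau> \<in> C"
  unfolding conditions_iff using pinj_sub card_le_sub by metis

lemma sub_refl: "sub M s s"
  by (simp add: sub_def)

lemma sub_trans: "sub M s t \<Longrightarrow> sub M t u \<Longrightarrow> sub M s u"
  by (simp add: sub_def)

lemma extends_iff: "extends M \<tau> \<sigma> \<longleftrightarrow> sub M \<sigma> \<tau>"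
  unfolding extends_def sub_def by blast

lemma joins_sub: "joins M u s t \<Longrightarrow> sub M s u" "joins M u s t \<Longrightarrow> sub M t u"
  unfolding joins_def sub_def by blast+

lemma joins_least: "joins M u s t \<Longrightarrow> sub M s v \<Longrightarrow> sub M t v \<Longrightarrow> sub M u v"
  unfolding joins_def sub_def by blast

lemma condition_joins: "\<sigma> \<in> C \<Longrightarrow> \<tau> \<in> C \<Longrightarrow> pinj M n u \<Longrightarrow> joins M u \<sigma> \<tau> \<Longrightarrow> u \<in> C"
  unfolding conditions_iff using card_le_joins small_plus by blast

lemma compat_joins:
  assumes "\<sigma> \<in> C" "\<tau> \<in> C" "compat M n \<sigma> \<tau>"
  obtains u where "u \<in> C" "joins M u \<sigma> \<tau>"
proof -
  obtain v where v: "pinj M n v" "sub M \<sigma> v" "sub M \<tau> v" using assms(3) unfolding compat_def by blast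
  obtain u where u: "joins M u \<sigma> \<tau>" using ex_joins by blast
  have "pinj M n u" by (rule pinj_sub[OF v(1) joins_least[OF u v(2,3)]])
  from that[OF condition_joins[OF assms(1,2) this u] u] show thesis .
qed

text \<open>Any common extension contains the union, which is therefore a partial injection; its
  size is small as a sum of two small numbers.\<close>

lemma compatible_iff:
  assumes "\<sigma> \<in> C" "\<tau> \<in> C"
  shows "compatible M n \<sigma> \<tau> \<longleftrightarrow> compat M n \<sigma> \<tau>"
proof
  assume "compatible M n \<sigma> \<tau>"
  then obtain \<rho> where "\<rho> \<in> C" "ext M \<rho> = ext M \<sigma> \<union> ext M \<tau>" unfolding compatible_def by blast
  then show "compat M n \<sigma> \<tau>" unfolding compat_def conditions_iff sub_def by blast
next
  assume "compat M n \<sigma> \<tau>"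
  then obtain u where "u \<in> C" "joins M u \<sigma> \<tau>" using compat_joins[OF assms] by blast
  moreover from this(2) have "ext M u = ext M \<sigma> \<union> ext M \<tau>" unfolding joins_def by blast
  ultimately show "compatible M n \<sigma> \<tau>" unfolding compatible_def by blast
qed

lemma compat_conditions:
  assumes "\<sigma> \<in> C" "\<tau> \<in> C" "compat M n \<sigma> \<tau>"
  obtains u where "u \<in> C" "sub M \<sigma> u" "sub M \<tau> u"
  using compat_joins[OF assms] joins_sub by metis

lemma filter_condition: "filter_of M n G \<Longrightarrow> \<tau> \<in> G \<Longrightarrow> \<tau> \<in> C"
  unfolding filter_of_def by blast

lemma filter_up: "filter_of M n G \<Longrightarrow> \<tau> \<in> G \<Longrightarrow> sub M \<sigma> \<tau> \<Longrightarrow> \<sigma> \<in> G"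
  using condition_sub unfolding filter_of_def extends_iff by blast

lemma filter_directed:
  assumes "filter_of M n G" "\<sigma> \<in> G" "\<tau> \<in> G"
  obtains u where "u \<in> C" "sub M \<sigma> u" "sub M \<tau> u"
proof -
  have "compat M n \<sigma> \<tau>"
    using assms compatible_iff filter_condition unfolding filter_of_def by blast
  then show thesis using compat_conditions[OF filter_condition[OF assms(1,2)] filter_condition[OF assms(1,3)]] that
    by blast
qed

lemma generic_filter: "generic M n G \<Longrightarrow> filter_of M n G"
  unfolding generic_def by blast

section \<open>Definability over the set of conditions, and existence of generic filters\<close>

definition dfn :: "((nat \<Rightarrow> 'a) \<Rightarrow> bool) \<Rightarrow> bool"
  where "dfn P \<longleftrightarrow> (\<exists>\<phi>. \<forall>e. P e = sat M UNIV (Id_on C) e \<phi>)"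

lemma dfn_rep: "rep M P Q \<Longrightarrow> dfn P"
  unfolding rep_def dfn_def using sat_R_free by metis

lemma dfn_condition: "dfn (\<lambda>e. e i \<in> C)"
  unfolding dfn_def by (rule exI[of _ "Rel (Var i) (Var i)"]) auto

lemma dfn_imp: "dfn P \<Longrightarrow> dfn Q \<Longrightarrow> dfn (\<lambda>e. P e \<longrightarrow> Q e)"
  unfolding dfn_def by (metis sat.simps(5))

lemma dfn_not: "dfn P \<Longrightarrow> dfn (\<lambda>e. \<not> P e)"
  unfolding dfn_def by (metis sat_Neg)

lemma dfn_disj: "dfn P \<Longrightarrow> dfn Q \<Longrightarrow> dfn (\<lambda>e. P e \<or> Q e)"
  unfolding dfn_def by (metis sat_Disj)

lemma dfn_conj: "dfn P \<Longrightarrow> dfn Q \<Longrightarrow> dfn (\<lambda>e. P e \<and> Q e)"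
  unfolding dfn_def by (metis sat_Conj)

lemma dfn_all:
  assumes "dfn (\<lambda>e. P (e 0) (\<lambda>i. e (Suc i)))"
  shows "dfn (\<lambda>e. \<forall>x. P x e)"
proof -
  obtain \<phi> where \<phi>: "\<And>e. P (e 0) (\<lambda>i. e (Suc i)) = sat M UNIV (Id_on C) e \<phi>"
    using assms unfolding dfn_def by blast
  have "P x e = sat M UNIV (Id_on C) (case_nat x e) \<phi>" for x e
    using \<phi>[of "case_nat x e"] by simp
  then show ?thesis unfolding dfn_def by (intro exI[of _ "Forall \<phi>"]) simp
qed

lemma dfn_ex: "dfn (\<lambda>e. P (e 0) (\<lambda>i. e (Suc i))) \<Longrightarrow> dfn (\<lambda>e. \<exists>x. P x e)"
  using dfn_not[OF dfn_all[of "\<lambda>x e. \<not> P x e", OF dfn_not]] by simp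

lemma dfn_rename:
  assumes "dfn P"
  shows "dfn (\<lambda>e. P (\<lambda>i. e (h i)))"
proof -
  obtain \<phi> where \<phi>: "\<And>e. P e = sat M UNIV (Id_on C) e \<phi>" using assms unfolding dfn_def by blast
  show ?thesis unfolding dfn_def
    by (rule exI[of _ "fsubst (\<lambda>i. Var (h i)) \<phi>"]) (simp add: \<phi> sat_fsubst)
qed

text \<open>This weak form of the truth lemma makes the definability of forcing unnecessary.\<close>

lemma dichotomy:
  assumes Q: "dfn (\<lambda>e. Q (e 0) (\<lambda>i. e (Suc i)))" and G: "generic M n G"
  shows "(\<exists>\<rho>\<in>G. Q \<rho> e) \<or> (\<exists>\<rho>\<in>G. \<forall>\<pi>\<in>C. sub M \<rho> \<pi> \<longrightarrow> \<not> Q \<pi> e)"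
proof -
  \<comment> \<open>The conditions that satisfy Q or exclude it in all their extensions. They are
    dense: a condition with no extension satisfying Q is itself of the second kind.\<close>
  define D where "D = {x. x \<in> C \<and> (Q x e \<or> (\<forall>y. y \<in> C \<longrightarrow> sub M x y \<longrightarrow> \<not> Q y e))}"
  have "dfn (\<lambda>e. Q (e 0) (\<lambda>i. e (Suc (Suc i))))"
    using dfn_rename[OF Q, of "case_nat 0 (\<lambda>i. Suc (Suc i))"] by simp
  then have "dfn (\<lambda>e. e 0 \<in> C \<longrightarrow> sub M (e (Suc 0)) (e 0) \<longrightarrow> \<not> Q (e 0) (\<lambda>i. e (Suc (Suc i))))"
    by (intro dfn_imp dfn_condition dfn_not dfn_rep[OF sub_rep[OF trep_var trep_var]])
  from dfn_all[of "\<lambda>y e. y \<in> C \<longrightarrow> sub M (e 0) y \<longrightarrow> \<not> Q y (\<lambda>i. e (Suc i))", OF this]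
  have "dfn (\<lambda>e. e 0 \<in> C \<and> (Q (e 0) (\<lambda>i. e (Suc i)) \<or>
      (\<forall>y. y \<in> C \<longrightarrow> sub M (e 0) y \<longrightarrow> \<not> Q y (\<lambda>i. e (Suc i)))))"
    by (intro dfn_conj dfn_disj dfn_condition Q)
  then obtain \<phi> where \<phi>: "\<And>e. (e 0 \<in> C \<and> (Q (e 0) (\<lambda>i. e (Suc i)) \<or>
      (\<forall>y. y \<in> C \<longrightarrow> sub M (e 0) y \<longrightarrow> \<not> Q y (\<lambda>i. e (Suc i))))) = sat M UNIV (Id_on C) e \<phi>"
    unfolding dfn_def by blast
  have "D = {x. sat M UNIV (Id_on C) (case_nat x e) \<phi>}"
    unfolding D_def \<phi>[of "case_nat _ e", symmetric] by simp
  then have "P_definable M n D" unfolding P_definable_def by blast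
  moreover have "dense_in M n D"
    unfolding dense_in_def extends_iff
  proof (intro conjI ballI)
    fix \<sigma> assume \<sigma>: "\<sigma> \<in> C"
    show "\<exists>\<tau>\<in>D. sub M \<sigma> \<tau>"
    proof (cases "\<exists>y. y \<in> C \<and> sub M \<sigma> y \<and> Q y e")
      case True
      then show ?thesis unfolding D_def by blast
    next
      case False
      then have "\<sigma> \<in> D" using \<sigma> unfolding D_def by blast
      then show ?thesis using sub_refl by blast
    qed
  qed (auto simp: D_def)
  ultimately have "G \<inter> D \<noteq> {}" using G unfolding generic_def by blast
  then show ?thesis unfolding D_def by blast
qed

text \<open>A definition uses finitely many parameters, so it is given by a formula and a finite
  list over the countable universe.\<close>

lemma countable_P_definable:
  assumes "countable (UNIV :: 'a set)"
  shows "countable {D. P_definable M n D}"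
proof -
  define F where "F = (\<lambda>(\<phi>, xs). {x. sat M UNIV (Id_on C)
     (case_nat x (\<lambda>i. if i < length xs then xs ! i else zero M)) \<phi>})"
  have "{D. P_definable M n D} \<subseteq> F ` (UNIV \<times> lists UNIV)"
  proof
    fix D assume "D \<in> {D. P_definable M n D}"
    then obtain \<phi> e where D: "D = {x. sat M UNIV (Id_on C) (case_nat x e) \<phi>}"
      unfolding P_definable_def by blast
    obtain k where k: "fvars \<phi> \<subseteq> {..<k}" using finite_fvars[of \<phi>] finite_nat_iff_bounded by blast
    have "sat M UNIV (Id_on C) (case_nat x e) \<phi> = sat M UNIV (Id_on C)
       (case_nat x (\<lambda>i. if i < length (map e [0..<k]) then map e [0..<k] ! i else zero M)) \<phi>" for x
      by (rule sat_cong) (use k in \<open>auto split: nat.split\<close>)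
    then have "D = F (\<phi>, map e [0..<k])" unfolding D F_def by simp
    then show "D \<in> F ` (UNIV \<times> lists UNIV)" by auto
  qed
  moreover have "countable (F ` (UNIV \<times> lists (UNIV :: 'a set)))"
    by (intro countable_image countable_SIGMA countable_lists assms) simp
  ultimately show ?thesis using countable_subset by blast
qed

text \<open>The Rasiowa-Sikorski construction: a descending sequence of conditions meets the
  countably many dense definable sets, and generates a filter.\<close>

lemma generic_exists:
  assumes "countable (UNIV :: 'a set)" and \<sigma>: "\<sigma> \<in> C"
  shows "\<exists>G. generic M n G \<and> \<sigma> \<in> G"
proof -
  define Ds where "Ds = from_nat_into {D. P_definable M n D}"
  have Ds: "\<exists>i. D = Ds i" if "P_definable M n D" for D
    unfolding Ds_def using that from_nat_into_surj[OF countable_P_definable[OF assms(1)]]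
    by (metis mem_Collect_eq)
  \<comment> \<open>The enumeration runs over all definable sets; those that are not dense are
    passed over without extending.\<close>
  define step where "step i \<tau> = (if dense_in M n (Ds i) then (SOME \<pi>. \<pi> \<in> Ds i \<and> sub M \<tau> \<pi>) else \<tau>)" for i \<tau>
  have step_dense: "step i \<tau> \<in> Ds i \<and> sub M \<tau> (step i \<tau>)" if "dense_in M n (Ds i)" "\<tau> \<in> C" for i \<tau>
  proof -
    have "\<exists>\<pi>. \<pi> \<in> Ds i \<and> sub M \<tau> \<pi>" using that unfolding dense_in_def extends_iff by blast
    from someI_ex[OF this] show ?thesis unfolding step_def using that(1) by simp
  qed
  have step_ext: "step i \<tau> \<in> C \<and> sub M \<tau> (step i \<tau>)" if "\<tau> \<in> C" for i \<tau>
  proof (cases "dense_in M n (Ds i)")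
    case True
    then show ?thesis using step_dense[OF True that] unfolding dense_in_def by blast
  next
    case False
    then show ?thesis using that sub_refl by (simp add: step_def)
  qed
  define s where "s = rec_nat \<sigma> step"
  have s0: "s 0 = \<sigma>" and sSuc: "s (Suc i) = step i (s i)" for i by (simp_all add: s_def)
  have sC: "s i \<in> C" for i by (induction i) (use \<sigma> step_ext s0 sSuc in simp_all)
  have smono: "sub M (s i) (s j)" if "i \<le> j" for i j
    using that
  proof (induction j rule: dec_induct)
    case base
    show ?case by (rule sub_refl)
  next
    case (step j)
    have "sub M (s j) (s (Suc j))" using step_ext[OF sC] unfolding sSuc by blast
    with step.IH show ?case by (rule sub_trans)
  qed
  define G where "G = {\<tau>. \<exists>i. sub M \<tau> (s i)}"
  have GC: "G \<subseteq> C" using condition_sub sC unfolding G_def by blast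
  have "filter_of M n G"
    unfolding filter_of_def
  proof (intro conjI ballI impI)
    fix \<tau> \<tau>' assume t: "\<tau> \<in> G" "\<tau>' \<in> G"
    then obtain i j where "sub M \<tau> (s i)" "sub M \<tau>' (s j)" unfolding G_def by blast
    then have "sub M \<tau> (s (max i j))" "sub M \<tau>' (s (max i j))"
      using smono[of i "max i j"] smono[of j "max i j"] sub_trans by (metis max.cobounded1, metis max.cobounded2)
    then have "compat M n \<tau> \<tau>'" using sC unfolding compat_def conditions_iff by blast
    then show "compatible M n \<tau> \<tau>'" using compatible_iff t GC by blast
  next
    fix \<tau> \<tau>' assume "\<tau> \<in> G" "extends M \<tau> \<tau>'"
    then show "\<tau>' \<in> G" unfolding G_def extends_iff using sub_trans by blast
  qed (rule GC)
  moreover have "G \<inter> D \<noteq> {}" if D: "P_definable M n D" "dense_in M n D" for D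
  proof -
    obtain i where i: "D = Ds i" using Ds[OF D(1)] by blast
    have "s (Suc i) \<in> D" using step_dense[of i "s i"] D(2) sC unfolding i sSuc by blast
    moreover have "s (Suc i) \<in> G" unfolding G_def using sub_refl by blast
    ultimately show ?thesis by blast
  qed
  ultimately have "generic M n G" unfolding generic_def by blast
  moreover have "\<sigma> \<in> G" unfolding G_def using sub_refl[of \<sigma>] s0 by (intro CollectI exI[of _ 0]) simp
  ultimately show ?thesis by blast
qed

section \<open>Certificates and truth in generic expansions\<close>

lemma dec_sound:
  assumes G: "filter_of M n G" and \<tau>: "\<tau> \<in> G"
  shows "cert \<tau> b e \<phi> \<Longrightarrow> sat M UNIV (RG G) e \<phi> = b"
proof (induction \<phi> arbitrary: b e)
  case (Rel s t)
  define x y where "x = val M e s" and "y = val M e t"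
  note xy = x_def[symmetric] y_def[symmetric]
  show ?case
  proof (cases b)
    case True
    then show ?thesis using Rel \<tau> by auto
  next
    case False
    \<comment> \<open>Two members of a filter have a common extension, and there (x, y) would clash
      with the pair of \<tau> that refutes it or would be out of range.\<close>
    have "(x, y) \<notin> graph M \<pi>" if \<pi>: "\<pi> \<in> G" for \<pi>
    proof
      assume "(x, y) \<in> graph M \<pi>"
      obtain u where u: "u \<in> C" "sub M \<tau> u" "sub M \<pi> u" using filter_directed[OF G \<tau> \<pi>] by blast
      have gu: "graph M \<tau> \<subseteq> graph M u" "graph M \<pi> \<subseteq> graph M u"
        using u unfolding sub_def graph_def by blast+
      have pu: "pair M x y \<in> ext M u" using \<open>(x, y) \<in> graph M \<pi>\<close> gu unfolding graph_def by blast
      have pi: "pinj M n u" using u(1) unfolding conditions_iff by blast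
      consider "\<not> less M x (plus M n (one M)) \<or> \<not> less M y n" | z where "z \<noteq> y" "(x, z) \<in> graph M \<tau>"
        | z where "z \<noteq> x" "(z, y) \<in> graph M \<tau>"
        using Rel False unfolding dec.simps xy by auto
      then show False
      proof cases
        case 1
        obtain a b where "less M a (plus M n (one M))" "less M b n" "pair M x y = pair M a b"
          using pi pu unfolding pinj_def by blast
        with 1 show False unfolding pair_inj by blast
      next
        case 2
        then have "pair M x z \<in> ext M u" using gu unfolding graph_def by blast
        then show False using pi pu 2(1) unfolding pinj_def by blast
      next
        case 3
        then have "pair M z y \<in> ext M u" using gu unfolding graph_def by blast
        then show False using pi pu 3(1) unfolding pinj_def by blast
      qed
    qed
    then show ?thesis using False unfolding sat.simps xy by blast
  qed
next
  case (Imp \<phi> \<psi>)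
  show ?case
  proof (cases b)
    case True
    then consider "cert \<tau> False e \<phi>" | "cert \<tau> True e \<psi>" using Imp.prems by auto
    then show ?thesis using Imp.IH True by cases auto
  next
    case False
    then show ?thesis using Imp.prems Imp.IH[of _ e] by auto
  qed
next
  case (Forall \<phi>)
  show ?case
  proof (cases b)
    case True
    then show ?thesis using Forall.prems Forall.IH[of True] by simp
  next
    case False
    then show ?thesis using Forall.prems Forall.IH[of False] by auto
  qed
qed auto

text \<open>I is an initial segment closed under terms, so a bounded quantifier has the same
  witnesses in I and in M. This connects truth in I with certificates, whose quantifiers range over
  M.\<close>

lemma sat_bounded:
  assumes IH: "\<And>e. (\<And>v. e v \<in> cut M n) \<Longrightarrow> sat M (cut M n) R e \<phi> = sat M UNIV R e \<phi>"
    and e: "\<And>v. e v \<in> cut M n"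
  shows "sat M (cut M n) R e (BAll t \<phi>) = sat M UNIV R e (BAll t \<phi>)"
    "sat M (cut M n) R e (BEx t \<phi>) = sat M UNIV R e (BEx t \<phi>)"
proof -
  have *: "sat M (cut M n) R (case_nat x e) \<phi> = sat M UNIV R (case_nat x e) \<phi>" if "x \<in> cut M n" for x
    by (rule IH) (use that e in \<open>simp split: nat.split\<close>)
  have "x \<in> cut M n" if "less M x (val M e t)" for x
    using cut_less[OF that val_cut] e by blast
  then show "sat M (cut M n) R e (BAll t \<phi>) = sat M UNIV R e (BAll t \<phi>)"
    "sat M (cut M n) R e (BEx t \<phi>) = sat M UNIV R e (BEx t \<phi>)"
    using * by auto
qed

lemma sat_sharply_bounded:
  "\<phi> \<in> sharply_bounded \<Longrightarrow> (\<And>v. e v \<in> cut M n) \<Longrightarrow> sat M (cut M n) R e \<phi> = sat M UNIV R e \<phi>"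
  by (induction \<phi> arbitrary: e rule: sharply_bounded.induct) (simp_all only: sat.simps sat_bounded)

lemma sat_Sigma1b:
  "\<phi> \<in> Sigma1b \<Longrightarrow> (\<And>v. e v \<in> cut M n) \<Longrightarrow> sat M (cut M n) R e \<phi> = sat M UNIV R e \<phi>"
  by (induction \<phi> arbitrary: e rule: Sigma1b.induct) (simp_all only: sat_sharply_bounded sat_bounded)

lemma sat_Pi1b:
  "\<phi> \<in> Pi1b \<Longrightarrow> (\<And>v. e v \<in> cut M n) \<Longrightarrow> sat M (cut M n) R e \<phi> = sat M UNIV R e \<phi>"
  by (induction \<phi> arbitrary: e rule: Pi1b.induct) (simp_all only: sat_sharply_bounded sat_bounded)

lemma env_bound:
  assumes "finite A" "\<And>v. v \<in> A \<Longrightarrow> e v \<in> cut M n"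
  shows "\<exists>c. \<forall>v\<in>A. leq M (len M (e v)) (len_pow M n c)"
  using assms
proof (induction A rule: finite_induct)
  case (insert v A)
  then obtain a where a: "\<forall>v\<in>A. leq M (len M (e v)) (len_pow M n a)" by blast
  obtain b where b: "leq M (len M (e v)) (len_pow M n b)"
    using insert.prems[of v] unfolding cut_iff small_def by blast
  have "leq M (len_pow M n a) (len_pow M n (max a b))" "leq M (len_pow M n b) (len_pow M n (max a b))"
    by (simp_all add: len_pow_mono[OF two_le_n])
  with a b leq_trans show ?case by (intro exI[of _ "max a b"]) blast
qed simp

text \<open>Every condition extends to one that decides the formula, so some member of G does; by
  soundness it decides according to truth.\<close>

lemma decide_generic:
  assumes G: "generic M n G" and \<phi>: "\<phi> \<in> sharply_bounded" and e: "\<And>v. e v \<in> cut M n"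
  shows "\<exists>\<tau>\<in>G. cert \<tau> (sat M UNIV (RG G) e \<phi>) e \<phi>"
proof -
  define Q where "Q \<rho> e \<longleftrightarrow> dec M (e 0) (graph M \<rho>) True (\<lambda>v. e (Suc v)) \<phi> \<or>
    dec M (e 0) (graph M \<rho>) False (\<lambda>v. e (Suc v)) \<phi>" for \<rho> e
  have "rep M (\<lambda>e. Q (e 0) (\<lambda>i. e (Suc i))) (\<lambda>e.
     dec std (e (Suc 0)) (graph std (e 0)) True (\<lambda>v. e (Suc (Suc v))) \<phi> \<or>
     dec std (e (Suc 0)) (graph std (e 0)) False (\<lambda>v. e (Suc (Suc v))) \<phi>)"
    unfolding Q_def by (rule rep_disj) (rule dec_rep; rule trep_var)+
  from dichotomy[OF dfn_rep[OF this] G, of "case_nat n e"]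
  consider \<rho> where "\<rho> \<in> G" "Q \<rho> (case_nat n e)"
    | \<rho> where "\<rho> \<in> G" "\<forall>\<pi>\<in>C. sub M \<rho> \<pi> \<longrightarrow> \<not> Q \<pi> (case_nat n e)" by blast
  then show ?thesis
  proof cases
    case 1
    then obtain b where b: "cert \<rho> b e \<phi>" unfolding Q_def by auto
    with dec_sound[OF generic_filter[OF G] 1(1) b] 1(1) show ?thesis by blast
  next
    case 2
    obtain c0 where c0: "\<forall>v\<in>fvars \<phi>. leq M (len M (e v)) (len_pow M n c0)"
      using env_bound[OF finite_fvars] e by blast
    obtain c where c: "\<forall>n \<sigma> s. leq M two n \<longrightarrow> (\<forall>v\<in>fvars \<phi>. leq M (len M (e v)) (len_pow M n c0)) \<longrightarrow>
      pinj M n \<sigma> \<longrightarrow> card_le M \<sigma> s \<longrightarrow> leq M (plus M s (len_pow M n c)) n \<longrightarrow>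
      (\<exists>\<rho>. sub M \<sigma> \<rho> \<and> pinj M n \<rho> \<and> card_le M \<rho> (plus M s (len_pow M n c)) \<and>
        (dec M n (graph M \<rho>) True e \<phi> \<or> dec M n (graph M \<rho>) False e \<phi>))"
      using decide_transfer[OF \<phi>] by blast
    have "\<rho> \<in> C" by (rule filter_condition[OF generic_filter[OF G] 2(1)])
    then obtain s where s: "pinj M n \<rho>" "small s" "card_le M \<rho> s" unfolding conditions_iff by blast
    \<comment> \<open>The deciding extension is again a condition since its size is bounded by a sum
      of small numbers. This contradicts the choice of \<rho>.\<close>
    have sc: "small (plus M s (len_pow M n c))" by (rule small_plus[OF s(2) small_len_pow])
    from c[rule_format, OF two_le_n c0[rule_format] s(1,3) small_le_n[OF sc]]
    obtain \<pi> where \<pi>: "sub M \<rho> \<pi>" "pinj M n \<pi>" "card_le M \<pi> (plus M s (len_pow M n c))"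
        "cert \<pi> True e \<phi> \<or> cert \<pi> False e \<phi>" by blast
    have "\<pi> \<in> C" using \<pi>(2,3) sc unfolding conditions_iff by blast
    with \<pi> 2(2) have False unfolding Q_def by auto
    then show ?thesis ..
  qed
qed

lemma case_nat_cut: "x \<in> cut M n \<Longrightarrow> (\<And>v. e v \<in> cut M n) \<Longrightarrow> case_nat x e v \<in> cut M n"
  by (simp split: nat.split)

text \<open>The converse of soundness for truth of an existential formula: the witness lies in the
  cut, and the sharply bounded matrix is decided by a member of G.\<close>

lemma Sigma1b_certificate:
  assumes G: "generic M n G"
  shows "\<phi> \<in> Sigma1b \<Longrightarrow> (\<And>v. e v \<in> cut M n) \<Longrightarrow> sat M UNIV (RG G) e \<phi> \<Longrightarrow>
    \<exists>\<tau>\<in>G. cert \<tau> True e \<phi>"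
proof (induction \<phi> arbitrary: e rule: Sigma1b.induct)
  case (1 \<phi>)
  then show ?case using decide_generic[OF G 1(1), of e] by simp
next
  case (2 \<phi> t)
  then obtain x where x: "less M x (val M e t)" "sat M UNIV (RG G) (case_nat x e) \<phi>" by auto
  have "x \<in> cut M n" using cut_less[OF x(1) val_cut] 2 by blast
  then have "\<exists>\<tau>\<in>G. cert \<tau> True (case_nat x e) \<phi>"
    by (intro 2(2) case_nat_cut x(2) 2(3))
  then show ?case unfolding dec_BEx using x(1) by blast
qed

lemma Pi1b_certificate:
  assumes G: "generic M n G"
  shows "\<phi> \<in> Pi1b \<Longrightarrow> (\<And>v. e v \<in> cut M n) \<Longrightarrow> \<not> sat M UNIV (RG G) e \<phi> \<Longrightarrow>
    \<exists>\<tau>\<in>G. cert \<tau> False e \<phi>"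
proof (induction \<phi> arbitrary: e rule: Pi1b.induct)
  case (1 \<phi>)
  then show ?case using decide_generic[OF G 1(1), of e] by simp
next
  case (2 \<phi> t)
  then obtain x where x: "less M x (val M e t)" "\<not> sat M UNIV (RG G) (case_nat x e) \<phi>" by auto
  have "x \<in> cut M n" using cut_less[OF x(1) val_cut] 2 by blast
  then have "\<exists>\<tau>\<in>G. cert \<tau> False (case_nat x e) \<phi>"
    by (intro 2(2) case_nat_cut x(2) 2(3))
  then show ?case unfolding dec_BAll using x(1) by blast
qed

end

section \<open>Generic expansions satisfy S12\<close>

text \<open>R is excluded together with quantifiers, so that satisfaction depends neither on the
  universe nor on R.\<close>

primrec quantifier_free :: "fm \<Rightarrow> bool" where
  "quantifier_free Fls \<longleftrightarrow> True"
| "quantifier_free (s \<^bold>= t) \<longleftrightarrow> True"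
| "quantifier_free (s \<^bold>< t) \<longleftrightarrow> True"
| "quantifier_free (Rel s t) \<longleftrightarrow> False"
| "quantifier_free (\<phi> \<^bold>\<longrightarrow> \<psi>) \<longleftrightarrow> quantifier_free \<phi> \<and> quantifier_free \<psi>"
| "quantifier_free (Forall \<phi>) \<longleftrightarrow> False"

lemma quantifier_free_simps [simp]:
  "quantifier_free (\<^bold>\<not> \<phi>) \<longleftrightarrow> quantifier_free \<phi>"
  "quantifier_free (\<phi> \<^bold>\<or> \<psi>) \<longleftrightarrow> quantifier_free \<phi> \<and> quantifier_free \<psi>"
  "quantifier_free (\<phi> \<^bold>\<and> \<psi>) \<longleftrightarrow> quantifier_free \<phi> \<and> quantifier_free \<psi>"
  "quantifier_free (\<phi> \<^bold>\<longleftrightarrow> \<psi>) \<longleftrightarrow> quantifier_free \<phi> \<and> quantifier_free \<psi>"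
  "quantifier_free (s \<^bold>\<le> t)"
  by (auto simp: Neg_def Disj_def Conj_def Iff_def Leq_def)

lemma sat_quantifier_free: "quantifier_free \<phi> \<Longrightarrow> sat M D R e \<phi> = sat M UNIV {} e \<phi>"
  by (induction \<phi>) auto

lemma quantifier_free_R_free: "quantifier_free \<phi> \<Longrightarrow> R_free \<phi>"
  by (induction \<phi>) auto

lemma quantifier_free_BASIC: "\<phi> \<in> BASIC \<Longrightarrow> quantifier_free \<phi>"
  unfolding BASIC_def Let_def by (elim insertE emptyE; simp)

lemma BASIC_standard:
  assumes "\<phi> \<in> BASIC"
  shows "sat std UNIV {} e \<phi>"
proof -
  have "len std (x + x) = Suc (len std x)" if "x \<noteq> 0" for x
    using len_double[OF that] by (simp add: mult_2)
  moreover have "len std (Suc (x + x)) = Suc (len std x)" for x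
    using len_double_1[of x] by (simp add: mult_2)
  ultimately have "\<forall>\<phi>\<in>BASIC. sat std UNIV {} e \<phi>"
    unfolding BASIC_def Let_def ball_simps
    by (intro conjI) (auto simp: len_half[of "e 0"] len_mono power_add[symmetric] algebra_simps)
  then show ?thesis using assms by blast
qed

context forcing_setting
begin

lemma sat_BASIC: "\<phi> \<in> BASIC \<Longrightarrow> sat M D R e \<phi>"
  using sat_quantifier_free[OF quantifier_free_BASIC]
    transfer_valid[OF Th quantifier_free_R_free[OF quantifier_free_BASIC] BASIC_standard] by blast

lemma graph_sub: "sub M s t \<Longrightarrow> graph M s \<subseteq> graph M t"
  unfolding sub_def graph_def by blast

lemma dec_sub: "sub M s t \<Longrightarrow> cert s b e \<phi> \<Longrightarrow> cert t b e \<phi>"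
  by (rule dec_mono[OF graph_sub])

text \<open>One k serves all assignments dominated by d: below z in the proof of PIND, and below 2m
  and m for the entries of the array.\<close>

lemma certificate_bound:
  assumes "\<exists>c. shrinks \<phi> b c"
    and d: "\<And>v. d v \<in> cut M n"
  shows "\<exists>k. small k \<and> (\<forall>e \<sigma>. (\<forall>v. leq M (e v) (d v)) \<longrightarrow> \<sigma> \<in> C \<longrightarrow> cert \<sigma> b e \<phi> \<longrightarrow>
    (\<exists>\<tau>. sub M \<tau> \<sigma> \<and> card_le M \<tau> k \<and> cert \<tau> b e \<phi>))"
proof -
  obtain c0 where c0: "\<forall>v\<in>fvars \<phi>. leq M (len M (d v)) (len_pow M n c0)"
    using env_bound[OF finite_fvars[of \<phi>], of d] d by blast
  obtain c where c: "\<forall>e n \<sigma>. leq M two n \<longrightarrow> (\<forall>v\<in>fvars \<phi>. leq M (len M (e v)) (len_pow M n c0)) \<longrightarrow>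
    pinj M n \<sigma> \<longrightarrow> dec M n (graph M \<sigma>) b e \<phi> \<longrightarrow>
    (\<exists>\<tau>. sub M \<tau> \<sigma> \<and> pinj M n \<tau> \<and> card_le M \<tau> (len_pow M n c) \<and> dec M n (graph M \<tau>) b e \<phi>)"
    using shrink_transfer[OF assms(1)] by blast
  have "\<exists>\<tau>. sub M \<tau> \<sigma> \<and> card_le M \<tau> (len_pow M n c) \<and> cert \<tau> b e \<phi>"
    if e: "\<forall>v. leq M (e v) (d v)" and \<sigma>: "\<sigma> \<in> C" "cert \<sigma> b e \<phi>" for e \<sigma>
  proof -
    have "leq M (len M (e v)) (len_pow M n c0)" if "v \<in> fvars \<phi>" for v
      by (rule leq_trans[OF len_mono_M[OF spec[OF e]] bspec[OF c0 that]])
    moreover have "pinj M n \<sigma>" using \<sigma>(1) unfolding conditions_iff by blast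
    ultimately show ?thesis using c two_le_n \<sigma>(2) by blast
  qed
  then show ?thesis using small_len_pow by blast
qed

lemma sat_PIND:
  assumes G: "generic M n G" and \<phi>: "\<phi> \<in> Sigma1b" and e: "\<And>v. e v \<in> cut M n"
  shows "sat M (cut M n) (RG G) e (PIND \<phi>)"
proof -
  note F = generic_filter[OF G]
  define S where "S x = sat M UNIV (RG G) (case_nat x e) \<phi>" for x
  have S: "sat M (cut M n) (RG G) (case_nat x e) \<phi> = S x" if "x \<in> cut M n" for x
    unfolding S_def using case_nat_cut[of x e] that e by (intro sat_Sigma1b[OF \<phi>]) blast
  have env: "(\<lambda>i. val M (case_nat x e) (if i = 0 then Half (Var 0) else Var i)) = case_nat (half M x) e" for x
    by (rule HOL.ext) (simp split: nat.split)
  have zero: "zero M \<in> cut M n" using val_cut[of Zero e] by simp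
  have half: "half M x \<in> cut M n" if "x \<in> cut M n" for x using cut_mono[OF half_le that] .
  have "S z" if S0: "S (zero M)" and step: "\<And>x. x \<in> cut M n \<Longrightarrow> S (half M x) \<Longrightarrow> S x"
    and z: "z \<in> cut M n" for z
  proof (rule ccontr)
    assume nz: "\<not> S z"
    obtain \<tau>0 where \<tau>0: "\<tau>0 \<in> G" "cert \<tau>0 True (case_nat (zero M) e) \<phi>"
      using Sigma1b_certificate[OF G \<phi> case_nat_cut[OF zero e] S0[unfolded S_def]] by blast
    \<comment> \<open>The parameters of Q are n, z and e. Failure at x is required for all
      conditions below \<rho>, which is stronger than the failure with a size bound that
      \<open>pind_transfer\<close> provides.\<close>
    define Q where "Q \<rho> p \<longleftrightarrow>
      dec M (p 0) (graph M \<rho>) True (case_nat (p (Suc 0)) (\<lambda>v. p (Suc (Suc v)))) \<phi> \<or>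
      (\<exists>x. leq M x (p (Suc 0)) \<and> dec M (p 0) (graph M \<rho>) True (case_nat (half M x) (\<lambda>v. p (Suc (Suc v)))) \<phi> \<and>
        \<not> (\<exists>\<pi>. \<pi> \<in> C \<and> sub M \<rho> \<pi> \<and> dec M (p 0) (graph M \<pi>) True (case_nat x (\<lambda>v. p (Suc (Suc v)))) \<phi>))" for \<rho> p
    let ?p = "case_nat n (case_nat z e)"
    have Qp: "Q \<rho> ?p \<longleftrightarrow> cert \<rho> True (case_nat z e) \<phi> \<or>
      (\<exists>x. leq M x z \<and> cert \<rho> True (case_nat (half M x) e) \<phi> \<and>
        \<not> (\<exists>\<pi>. \<pi> \<in> C \<and> sub M \<rho> \<pi> \<and> cert \<pi> True (case_nat x e) \<phi>))" for \<rho>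
      unfolding Q_def by simp
    have "dfn (\<lambda>p. Q (p 0) (\<lambda>i. p (Suc i)))"
      unfolding Q_def
      by (rule dfn_disj dfn_conj dfn_not dfn_ex dfn_condition dfn_rep[OF dec_rep] dfn_rep[OF leq_rep]
          dfn_rep[OF sub_rep] trep_intros)+
    from dichotomy[OF this G, of ?p]
    consider (meets) \<rho> where "\<rho> \<in> G" "Q \<rho> ?p" | (avoids) \<rho> where "\<rho> \<in> G" "\<forall>\<pi>\<in>C. sub M \<rho> \<pi> \<longrightarrow> \<not> Q \<pi> ?p"
      by blast
    then show False
    proof cases
      case meets
      have sound: "S x" if "cert \<rho> True (case_nat x e) \<phi>" for x
        using dec_sound[OF F meets(1) that] unfolding S_def by simp
      from meets(2) sound nz obtain x where x: "leq M x z" "cert \<rho> True (case_nat (half M x) e) \<phi>"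
        and no: "\<not> (\<exists>\<pi>. \<pi> \<in> C \<and> sub M \<rho> \<pi> \<and> cert \<pi> True (case_nat x e) \<phi>)"
        unfolding Qp by blast
      have xc: "x \<in> cut M n" by (rule cut_mono[OF x(1) z])
      \<comment> \<open>Induction is inductive at x in the expansion, so \<phi>(x) is true and has a
        certificate in G. That certificate is compatible with \<rho>, contrary to the exclusion of
        x.\<close>
      have "S x" by (rule step[OF xc sound[OF x(2)]])
      then have "sat M UNIV (RG G) (case_nat x e) \<phi>" unfolding S_def .
      from Sigma1b_certificate[OF G \<phi> case_nat_cut[OF xc e] this]
      obtain \<tau> where \<tau>: "\<tau> \<in> G" "cert \<tau> True (case_nat x e) \<phi>" by blast
      obtain u where "u \<in> C" "sub M \<rho> u" "sub M \<tau> u" using filter_directed[OF F meets(1) \<tau>(1)] .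
      with dec_sub[OF _ \<tau>(2)] no show False by blast
    next
      case avoids
      obtain u where u: "u \<in> C" "sub M \<rho> u" "sub M \<tau>0 u" using filter_directed[OF F avoids(1) \<tau>0(1)] .
      obtain s where s: "pinj M n u" "small s" "card_le M u s" using u(1) unfolding conditions_iff by blast
      obtain k where k: "small k" and bound0: "\<forall>e' \<sigma>. (\<forall>v. leq M (e' v) (case_nat z e v)) \<longrightarrow> \<sigma> \<in> C \<longrightarrow>
          cert \<sigma> True e' \<phi> \<longrightarrow>
          (\<exists>\<tau>. sub M \<tau> \<sigma> \<and> card_le M \<tau> k \<and> cert \<tau> True e' \<phi>)"
        using certificate_bound[of \<phi> True "case_nat z e", OF shrink_Sigma1b[OF \<phi>] case_nat_cut[OF z e]]
        by blast
      have bound: "\<exists>\<tau>. sub M \<tau> \<sigma> \<and> card_le M \<tau> k \<and> cert \<tau> True (case_nat x e) \<phi>"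
        if "leq M x z" "\<sigma> \<in> C" "cert \<sigma> True (case_nat x e) \<phi>" for x \<sigma>
        by (rule bound0[rule_format, OF _ that(2,3)]) (use that(1) leq_refl in \<open>simp split: nat.split\<close>)
      have sl: "small (plus M s (times M (len M z) k))"
        using z unfolding cut_iff by (intro small_plus small_times s(2) k)
      obtain \<pi> l where \<pi>: "sub M u \<pi>" "pinj M n \<pi>" "card_le M \<pi> l" "leq M l (plus M s (times M (len M z) k))"
        and alt: "cert \<pi> True (case_nat z e) \<phi> \<or>
         (\<exists>x. leq M x z \<and> cert \<pi> True (case_nat (half M x) e) \<phi> \<and>
           \<not> (\<exists>\<mu>. sub M \<pi> \<mu> \<and> pinj M n \<mu> \<and> card_le M \<mu> (plus M l k) \<and>
              cert \<mu> True (case_nat x e) \<phi>))"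
        using pind_transfer[rule_format, OF s(1,3) dec_sub[OF u(3) \<tau>0(2)], of z k] by blast
      have \<pi>C: "\<pi> \<in> C" using \<pi>(2,3) small_mono[OF \<pi>(4) sl] unfolding conditions_iff by blast
      have "Q \<pi> ?p"
        using alt unfolding Qp
      proof (elim disjE exE conjE)
        fix x assume x: "leq M x z" "cert \<pi> True (case_nat (half M x) e) \<phi>"
          and no: "\<not> (\<exists>\<mu>. sub M \<pi> \<mu> \<and> pinj M n \<mu> \<and> card_le M \<mu> (plus M l k) \<and>
              cert \<mu> True (case_nat x e) \<phi>)"
        \<comment> \<open>The size bound is removed by shrinking: a certificate in \<mu> contains
          one with at most k pairs, whose union with \<pi> has size at most l + k and would be an
          extension of the excluded kind.\<close>
        have False if \<mu>: "\<mu> \<in> C" "sub M \<pi> \<mu>" "cert \<mu> True (case_nat x e) \<phi>" for \<mu>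
        proof -
          obtain \<tau> where \<tau>: "sub M \<tau> \<mu>" "card_le M \<tau> k" "cert \<tau> True (case_nat x e) \<phi>"
            using bound[OF x(1) \<mu>(1,3)] by blast
          obtain w where w: "joins M w \<pi> \<tau>" using ex_joins by blast
          have "pinj M n \<mu>" using \<mu>(1) unfolding conditions_iff by blast
          then have "pinj M n w" by (rule pinj_sub) (rule joins_least[OF w \<mu>(2) \<tau>(1)])
          with no joins_sub[OF w] card_le_joins[OF w \<pi>(3) \<tau>(2)] dec_sub[OF joins_sub(2)[OF w] \<tau>(3)]
          show False by blast
        qed
        with x show "cert \<pi> True (case_nat z e) \<phi> \<or>
          (\<exists>x. leq M x z \<and> cert \<pi> True (case_nat (half M x) e) \<phi> \<and>
            \<not> (\<exists>\<mu>. \<mu> \<in> C \<and> sub M \<pi> \<mu> \<and> cert \<mu> True (case_nat x e) \<phi>))"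
          by blast
      qed blast
      with avoids(2) \<pi>C sub_trans[OF u(2) \<pi>(1)] show False by blast
    qed
  qed
  moreover have "sat M (cut M n) (RG G) e (PIND \<phi>) \<longleftrightarrow>
      (S (zero M) \<and> (\<forall>x\<in>cut M n. S (half M x) \<longrightarrow> S x) \<longrightarrow> (\<forall>z\<in>cut M n. S z))"
    unfolding PIND_def by (simp add: sat_fsubst[of _ _ _ "case_nat _ e"] env S zero half)
  ultimately show ?thesis by blast
qed

lemma proves_sound:
  assumes "T \<turnstile> \<phi>" and "\<And>\<psi> e. \<psi> \<in> T \<Longrightarrow> (\<And>v. e v \<in> cut M n) \<Longrightarrow> sat M (cut M n) R e \<psi>"
  shows "(\<And>v. e v \<in> cut M n) \<Longrightarrow> sat M (cut M n) R e \<phi>"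
  using assms(1)
proof (induction \<phi> arbitrary: e rule: proves.induct)
  case (axiom \<phi>)
  then show ?case using assms(2) by blast
next
  case (inst \<phi> t)
  then show ?case using val_cut[of t e] by simp
next
  case (generalise \<phi>)
  then show ?case using case_nat_cut[of _ e] by simp
next
  case (modus_ponens \<phi> \<psi>)
  have "sat M (cut M n) R e (\<phi> \<^bold>\<longrightarrow> \<psi>)" "sat M (cut M n) R e \<phi>"
    by (rule modus_ponens.IH, rule modus_ponens.prems)+
  then show ?case by simp
qed simp_all

text \<open>Through this lemma the provable equivalence of \<phi> and \<psi> becomes their
  equivalence in every generic expansion.\<close>

lemma S12_sound:
  assumes "generic M n G" "S12 \<turnstile> \<phi>" "\<And>v. e v \<in> cut M n"
  shows "sat M (cut M n) (RG G) e \<phi>"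
  by (rule proves_sound[OF assms(2) _ assms(3)])
    (auto simp: S12_def intro: sat_BASIC sat_PIND[OF assms(1)])

section \<open>The array\<close>

lemma plus_ge: "leq M x (plus M x y)" "leq M y (plus M x y)"
proof -
  have "\<forall>x y. leq M x (plus M x y) \<and> leq M y (plus M x y)"
    apply (rule transfer_M)
     apply (rule transfer_rules)+
    by simp
  then show "leq M x (plus M x y)" "leq M y (plus M x y)" by blast+
qed

lemma join3:
  assumes "a \<in> C" "b \<in> C" "c \<in> C" "compat M n a b" "compat M n a c" "compat M n b c"
  obtains u where "u \<in> C" "sub M a u" "sub M b u" "sub M c u"
proof -
  obtain v where v: "pinj M n v" "sub M a v" "sub M b v" "sub M c v"
    using compat3[OF assms(4-6)] by blast
  obtain d where d: "d \<in> C" "joins M d a b" using compat_joins[OF assms(1,2,4)] .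
  obtain u where u: "joins M u d c" using ex_joins by blast
  have "pinj M n u"
    by (rule pinj_sub[OF v(1)]) (rule joins_least[OF u joins_least[OF d(2) v(2,3)] v(4)])
  then have "u \<in> C" using condition_joins[OF d(1) assms(3) _ u] by blast
  moreover have "sub M a u" "sub M b u" "sub M c u"
    using joins_sub[OF u] joins_sub[OF d(2)] sub_trans by blast+
  ultimately show thesis by (rule that)
qed

lemma filter_compat: "filter_of M n G \<Longrightarrow> \<sigma> \<in> G \<Longrightarrow> \<tau> \<in> G \<Longrightarrow> compat M n \<sigma> \<tau>"
  using compatible_iff filter_condition unfolding filter_of_def by blast

lemma filter_directed3:
  assumes G: "filter_of M n G" and abc: "a \<in> G" "b \<in> G" "c \<in> G"
  obtains u where "u \<in> C" "sub M a u" "sub M b u" "sub M c u"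
  using join3[OF filter_condition[OF G abc(1)] filter_condition[OF G abc(2)] filter_condition[OF G abc(3)]
      filter_compat[OF G abc(1,2)] filter_compat[OF G abc(1,3)] filter_compat[OF G abc(2,3)]]
  by blast

lemma sat_WPHP:
  assumes m: "m \<in> cut M n" and p: "\<And>i. p i \<in> cut M n"
    and \<phi>: "\<And>e. (\<And>v. e v \<in> cut M n) \<Longrightarrow> sat M (cut M n) R e \<phi> = sat M UNIV R e \<phi>"
  defines "S a b \<equiv> sat M UNIV R (case_nat a (case_nat b p)) \<phi>"
  shows "sat M (cut M n) R (case_nat m p) (WPHP \<phi>) \<longleftrightarrow>
    (\<exists>a. less M a (times M two m) \<and> (\<forall>b. less M b m \<longrightarrow> \<not> S a b)) \<or>
    (\<exists>a a' b. less M a (times M two m) \<and> less M a' (times M two m) \<and> less M b m \<and> a \<noteq> a' \<and> S a b \<and> S a' b) \<or>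
    (\<exists>a b b'. less M a (times M two m) \<and> less M b m \<and> less M b' m \<and> b \<noteq> b' \<and> S a b \<and> S a b')"
proof -
  have "times M two m \<in> cut M n"
    using val_cut[of "(One \<^bold>+ One) \<^bold>* Var 0" "case_nat m p"] m by simp
  then have a: "a \<in> cut M n" if "less M a (times M two m)" for a using cut_less[OF that] by blast
  have b: "b \<in> cut M n" if "less M b m" for b using cut_less[OF that m] .
  have S: "sat M (cut M n) R (case_nat a (case_nat b p)) \<phi> = S a b" if "a \<in> cut M n" "b \<in> cut M n" for a b
    unfolding S_def by (rule \<phi>) (use that p in \<open>simp split: nat.split\<close>)
  have 1: "sat M (cut M n) R (case_nat m p) (BEx ((One \<^bold>+ One) \<^bold>* Var 0) (BAll (Var 1) (\<^bold>\<not> app 2 1 0 \<phi>))) \<longleftrightarrow>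
    (\<exists>a. less M a (times M two m) \<and> (\<forall>b. less M b m \<longrightarrow> \<not> S a b))"
    using a b by (auto simp: sat_app S)
  have 2: "sat M (cut M n) R (case_nat m p) (BEx ((One \<^bold>+ One) \<^bold>* Var 0)
      (BEx ((One \<^bold>+ One) \<^bold>* Var 1) (\<^bold>\<not> (Var 1 \<^bold>= Var 0) \<^bold>\<and> BEx (Var 2) (app 3 2 0 \<phi> \<^bold>\<and> app 3 1 0 \<phi>)))) \<longleftrightarrow>
    (\<exists>a a' b. less M a (times M two m) \<and> less M a' (times M two m) \<and> less M b m \<and> a \<noteq> a' \<and> S a b \<and> S a' b)"
    using a b by (auto simp: sat_app S eval_nat_numeral) blast+
  have 3: "sat M (cut M n) R (case_nat m p) (BEx ((One \<^bold>+ One) \<^bold>* Var 0)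
      (BEx (Var 1) (BEx (Var 2) (\<^bold>\<not> (Var 1 \<^bold>= Var 0) \<^bold>\<and> (app 3 2 1 \<phi> \<^bold>\<and> app 3 2 0 \<phi>))))) \<longleftrightarrow>
    (\<exists>a b b'. less M a (times M two m) \<and> less M b m \<and> less M b' m \<and> b \<noteq> b' \<and> S a b \<and> S a b')"
    using a b by (auto simp: sat_app S eval_nat_numeral) blast+
  show ?thesis unfolding WPHP_def Let_def sat_Disj 1 2 3 ..
qed

text \<open>The failure of each disjunct of WPHP is restated in terms of certificates, and one
  condition of G enforces all three below it. Totality becomes density of certified values; the
  other two say that no condition certifies a collision.\<close>

lemma WPHP_failure_condition:
  assumes m: "m \<in> cut M n" and p: "\<And>i. p i \<in> cut M n" and \<phi>: "\<phi> \<in> Sigma1b"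
    and G: "generic M n G" and fails: "\<not> sat M (cut M n) (RG G) (case_nat m p) (WPHP \<phi>)"
  defines "D \<rho> a b \<equiv> cert \<rho> True (case_nat a (case_nat b p)) \<phi>"
  obtains \<sigma> where "\<sigma> \<in> C"
    "\<And>\<pi> a. \<pi> \<in> C \<Longrightarrow> sub M \<sigma> \<pi> \<Longrightarrow> less M a (times M two m) \<Longrightarrow>
      \<exists>\<rho> b. \<rho> \<in> C \<and> sub M \<pi> \<rho> \<and> less M b m \<and> D \<rho> a b"
    "\<And>\<pi> a a' b. \<pi> \<in> C \<Longrightarrow> sub M \<sigma> \<pi> \<Longrightarrow> less M a (times M two m) \<Longrightarrow> less M a' (times M two m) \<Longrightarrow>
      less M b m \<Longrightarrow> D \<pi> a b \<Longrightarrow> D \<pi> a' b \<Longrightarrow> a = a'"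
    "\<And>\<pi> a b b'. \<pi> \<in> C \<Longrightarrow> sub M \<sigma> \<pi> \<Longrightarrow> less M a (times M two m) \<Longrightarrow> less M b m \<Longrightarrow>
      less M b' m \<Longrightarrow> D \<pi> a b \<Longrightarrow> D \<pi> a b' \<Longrightarrow> b = b'"
proof -
  note F = generic_filter[OF G]
  define S where "S a b = sat M UNIV (RG G) (case_nat a (case_nat b p)) \<phi>" for a b
  have wphp: "sat M (cut M n) (RG G) (case_nat m p) (WPHP \<phi>) \<longleftrightarrow>
    (\<exists>a. less M a (times M two m) \<and> (\<forall>b. less M b m \<longrightarrow> \<not> S a b)) \<or>
    (\<exists>a a' b. less M a (times M two m) \<and> less M a' (times M two m) \<and> less M b m \<and> a \<noteq> a' \<and> S a b \<and> S a' b) \<or>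
    (\<exists>a b b'. less M a (times M two m) \<and> less M b m \<and> less M b' m \<and> b \<noteq> b' \<and> S a b \<and> S a b')"
    unfolding S_def by (rule sat_WPHP[OF m p sat_Sigma1b[OF \<phi>]])
  have total: "\<exists>b. less M b m \<and> S a b" if "less M a (times M two m)" for a
    using fails that unfolding wphp by blast
  have injective: "a = a'" if "less M a (times M two m)" "less M a' (times M two m)" "less M b m" "S a b" "S a' b" for a a' b
    using fails that unfolding wphp by blast
  have functional: "b = b'" if "less M a (times M two m)" "less M b m" "less M b' m" "S a b" "S a b'" for a b b'
    using fails that unfolding wphp by blast
  have "times M two m \<in> cut M n"
    using val_cut[of "(One \<^bold>+ One) \<^bold>* Var 0" "case_nat m p"] m by simp
  then have ab: "case_nat a (case_nat b p) v \<in> cut M n" if "less M a (times M two m)" "less M b m" for a b v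
    using cut_less[OF that(1)] cut_less[OF that(2) m] p by (simp split: nat.split)
  \<comment> \<open>The three possible violations: a row for which no extension certifies a value,
    and certified collisions in a column or in a row. As before, the first two parameters carry n
    and m.\<close>
  define Q1 where "Q1 \<rho> q \<longleftrightarrow> (\<exists>a. less M a (times M two (q (Suc 0))) \<and>
    \<not> (\<exists>\<pi>. \<pi> \<in> C \<and> sub M \<rho> \<pi> \<and> (\<exists>b. less M b (q (Suc 0)) \<and>
      dec M (q 0) (graph M \<pi>) True (case_nat a (case_nat b (\<lambda>v. q (Suc (Suc v))))) \<phi>)))" for \<rho> q
  define Q2 where "Q2 \<rho> q \<longleftrightarrow> (\<exists>a a' b. less M a (times M two (q (Suc 0))) \<and> less M a' (times M two (q (Suc 0))) \<and>
    less M b (q (Suc 0)) \<and> \<not> a = a' \<and>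
    dec M (q 0) (graph M \<rho>) True (case_nat a (case_nat b (\<lambda>v. q (Suc (Suc v))))) \<phi> \<and>
    dec M (q 0) (graph M \<rho>) True (case_nat a' (case_nat b (\<lambda>v. q (Suc (Suc v))))) \<phi>)" for \<rho> q
  define Q3 where "Q3 \<rho> q \<longleftrightarrow> (\<exists>a b b'. less M a (times M two (q (Suc 0))) \<and> less M b (q (Suc 0)) \<and>
    less M b' (q (Suc 0)) \<and> \<not> b = b' \<and>
    dec M (q 0) (graph M \<rho>) True (case_nat a (case_nat b (\<lambda>v. q (Suc (Suc v))))) \<phi> \<and>
    dec M (q 0) (graph M \<rho>) True (case_nat a (case_nat b' (\<lambda>v. q (Suc (Suc v))))) \<phi>)" for \<rho> q
  let ?q = "case_nat n (case_nat m p)"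
  have Q1: "Q1 \<rho> ?q \<longleftrightarrow> (\<exists>a. less M a (times M two m) \<and>
    \<not> (\<exists>\<pi>. \<pi> \<in> C \<and> sub M \<rho> \<pi> \<and> (\<exists>b. less M b m \<and> D \<pi> a b)))" for \<rho>
    unfolding Q1_def D_def by simp
  have Q2: "Q2 \<rho> ?q \<longleftrightarrow> (\<exists>a a' b. less M a (times M two m) \<and> less M a' (times M two m) \<and> less M b m \<and>
    a \<noteq> a' \<and> D \<rho> a b \<and> D \<rho> a' b)" for \<rho>
    unfolding Q2_def D_def by simp
  have Q3: "Q3 \<rho> ?q \<longleftrightarrow> (\<exists>a b b'. less M a (times M two m) \<and> less M b m \<and> less M b' m \<and>
    b \<noteq> b' \<and> D \<rho> a b \<and> D \<rho> a b')" for \<rho>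
    unfolding Q3_def D_def by simp
  have "dfn (\<lambda>q. Q1 (q 0) (\<lambda>i. q (Suc i)) \<or> Q2 (q 0) (\<lambda>i. q (Suc i)) \<or> Q3 (q 0) (\<lambda>i. q (Suc i)))"
    unfolding Q1_def Q2_def Q3_def
    by (rule dfn_disj dfn_conj dfn_not dfn_ex dfn_condition dfn_rep[OF dec_rep] dfn_rep[OF rep_less]
        dfn_rep[OF sub_rep] dfn_rep[OF rep_eq] trep_intros)+
  from dichotomy[of "\<lambda>\<rho> q. Q1 \<rho> q \<or> Q2 \<rho> q \<or> Q3 \<rho> q", OF this G, of ?q]
  consider (meets) \<rho> where "\<rho> \<in> G" "Q1 \<rho> ?q \<or> Q2 \<rho> ?q \<or> Q3 \<rho> ?q"
    | (avoids) \<rho> where "\<rho> \<in> G" "\<forall>\<pi>\<in>C. sub M \<rho> \<pi> \<longrightarrow> \<not> (Q1 \<pi> ?q \<or> Q2 \<pi> ?q \<or> Q3 \<pi> ?q)"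
    by blast
  then show thesis
  proof cases
    case meets
    \<comment> \<open>A certified collision would be a true one in the expansion by G. A row without
      certifiable value contradicts the certificate in G for its actual value.\<close>
    have sound: "S a b" if "D \<rho> a b" for a b
      using dec_sound[OF F meets(1) that[unfolded D_def]] unfolding S_def by simp
    have "\<not> Q2 \<rho> ?q" unfolding Q2 using sound injective by blast
    moreover have "\<not> Q3 \<rho> ?q" unfolding Q3 using sound functional by blast
    ultimately obtain a where a: "less M a (times M two m)"
      and no: "\<not> (\<exists>\<pi>. \<pi> \<in> C \<and> sub M \<rho> \<pi> \<and> (\<exists>b. less M b m \<and> D \<pi> a b))"
      using meets(2) unfolding Q1 by blast
    obtain b where b: "less M b m" "S a b" using total[OF a] by blast
    obtain \<tau> where \<tau>: "\<tau> \<in> G" "D \<tau> a b"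
      using Sigma1b_certificate[OF G \<phi> ab[OF a b(1)] b(2)[unfolded S_def]] unfolding D_def by blast
    obtain u where "u \<in> C" "sub M \<rho> u" "sub M \<tau> u" using filter_directed[OF F meets(1) \<tau>(1)] .
    with no b(1) dec_sub[OF _ \<tau>(2)[unfolded D_def]] have False unfolding D_def by blast
    then show thesis ..
  next
    case avoids
    have no: "\<not> Q1 \<pi> ?q" "\<not> Q2 \<pi> ?q" "\<not> Q3 \<pi> ?q" if "\<pi> \<in> C" "sub M \<rho> \<pi>" for \<pi>
      using avoids(2) that by blast+
    show thesis
    proof (rule that[OF filter_condition[OF F avoids(1)]])
      fix \<pi> a assume "\<pi> \<in> C" "sub M \<rho> \<pi>" "less M a (times M two m)"
      with no(1)[OF this(1,2)] show "\<exists>\<rho> b. \<rho> \<in> C \<and> sub M \<pi> \<rho> \<and> less M b m \<and> D \<rho> a b"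
        unfolding Q1 by blast
    next
      fix \<pi> a a' b assume "\<pi> \<in> C" "sub M \<rho> \<pi>" "less M a (times M two m)" "less M a' (times M two m)"
        "less M b m" "D \<pi> a b" "D \<pi> a' b"
      with no(2)[OF this(1,2)] show "a = a'" unfolding Q2 by blast
    next
      fix \<pi> a b b' assume "\<pi> \<in> C" "sub M \<rho> \<pi>" "less M a (times M two m)" "less M b m" "less M b' m"
        "D \<pi> a b" "D \<pi> a b'"
      with no(3)[OF this(1,2)] show "b = b'" unfolding Q3 by blast
    qed
  qed
qed

lemma WPHP_array_exists:
  assumes count: "countable (UNIV :: 'a set)" and m: "m \<in> cut M n" and p: "\<And>i. p i \<in> cut M n"
    and \<phi>: "\<phi> \<in> Sigma1b" and \<psi>: "\<psi> \<in> Pi1b" and eqv: "S12 \<turnstile> (\<phi> \<^bold>\<longleftrightarrow> \<psi>)"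
    and G: "generic M n G" and fails: "\<not> sat M (cut M n) (RG G) (case_nat m p) (WPHP \<phi>)"
  shows "\<exists>\<sigma>\<in>C. \<exists>(c::nat) k. leq M k (len_pow M n c) \<and> (\<exists>A. WPHP_array M n m k \<sigma> A)"
proof -
  define D where "D \<rho> a b = cert \<rho> True (case_nat a (case_nat b p)) \<phi>" for \<rho> a b
  define N where "N \<rho> a b = cert \<rho> False (case_nat a (case_nat b p)) \<psi>" for \<rho> a b
  define row where "row a \<longleftrightarrow> less M a (times M two m)" for a
  define col where "col b \<longleftrightarrow> less M b m" for b
  define S where "S H a b = sat M UNIV (RG H) (case_nat a (case_nat b p)) \<phi>" for H a b
  obtain \<sigma> where \<sigma>: "\<sigma> \<in> C"
    and total: "\<And>\<pi> a. \<pi> \<in> C \<Longrightarrow> sub M \<sigma> \<pi> \<Longrightarrow> row a \<Longrightarrow> \<exists>\<rho> b. \<rho> \<in> C \<and> sub M \<pi> \<rho> \<and> col b \<and> D \<rho> a b"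
    and injective: "\<And>\<pi> a a' b. \<pi> \<in> C \<Longrightarrow> sub M \<sigma> \<pi> \<Longrightarrow> row a \<Longrightarrow> row a' \<Longrightarrow> col b \<Longrightarrow> D \<pi> a b \<Longrightarrow> D \<pi> a' b \<Longrightarrow> a = a'"
    and functional: "\<And>\<pi> a b b'. \<pi> \<in> C \<Longrightarrow> sub M \<sigma> \<pi> \<Longrightarrow> row a \<Longrightarrow> col b \<Longrightarrow> col b' \<Longrightarrow> D \<pi> a b \<Longrightarrow> D \<pi> a b' \<Longrightarrow> b = b'"
    using WPHP_failure_condition[OF m p \<phi> G fails] unfolding D_def row_def col_def by blast
  have mm: "times M two m \<in> cut M n"
    using val_cut[of "(One \<^bold>+ One) \<^bold>* Var 0" "case_nat m p"] m by simp
  have ab: "case_nat a (case_nat b p) v \<in> cut M n" if "row a" "col b" for a b v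
    using cut_less[OF that(1)[unfolded row_def] mm] cut_less[OF that(2)[unfolded col_def] m] p
    by (simp split: nat.split)
  \<comment> \<open>All arguments are dominated by 2m and m, which yields one bound on certificates
    for the whole array.\<close>
  have bound: "leq M (case_nat a (case_nat b p) v) (case_nat (times M two m) (case_nat m p) v)"
    if "row a" "col b" for a b v
    using that leq_refl unfolding row_def col_def leq_def by (simp split: nat.split)
  have bound_cut: "case_nat (times M two m) (case_nat m p) v \<in> cut M n" for v
    using m mm p by (simp split: nat.split)
  have SD: "S H a b" if "generic M n H" "\<tau> \<in> H" "D \<tau> a b" for H \<tau> a b
    using dec_sound[OF generic_filter[OF that(1)] that(2) that(3)[unfolded D_def]] unfolding S_def by simp
  have S\<psi>: "S H a b \<longleftrightarrow> sat M UNIV (RG H) (case_nat a (case_nat b p)) \<psi>"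
    if "generic M n H" "row a" "col b" for H a b
    using S12_sound[OF that(1) eqv ab[OF that(2,3)]]
    unfolding S_def sat_Iff sat_Sigma1b[OF \<phi> ab[OF that(2,3)]] sat_Pi1b[OF \<psi> ab[OF that(2,3)]] .
  have SN: "\<not> S H a b" if "generic M n H" "row a" "col b" "\<tau> \<in> H" "N \<tau> a b" for H \<tau> a b
    using dec_sound[OF generic_filter[OF that(1)] that(4) that(5)[unfolded N_def]]
    unfolding S\<psi>[OF that(1-3)] by simp
  have certS: "\<exists>\<tau>\<in>H. D \<tau> a b" if H: "generic M n H" and a: "row a" "col b" and "S H a b" for H a b
    unfolding D_def
    by (rule Sigma1b_certificate[where e = "case_nat a (case_nat b p)", OF H \<phi> ab[OF a]])
      (rule \<open>S H a b\<close>[unfolded S_def])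
  have certN: "\<exists>\<tau>\<in>H. N \<tau> a b" if H: "generic M n H" and a: "row a" "col b" and "\<not> S H a b" for H a b
    unfolding N_def
    by (rule Pi1b_certificate[where e = "case_nat a (case_nat b p)", OF H \<psi> ab[OF a]])
      (rule \<open>\<not> S H a b\<close>[unfolded S\<psi>[OF H a]])
  obtain k1 where k1: "small k1" "\<forall>e \<sigma>. (\<forall>v. leq M (e v) (case_nat (times M two m) (case_nat m p) v)) \<longrightarrow>
      \<sigma> \<in> C \<longrightarrow> cert \<sigma> True e \<phi> \<longrightarrow>
      (\<exists>\<tau>. sub M \<tau> \<sigma> \<and> card_le M \<tau> k1 \<and> cert \<tau> True e \<phi>)"
    using certificate_bound[of \<phi> True "case_nat (times M two m) (case_nat m p)", OF shrink_Sigma1b[OF \<phi>] bound_cut] by blast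
  obtain k0 where k0: "small k0" "\<forall>e \<sigma>. (\<forall>v. leq M (e v) (case_nat (times M two m) (case_nat m p) v)) \<longrightarrow>
      \<sigma> \<in> C \<longrightarrow> cert \<sigma> False e \<psi> \<longrightarrow>
      (\<exists>\<tau>. sub M \<tau> \<sigma> \<and> card_le M \<tau> k0 \<and> cert \<tau> False e \<psi>)"
    using certificate_bound[of \<psi> False "case_nat (times M two m) (case_nat m p)", OF shrink_Pi1b[OF \<psi>] bound_cut] by blast
  \<comment> \<open>A common bound for certificates of both kinds.\<close>
  define k where "k = plus M k1 k0"
  have k: "small k" unfolding k_def by (rule small_plus[OF k1(1) k0(1)])
  have shrinkD: "\<exists>\<tau>. sub M \<tau> \<pi> \<and> card_le M \<tau> k \<and> D \<tau> a b" if "row a" "col b" "\<pi> \<in> C" "D \<pi> a b" for a b \<pi>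
    using k1(2)[rule_format, OF bound[OF that(1,2)] that(3) that(4)[unfolded D_def]]
      card_le_mono[OF _ plus_ge(1)] unfolding D_def k_def by blast
  have shrinkN: "\<exists>\<tau>. sub M \<tau> \<pi> \<and> card_le M \<tau> k \<and> N \<tau> a b" if "row a" "col b" "\<pi> \<in> C" "N \<pi> a b" for a b \<pi>
    using k0(2)[rule_format, OF bound[OF that(1,2)] that(3) that(4)[unfolded N_def]]
      card_le_mono[OF _ plus_ge(2)] unfolding N_def k_def by blast
  have pinj\<sigma>: "pinj M n \<sigma>" using \<sigma> unfolding conditions_iff by blast
  have clash: False
    if a: "row a" and b: "col b" and u: "pinj M n u" "sub M \<sigma> u" "sub M c0 u" "sub M c1 u"
      and c: "card_le M c0 k" "card_le M c1 k" "N c0 a b" "D c1 a b" for a b u c0 c1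
  proof -
    \<comment> \<open>The partial injection u may be large, but c0, c1 and their union are
      conditions because k is small. A generic filter through the union would make \<phi>(a, b) both
      true and false.\<close>
    have "c0 \<in> C" "c1 \<in> C" using c(1,2) k pinj_sub[OF u(1,3)] pinj_sub[OF u(1,4)] unfolding conditions_iff by blast+
    then obtain v where v: "v \<in> C" "joins M v c0 c1" using compat_joins u unfolding compat_def by blast
    obtain H where H: "generic M n H" "v \<in> H" using generic_exists[OF count v(1)] by blast
    note HF = generic_filter[OF H(1)]
    have "S H a b" by (rule SD[OF H(1) filter_up[OF HF H(2) joins_sub(2)[OF v(2)]] c(4)])
    moreover have "\<not> S H a b" by (rule SN[OF H(1) a b filter_up[OF HF H(2) joins_sub(1)[OF v(2)]] c(3)])
    ultimately show False by blast
  qed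
  define good where "good a b = good_entry M n k \<sigma> (\<lambda>c. N c a b) (\<lambda>c. D c a b)" for a b
  from array_transfer[rule_format, OF pinj\<sigma>, where m = m and k = k and p = p and \<phi> = \<phi> and \<psi> = \<psi>,
      folded N_def D_def row_def col_def good_def]
  obtain A where A1: "\<And>z. z \<in> ext M A \<Longrightarrow> \<exists>a b s. row a \<and> col b \<and> z = pair M (pair M a b) s"
    and A2: "\<And>a b. row a \<Longrightarrow> col b \<Longrightarrow> \<exists>s. pair M (pair M a b) s \<in> ext M A \<and> good a b s"
    and A3: "\<And>a b s s'. pair M (pair M a b) s \<in> ext M A \<Longrightarrow> pair M (pair M a b) s' \<in> ext M A \<Longrightarrow> s = s'"
    using clash by blast
  obtain F where Fx: "\<And>a b. row a \<Longrightarrow> col b \<Longrightarrow> pair M (pair M a b) (F a b) \<in> ext M A \<and> good a b (F a b)"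
    using A2 by metis
  have extA: "ext M A = (\<lambda>(a, b). pair M (pair M a b) (F a b)) ` (Collect row \<times> Collect col)"
  proof (intro equalityI subsetI)
    fix z assume z: "z \<in> ext M A"
    then obtain a b s where abs: "row a" "col b" "z = pair M (pair M a b) s" using A1 by blast
    then have "s = F a b" using A3 Fx z by blast
    with abs show "z \<in> (\<lambda>(a, b). pair M (pair M a b) (F a b)) ` (Collect row \<times> Collect col)" by auto
  qed (use Fx in auto)
  define K where "K = times M two (times M k k)"
  have K: "small K" unfolding K_def by (intro small_times small_plus small_one k)
  define B where "B a b = ext M (F a b)" for a b
  have B1: "pinj M n \<tau> \<and> card_le M \<tau> K \<and> (\<exists>u. pinj M n u \<and> joins M u \<tau> \<sigma>) \<and>
      (\<forall>x. \<not> (x \<in> ext M \<tau> \<and> x \<in> ext M \<sigma>)) \<and>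
      (\<forall>u c. pinj M n u \<longrightarrow> sub M \<tau> u \<longrightarrow> sub M \<sigma> u \<longrightarrow> sub M c u \<longrightarrow> card_le M c k \<longrightarrow> \<not> N c a b)"
    if "row a" "col b" "\<tau> \<in> B a b" for a b \<tau>
    using conjunct1[OF conjunct2[OF Fx[OF that(1,2)], unfolded good_def good_entry_def]] that(3)
    unfolding B_def K_def by blast
  have B2: "\<tau> = \<tau>'" if "row a" "col b" "\<tau> \<in> B a b" "\<tau>' \<in> B a b" "compat M n \<tau> \<tau>'" for a b \<tau> \<tau>'
    using conjunct1[OF conjunct2[OF conjunct2[OF Fx[OF that(1,2)], unfolded good_def good_entry_def]]] that(3-5)
    unfolding B_def by blast
  have B3: "\<exists>\<tau>. \<tau> \<in> B a b \<and> compat M n \<tau> \<rho>"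
    if "row a" "col b" and \<rho>: "pinj M n \<rho>" "sub M \<sigma> \<rho>" "sub M c \<rho>" "card_le M c k" "D c a b"
      "card_le M \<rho> l" "leq M (plus M l K) n" for a b c l \<rho>
    unfolding B_def
    by (rule conjunct2[OF conjunct2[OF conjunct2[OF Fx[OF that(1,2)], unfolded good_def good_entry_def]],
        folded K_def, rule_format, OF \<rho>])
  have B_condition: "\<tau> \<in> C" if "row a" "col b" "\<tau> \<in> B a b" for a b \<tau>
    using B1[OF that] K unfolding conditions_iff by blast
  have B_compat: "compat M n \<tau> \<sigma>" if "row a" "col b" "\<tau> \<in> B a b" for a b \<tau>
    using B1[OF that] joins_sub unfolding compat_def by blast
  \<comment> \<open>Over \<sigma> the leaf \<tau> excludes certificates of \<not> \<psi>(a, b) with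
    at most k pairs. If \<phi>(a, b) failed, H would contain such a certificate, after shrinking,
    and a common extension with \<tau> and \<sigma>.\<close>
  have label: "S H a b" if H: "generic M n H" "\<tau> \<in> H" "\<sigma> \<in> H" and a: "row a" "col b" "\<tau> \<in> B a b" for H a b \<tau>
  proof (rule ccontr)
    assume "\<not> S H a b"
    then obtain \<nu> where \<nu>: "\<nu> \<in> H" "N \<nu> a b"
      using certN[OF H(1) a(1,2)] by blast
    note HF = generic_filter[OF H(1)]
    obtain c where c: "sub M c \<nu>" "card_le M c k" "N c a b"
      using shrinkN[OF a(1,2) filter_condition[OF HF \<nu>(1)] \<nu>(2)] by blast
    obtain u where u: "u \<in> C" "sub M \<tau> u" "sub M \<sigma> u" "sub M \<nu> u"
      using filter_directed3[OF HF H(2,3) \<nu>(1)] .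
    have "pinj M n u" using u(1) unfolding conditions_iff by blast
    with B1[OF a] u(2,3) sub_trans[OF c(1) u(4)] c(2,3) show False by blast
  qed
  \<comment> \<open>Two compatible leaves need not contain certificates of \<phi>. A generic filter
    through both of them and \<sigma> makes both instances true, and so supplies certificates with a
    common extension below \<sigma>.\<close>
  have certs: "\<exists>\<pi>. \<pi> \<in> C \<and> sub M \<sigma> \<pi> \<and> D \<pi> a b \<and> D \<pi> a' b'"
    if a: "row a" "col b" "\<tau> \<in> B a b" and a': "row a'" "col b'" "\<tau>' \<in> B a' b'" and comp: "compat M n \<tau> \<tau>'"
    for a b a' b' \<tau> \<tau>'
  proof -
    obtain u where u: "u \<in> C" "sub M \<tau> u" "sub M \<tau>' u" "sub M \<sigma> u"
      using join3[OF B_condition[OF a] B_condition[OF a'] \<sigma> comp B_compat[OF a] B_compat[OF a']] .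
    obtain H where H: "generic M n H" "u \<in> H" using generic_exists[OF count u(1)] by blast
    note HF = generic_filter[OF H(1)]
    note up = filter_up[OF HF H(2)]
    have "S H a b" "S H a' b'"
      by (rule label[OF H(1) up[OF u(2)] up[OF u(4)] a], rule label[OF H(1) up[OF u(3)] up[OF u(4)] a'])
    then obtain \<mu> \<mu>' where \<mu>: "\<mu> \<in> H" "D \<mu> a b" "\<mu>' \<in> H" "D \<mu>' a' b'"
      using certS[OF H(1) a(1,2)] certS[OF H(1) a'(1,2)] by blast
    obtain \<pi> where "\<pi> \<in> C" "sub M \<mu> \<pi>" "sub M \<mu>' \<pi>" "sub M \<sigma> \<pi>"
      using filter_directed3[OF HF \<mu>(1,3) up[OF u(4)]] .
    with \<mu>(2,4) dec_sub show ?thesis unfolding D_def by blast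
  qed
  \<comment> \<open>Injectivity identifies the rows; the leaves then belong to one entry, where
    compatible leaves are equal. Applied to a leaf and itself, this also shows that different
    entries of a column are disjoint.\<close>
  have same_col: "a = a' \<and> \<tau> = \<tau>'"
    if a: "row a" "col b" "\<tau> \<in> B a b" and a': "row a'" "\<tau>' \<in> B a' b" and comp: "compat M n \<tau> \<tau>'" for a a' b \<tau> \<tau>'
  proof -
    obtain \<pi> where "\<pi> \<in> C" "sub M \<sigma> \<pi>" "D \<pi> a b" "D \<pi> a' b"
      using certs[OF a a'(1) a(2) a'(2) comp] by blast
    then have "a = a'" using injective a(1,2) a'(1) by blast
    then show ?thesis using B2[OF a _ comp] a'(2) by blast
  qed
  have same_row: "b = b' \<and> \<tau> = \<tau>'"
    if a: "row a" "col b" "\<tau> \<in> B a b" and a': "col b'" "\<tau>' \<in> B a b'" and comp: "compat M n \<tau> \<tau>'" for a b b' \<tau> \<tau>'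
  proof -
    obtain \<pi> where "\<pi> \<in> C" "sub M \<sigma> \<pi>" "D \<pi> a b" "D \<pi> a b'"
      using certs[OF a a(1) a' comp] by blast
    then have "b = b'" using functional a(1,2) a'(1) by blast
    then show ?thesis using B2[OF a _ comp] a'(2) by blast
  qed
  have compat_refl: "compat M n \<tau> \<tau>" if "row a" "col b" "\<tau> \<in> B a b" for a b \<tau>
    using B1[OF that] sub_refl unfolding compat_def by blast
  have rows: "seg M (times M two m) = Collect row" unfolding seg_def row_def ..
  have cols: "seg M m = Collect col" unfolding seg_def col_def ..
  have "WPHP_array M n m K \<sigma> A"
    unfolding WPHP_array_def Let_def rows cols
  proof (intro exI[of _ F] conjI ballI impI)
    show "ext M A = (\<lambda>(a, b). pair M (pair M a b) (F a b)) ` (Collect row \<times> Collect col)" by (rule extA)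
  next
    fix a b \<tau> assume "a \<in> Collect row" "b \<in> Collect col" "\<tau> \<in> ext M (F a b)"
    then have t: "row a" "col b" "\<tau> \<in> B a b" unfolding B_def by simp_all
    show "\<tau> \<in> C" by (rule B_condition[OF t])
    show "\<exists>l. has_card M \<tau> l \<and> leq M l K" using B1[OF t] unfolding card_le_def by blast
    show "compatible M n \<tau> \<sigma>" using compatible_iff[OF B_condition[OF t] \<sigma>] B_compat[OF t] by blast
    show "ext M \<tau> \<inter> ext M \<sigma> = {}" using B1[OF t] by blast
  next
    fix a a' b assume "a \<in> Collect row" "a' \<in> Collect row" "b \<in> Collect col" "a \<noteq> a'"
    then show "ext M (F a b) \<inter> ext M (F a' b) = {}"
      using same_col compat_refl unfolding B_def by blast
  next
    fix a b b' assume "a \<in> Collect row" "b \<in> Collect col" "b' \<in> Collect col" "b \<noteq> b'"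
    then show "ext M (F a b) \<inter> ext M (F a b') = {}"
      using same_row compat_refl unfolding B_def by blast
  next
    fix a a' b \<tau> \<tau>' assume "a \<in> Collect row" "a' \<in> Collect row" "b \<in> Collect col"
      "\<tau> \<in> ext M (F a b)" "\<tau>' \<in> ext M (F a' b)" "\<tau> \<noteq> \<tau>'"
    then show "\<not> compatible M n \<tau> \<tau>'"
      using same_col[of a b \<tau> a' \<tau>'] compatible_iff[OF B_condition[of a b \<tau>] B_condition[of a' b \<tau>']]
      unfolding B_def by blast
  next
    fix a b b' \<tau> \<tau>' assume "a \<in> Collect row" "b \<in> Collect col" "b' \<in> Collect col"
      "\<tau> \<in> ext M (F a b)" "\<tau>' \<in> ext M (F a b')" "\<tau> \<noteq> \<tau>'"
    then show "\<not> compatible M n \<tau> \<tau>'"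
      using same_row[of a b \<tau> b' \<tau>'] compatible_iff[OF B_condition[of a b \<tau>] B_condition[of a b' \<tau>']]
      unfolding B_def by blast
  next
    fix \<rho> a assume \<rho>: "\<rho> \<in> C" "extends M \<rho> \<sigma>" and "a \<in> Collect row"
    then have a: "row a" by simp
    obtain \<pi> b where \<pi>: "\<pi> \<in> C" "sub M \<rho> \<pi>" "col b" "D \<pi> a b"
      using total[OF \<rho>(1) _ a] \<rho>(2) unfolding extends_iff by blast
    obtain c where c: "sub M c \<pi>" "card_le M c k" "D c a b" using shrinkD[OF a \<pi>(3,1,4)] by blast
    obtain l where l: "pinj M n \<pi>" "small l" "card_le M \<pi> l" using \<pi>(1) unfolding conditions_iff by blast
    have "sub M \<sigma> \<pi>" using \<rho>(2) sub_trans[OF _ \<pi>(2)] unfolding extends_iff by blast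
    from B3[OF a \<pi>(3) l(1) this c l(3) small_le_n[OF small_plus[OF l(2) K]]]
    obtain \<tau> where \<tau>: "\<tau> \<in> B a b" "compat M n \<tau> \<pi>" by blast
    have "compat M n \<tau> \<rho>" using \<tau>(2) sub_trans[OF \<pi>(2)] unfolding compat_def by blast
    then have "compatible M n \<tau> \<rho>" using compatible_iff[OF B_condition[OF a \<pi>(3) \<tau>(1)] \<rho>(1)] by blast
    then show "\<exists>b\<in>Collect col. \<exists>\<tau>\<in>ext M (F a b). compatible M n \<tau> \<rho>"
      using \<pi>(3) \<tau>(1) unfolding B_def by blast
  qed
  with \<sigma> K show ?thesis unfolding small_def by blast
qed

end

theorem theorem4p14:
  fixes M :: "'a interp" and n m :: 'a
  assumes "countable (UNIV :: 'a set)"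
    and "models_Th_N M"
    and "nonstandard M n"
    and "m \<in> cut M n"
    and "\<exists>\<phi>\<in>Delta1b. \<exists>p. (\<forall>i. p i \<in> cut M n) \<and>
           \<not> forces M n (zero M) (case_nat m p) (WPHP \<phi>)"
  shows "\<exists>\<sigma>\<in>conditions M n. \<exists>(c::nat) k. leq M k (len_pow M n c) \<and>
           (\<exists>A. WPHP_array M n m k \<sigma> A)"
proof -
  interpret forcing_setting M n
    by unfold_locales (rule assms(2), rule assms(3))
  obtain \<phi> p where \<phi>: "\<phi> \<in> Delta1b" and p: "\<And>i. p i \<in> cut M n"
    and nf: "\<not> forces M n (zero M) (case_nat m p) (WPHP \<phi>)"
    using assms(5) by blast
  from nf obtain G where G: "generic M n G" "\<not> sat M (cut M n) (\<Union>\<tau>\<in>G. graph M \<tau>) (case_nat m p) (WPHP \<phi>)"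
    unfolding forces_def by blast
  from \<phi> obtain \<psi> where "\<phi> \<in> Sigma1b" "\<psi> \<in> Pi1b" "S12 \<turnstile> (\<phi> \<^bold>\<longleftrightarrow> \<psi>)" unfolding Delta1b_def by blast
  from WPHP_array_exists[OF assms(1,4) p this G] show ?thesis .
qed

end
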